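(* Let $\mathcal H$ be a complex separable Hilbert space, $H_0$ a self-adjoint operator in $\mathcal H$, and $K\in\mathcal B_2(\mathcal H)$ a Hilbert-Schmidt operator. For $s\in[0,1]$ let $E_{H_0+sKK^*}(\cdot)$ denote the family of spectral projections of the self-adjoint operator $H_0+sKK^*$ (with domain $\operatorname{dom}(H_0)$). Then $$\int_0^1 ds\,d(K^*E_{H_0+sKK^*}(\lambda)K)=\Xi(\lambda)\,d\lambda$$ as operator-valued measures on $\mathbb R$ in the weak sense (i.e. for all $f,g\in\mathcal H$ and all Borel sets $\Delta\subseteq\mathbb R$, $\int_0^1 ds\,(f,K^*E_{H_0+sKK^*}(\Delta)Kg)_{\mathcal H}=\int_\Delta d\lambda\,(f,\Xi(\lambda)g)_{\mathcal H}$), where $\Xi(\cdot)$ is the spectral shift operator associated with $$\Phi(z)=I_{\mathcal H}+K^*(H_0-z)^{-1}K,\quad z\in\mathbb C\setminus\mathbb R,$$ that is, $$\log(\Phi(z))=\int_{\mathbb R}d\lambda\,\Xi(\lambda)(\lambda-z)^{-1},\quad z\in\mathbb C\setminus\mathbb R,$$ $$0\le\Xi(\lambda)\in\mathcal B_1(\mathcal H)\text{ for a.e. }\lambda\in\mathbb R,\qquad \|\Xi(\cdot)\|_1\in L^1(\mathbb R;d\lambda).$$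
   Context: $\mathcal B(\mathcal H),\mathcal B_1(\mathcal H),\mathcal B_2(\mathcal H)$ denote bounded, trace class (norm $\|\cdot\|_1$) and Hilbert-Schmidt operators; $\operatorname{Im}(T)=(T-T^* )/(2i)$. For $z\in\mathbb C\setminus\mathbb R$ the operator $\Phi(z)$ is boundedly invertible, with $\operatorname{Im}(\Phi(z))\ge0$ if $\operatorname{Im}(z)>0$ and $\operatorname{Im}(\Phi(z))\le0$ if $\operatorname{Im}(z)<0$. For a bounded, boundedly invertible $T$ with $\operatorname{Im}(T)\ge0$, $\log(T)=-i\int_0^\infty d\lambda\,((T+i\lambda)^{-1}-(1+i\lambda)^{-1}I_{\mathcal H})$ (norm convergent Riemann integral); for a bounded, boundedly invertible $S$ with $\operatorname{Im}(S)\le0$, $\log(S)=(\log(S^* ))^*$. The family $\Xi(\lambda)$ is weakly measurable, satisfies $0\le\Xi(\lambda)\le I_{\mathcal H}$ a.e., and is determined up to a.e. equality by the displayed representation of $\log(\Phi(z))$, in which the integral is taken in the weak sense. *)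

theory Defs
  imports "HOL-Analysis.Analysis"
begin

text \<open>
  Complex Hilbert spaces. The inner product is linear in the \<^emph>\<open>second\<close> argument. Separability is
  not part of the class; it is added as the sort constraint \<^class>\<open>second_countable_topology\<close>.
  The last axiom contains positive definiteness, because the norm vanishes only at 0.
\<close>

class complex_hilbert = banach +
  fixes scaleC :: "complex \<Rightarrow> 'a \<Rightarrow> 'a"  (infixr "*\<^sub>C" 75)
    and cinner :: "'a \<Rightarrow> 'a \<Rightarrow> complex"
  assumes scaleC_add_right: "c *\<^sub>C (x + y) = c *\<^sub>C x + c *\<^sub>C y"
    and scaleC_add_left: "(c + d) *\<^sub>C x = c *\<^sub>C x + d *\<^sub>C x"
    and scaleC_scaleC: "c *\<^sub>C (d *\<^sub>C x) = (c * d) *\<^sub>C x"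
    and scaleC_of_real: "complex_of_real r *\<^sub>C x = r *\<^sub>R x"
    and cinner_commute: "cinner x y = cnj (cinner y x)"
    and cinner_add_right: "cinner x (y + z) = cinner x y + cinner x z"
    and cinner_scaleC_right: "cinner x (c *\<^sub>C y) = c * cinner x y"
    and cinner_self: "cinner x x = complex_of_real ((norm x)\<^sup>2)"

instantiation complex :: complex_hilbert
begin

definition scaleC_complex :: "complex \<Rightarrow> complex \<Rightarrow> complex" where
  "scaleC_complex c x = c * x"

definition cinner_complex :: "complex \<Rightarrow> complex \<Rightarrow> complex" where
  "cinner_complex x y = cnj x * y"

instance
  by standard
    (auto simp: scaleC_complex_def cinner_complex_def algebra_simps scaleR_conv_of_real
      complex_norm_square[unfolded of_real_power])

end


subsection \<open>Bounded operators\<close>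

text \<open>
  The library type of bounded linear maps consists of the \<^emph>\<open>real\<close>-linear ones. An element of
  B(H) is such a map that is moreover complex-linear; all predicates below that single out classes
  of operators include this requirement.
\<close>

definition clinear_op :: "('a::complex_hilbert \<Rightarrow>\<^sub>L 'a) \<Rightarrow> bool" where
  "clinear_op T \<longleftrightarrow> (\<forall>c x. T (c *\<^sub>C x) = c *\<^sub>C T x)"

definition scalar_op :: "complex \<Rightarrow> 'a::complex_hilbert \<Rightarrow>\<^sub>L 'a" where
  "scalar_op c = Blinfun (\<lambda>x. c *\<^sub>C x)"

definition adj :: "('a::complex_hilbert \<Rightarrow>\<^sub>L 'a) \<Rightarrow> ('a \<Rightarrow>\<^sub>L 'a)" where
  "adj T = (THE S :: 'a \<Rightarrow>\<^sub>L 'a. \<forall>x y. cinner (T x) y = cinner x (S y))"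

definition op_inv :: "('a::complex_hilbert \<Rightarrow>\<^sub>L 'a) \<Rightarrow> ('a \<Rightarrow>\<^sub>L 'a)" where
  "op_inv T = (THE S. S o\<^sub>L T = id_blinfun \<and> T o\<^sub>L S = id_blinfun)"

definition im_op :: "('a::complex_hilbert \<Rightarrow>\<^sub>L 'a) \<Rightarrow> ('a \<Rightarrow>\<^sub>L 'a)" where
  "im_op T = scalar_op (1 / (2 * \<i>)) o\<^sub>L (T - adj T)"

definition op_nonneg :: "('a::complex_hilbert \<Rightarrow>\<^sub>L 'a) \<Rightarrow> bool" where
  "op_nonneg T \<longleftrightarrow> clinear_op T \<and> (\<forall>x. cinner x (T x) \<in> \<real>\<^sub>\<ge>\<^sub>0)"

definition op_le :: "('a::complex_hilbert \<Rightarrow>\<^sub>L 'a) \<Rightarrow> ('a \<Rightarrow>\<^sub>L 'a) \<Rightarrow> bool" where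
  "op_le S T \<longleftrightarrow> op_nonneg (T - S)"

text \<open>The absolute value: the unique nonnegative square root of \<open>T\<^sup>* T\<close>.\<close>

definition op_abs :: "('a::complex_hilbert \<Rightarrow>\<^sub>L 'a) \<Rightarrow> ('a \<Rightarrow>\<^sub>L 'a)" where
  "op_abs T = (THE P. op_nonneg P \<and> P o\<^sub>L P = adj T o\<^sub>L T)"

text \<open>Orthonormal bases, as maximal orthonormal sets.\<close>

definition is_onb :: "'a::complex_hilbert set \<Rightarrow> bool" where
  "is_onb B \<longleftrightarrow>
     (\<forall>e\<in>B. \<forall>e'\<in>B. cinner e e' = (if e = e' then 1 else 0)) \<and>
     (\<forall>x. (\<forall>e\<in>B. cinner e x = 0) \<longrightarrow> x = 0)"

text \<open>
  Summability in the next two definitions does not depend on the orthonormal basis, and neither does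
  the sum in the third one. The trace norm is meaningful for trace class operators only.
\<close>

definition hilbert_schmidt :: "('a::complex_hilbert \<Rightarrow>\<^sub>L 'a) \<Rightarrow> bool" where
  "hilbert_schmidt T \<longleftrightarrow>
     clinear_op T \<and> (\<exists>B. is_onb B \<and> (\<lambda>e. (norm (T e))\<^sup>2) summable_on B)"

definition trace_class :: "('a::complex_hilbert \<Rightarrow>\<^sub>L 'a) \<Rightarrow> bool" where
  "trace_class T \<longleftrightarrow>
     clinear_op T \<and> (\<exists>B. is_onb B \<and> (\<lambda>e. Re (cinner e (op_abs T e))) summable_on B)"

definition trace_norm :: "('a::complex_hilbert \<Rightarrow>\<^sub>L 'a) \<Rightarrow> real" where
  "trace_norm T = infsum (\<lambda>e. Re (cinner e (op_abs T e))) (SOME B. is_onb B)"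


subsection \<open>The operator logarithm\<close>

text \<open>
  \<open>log_upper\<close> is for \<open>Im T \<ge> 0\<close>. The Henstock-Kurzweil integral over \<open>[0, \<infinity>)\<close>, taken in the
  operator norm, agrees with the improper Riemann integral: the integrand is norm continuous and
  \<open>O(\<lambda>\<^sup>-\<^sup>2)\<close>.
\<close>

definition log_upper :: "('a::complex_hilbert \<Rightarrow>\<^sub>L 'a) \<Rightarrow> ('a \<Rightarrow>\<^sub>L 'a)" where
  "log_upper T = scalar_op (- \<i>) o\<^sub>L
     integral {0..} (\<lambda>l::real. op_inv (T + scalar_op (\<i> * complex_of_real l))
                               - scalar_op (inverse (1 + \<i> * complex_of_real l)))"

text \<open>
  The second branch is for \<open>Im T \<le> 0\<close>. An operator with \<open>Im T = 0\<close> is sent to the first branch;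
  the two branches agree on positive boundedly invertible operators.
\<close>

definition op_log :: "('a::complex_hilbert \<Rightarrow>\<^sub>L 'a) \<Rightarrow> ('a \<Rightarrow>\<^sub>L 'a)" where
  "op_log T = (if op_nonneg (im_op T) then log_upper T else adj (log_upper (adj T)))"


subsection \<open>Unbounded self-adjoint operators\<close>

text \<open>
  An unbounded operator is given by its domain \<open>D\<close> and a function \<open>H\<close>, of which only the values
  on \<open>D\<close> matter. The last conjunct says that the graph of the adjoint is the graph of \<open>H\<close>.
\<close>

definition selfadjoint :: "'a::complex_hilbert set \<Rightarrow> ('a \<Rightarrow> 'a) \<Rightarrow> bool" where
  "selfadjoint D H \<longleftrightarrow>
     0 \<in> D \<and> (\<forall>x\<in>D. \<forall>y\<in>D. x + y \<in> D \<and> H (x + y) = H x + H y) \<and>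
     (\<forall>c. \<forall>x\<in>D. c *\<^sub>C x \<in> D \<and> H (c *\<^sub>C x) = c *\<^sub>C H x) \<and>
     closure D = UNIV \<and>
     (\<forall>x y. (\<forall>u\<in>D. cinner y u = cinner x (H u)) \<longleftrightarrow> x \<in> D \<and> y = H x)"

text \<open>\<open>(H - z)\<^sup>-\<^sup>1\<close>\<close>

definition resolvent :: "'a::complex_hilbert set \<Rightarrow> ('a \<Rightarrow> 'a) \<Rightarrow> complex \<Rightarrow> ('a \<Rightarrow>\<^sub>L 'a)" where
  "resolvent D H z = (THE R :: 'a \<Rightarrow>\<^sub>L 'a. (\<forall>x. R x \<in> D \<and> H (R x) - z *\<^sub>C R x = x) \<and>
                             (\<forall>u\<in>D. R (H u - z *\<^sub>C u) = u))"

definition is_projection :: "('a::complex_hilbert \<Rightarrow>\<^sub>L 'a) \<Rightarrow> bool" where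
  "is_projection P \<longleftrightarrow> clinear_op P \<and> P o\<^sub>L P = P \<and> adj P = P"

definition is_pvm :: "(real set \<Rightarrow> ('a::complex_hilbert \<Rightarrow>\<^sub>L 'a)) \<Rightarrow> bool" where
  "is_pvm E \<longleftrightarrow>
     (\<forall>\<Delta>\<in>sets borel. is_projection (E \<Delta>)) \<and> E {} = 0 \<and> E UNIV = id_blinfun \<and>
     (\<forall>\<Delta>\<in>sets borel. \<forall>\<Gamma>\<in>sets borel. E (\<Delta> \<inter> \<Gamma>) = E \<Delta> o\<^sub>L E \<Gamma>) \<and>
     (\<forall>F :: nat \<Rightarrow> real set. range F \<subseteq> sets borel \<longrightarrow> disjoint_family F \<longrightarrow>
        (\<forall>x. (\<lambda>n. E (F n) x) sums E (\<Union>n. F n) x))"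

definition scalar_spectral_measure ::
  "(real set \<Rightarrow> ('a::complex_hilbert \<Rightarrow>\<^sub>L 'a)) \<Rightarrow> 'a \<Rightarrow> real measure" where
  "scalar_spectral_measure E x =
     measure_of UNIV (sets borel) (\<lambda>\<Delta>. ennreal (Re (cinner x (E \<Delta> x))))"

text \<open>
  \<open>E\<close> is the family of spectral projections of the self-adjoint operator \<open>H\<close> with domain \<open>D\<close>,
  i.e. \<open>H = \<integral> \<lambda> dE(\<lambda>)\<close>: the domain is \<open>{x. \<integral> \<lambda>\<^sup>2 d(x, E(\<lambda>) x) < \<infinity>}\<close>, and on it
  \<open>(x, H x) = \<integral> \<lambda> d(x, E(\<lambda>) x)\<close>, which determines \<open>H\<close> by polarization. By the spectral theorem,
  such an \<open>E\<close> exists and is unique on Borel sets.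
\<close>

definition spectral_family ::
  "'a::complex_hilbert set \<Rightarrow> ('a \<Rightarrow> 'a) \<Rightarrow> (real set \<Rightarrow> ('a \<Rightarrow>\<^sub>L 'a)) \<Rightarrow> bool" where
  "spectral_family D H E \<longleftrightarrow>
     is_pvm E \<and>
     D = {x. (\<integral>\<^sup>+l. ennreal (l\<^sup>2) \<partial>scalar_spectral_measure E x) < \<infinity>} \<and>
     (\<forall>x\<in>D. cinner x (H x) = complex_of_real (LINT l|scalar_spectral_measure E x. l))"


subsection \<open>The spectral shift operator\<close>

definition weakly_measurable :: "(real \<Rightarrow> ('a::complex_hilbert \<Rightarrow>\<^sub>L 'a)) \<Rightarrow> bool" where
  "weakly_measurable X \<longleftrightarrow> (\<forall>f g. (\<lambda>l. cinner f (X l g)) \<in> borel_measurable lebesgue)"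

definition is_spectral_shift_operator ::
  "(complex \<Rightarrow> ('a::complex_hilbert \<Rightarrow>\<^sub>L 'a)) \<Rightarrow> (real \<Rightarrow> ('a \<Rightarrow>\<^sub>L 'a)) \<Rightarrow> bool" where
  "is_spectral_shift_operator \<Phi> \<Xi> \<longleftrightarrow>
     weakly_measurable \<Xi> \<and>
     (AE l in lebesgue. op_le 0 (\<Xi> l) \<and> op_le (\<Xi> l) id_blinfun) \<and>
     (\<forall>z. z \<notin> \<real> \<longrightarrow> (\<forall>f g.
        has_bochner_integral lebesgue
          (\<lambda>l. cinner f (\<Xi> l g) * inverse (complex_of_real l - z))
          (cinner f (op_log (\<Phi> z) g))))"

end

theory Submission
  imports Defs "HOL-Complex_Analysis.Complex_Analysis"
begin

text \<open>
  Put \<open>H\<^sub>s = H\<^sub>0 + s K K\<^sup>*\<close> and \<open>M\<^sub>s(z) = K\<^sup>* (H\<^sub>s - z)\<^sup>-\<^sup>1 K\<close>. The second resolvent identity gives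
  \<open>M\<^sub>s (1 + s M\<^sub>0) = M\<^sub>0\<close>, so \<open>M\<^sub>s\<close> is the derivative of \<open>log (1 + s M\<^sub>0)\<close> in \<open>s\<close> and
  \<open>log \<Phi>(z) = \<integral>\<^sub>0\<^sup>1 M\<^sub>s(z) ds\<close>. Hence \<open>\<langle>f, log \<Phi>(z) f\<rangle>\<close> is the Stieltjes transform of the averaged spectral
  measure \<open>\<mu>\<^sub>f\<close>. Since the imaginary part of \<open>log \<Phi>(z)\<close> is at most \<open>\<pi>\<close> in the upper half plane,
  Stieltjes inversion gives \<open>\<mu>\<^sub>f(a, b] \<le> (b - a) \<parallel>f\<parallel>\<^sup>2\<close>. Differentiating \<open>\<mu>\<^sub>f\<close> along dyadic intervals for
  \<open>f\<close> in a countable dense set yields \<open>0 \<le> \<Xi> \<le> 1\<close> almost everywhere. Uniqueness of the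
  Stieltjes transform identifies \<open>\<mu>\<^sub>f\<close> with \<open>\<langle>f, \<Xi>(\<lambda>) f\<rangle> d\<lambda>\<close> for every spectral shift operator, and the trace norm
  is integrable because \<open>\<mu>\<^sub>f(\<real>) = \<parallel>K f\<parallel>\<^sup>2\<close> is summable over an orthonormal basis.
\<close>

section \<open>Complex Hilbert spaces\<close>

text \<open>The bound by pi cannot be read off the integral that defines the logarithm. It rests on
  (1 + s A)^{-1} = 1 - s M_s with A = M_0(z), hence on s^2 Im <f, M_s f> = - Im <f, (A + 1/s)^{-1}
  f>. Substituting t = 1/s turns the integral over the coupling into one over t >= 1 of the form of
  a resolvent of a dissipative operator, and a contour deformation compares it with ||f||^2 times an
  increment of the argument. \<open>spectral_family\<close> speaks only of the domain and the
  diagonal form of H, so the resolvent formula has to be earned: E is shown to commute with H, and H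
  is then nearly constant on the range of E of a short interval. Nothing is assumed about the
  dependence of E_s on s. Its measurability comes from Stieltjes inversion, because resolvents
  depend continuously on s. The exceptional null set of the differentiation must not depend on f.
  Therefore countably many vectors share one subsequence, and uniform bounds extend the limit to all
  vectors. Measures are handled on the diagonal, and polarization recovers the rest.\<close>

lemma cinner_add_left: "cinner (x + y) z = cinner x z + cinner y z"
  by (metis cinner_commute cinner_add_right complex_cnj_add)

lemma cinner_scaleC_left: "cinner (c *\<^sub>C x) y = cnj c * cinner x y"
  by (metis cinner_commute cinner_scaleC_right complex_cnj_mult)

lemma cinner_scaleR_right: "cinner x (r *\<^sub>R y) = complex_of_real r * cinner x y"
  by (metis scaleC_of_real cinner_scaleC_right)

lemma cinner_scaleR_left: "cinner (r *\<^sub>R x) y = complex_of_real r * cinner x y"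
  by (metis scaleC_of_real cinner_scaleC_left complex_cnj_complex_of_real)

lemma cinner_zero_right [simp]: "cinner x 0 = 0"
  using cinner_scaleR_right[of x 0 0] by simp

lemma cinner_zero_left [simp]: "cinner 0 x = 0"
  using cinner_scaleR_left[of 0 0 x] by simp

lemma cinner_minus_right: "cinner x (- y) = - cinner x y"
  using cinner_scaleR_right[of x "-1" y] by simp

lemma cinner_minus_left: "cinner (- x) y = - cinner x y"
  using cinner_scaleR_left[of "-1" x y] by simp

lemma cinner_diff_right: "cinner x (y - z) = cinner x y - cinner x z"
  using cinner_add_right[of x y "- z"] by (simp add: cinner_minus_right)

lemma cinner_diff_left: "cinner (x - y) z = cinner x z - cinner y z"
  using cinner_add_left[of x "- y" z] by (simp add: cinner_minus_left)

lemmas cinner_simps =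
  cinner_add_left cinner_add_right cinner_diff_left cinner_diff_right cinner_minus_left
  cinner_minus_right cinner_scaleC_left cinner_scaleC_right cinner_scaleR_left cinner_scaleR_right

lemma cinner_sum_right: "cinner x (sum f A) = (\<Sum>i\<in>A. cinner x (f i))"
  by (induction A rule: infinite_finite_induct) (auto simp: cinner_add_right)

lemma cinner_sum_left: "cinner (sum f A) x = (\<Sum>i\<in>A. cinner (f i) x)"
  by (induction A rule: infinite_finite_induct) (auto simp: cinner_add_left)

lemma Re_cinner_self: "Re (cinner x x) = (norm x)\<^sup>2"
  by (simp add: cinner_self)

lemma cinner_self_eq_0: "cinner x x = 0 \<longleftrightarrow> x = 0"
  by (simp add: cinner_self)

lemma cinner_ext: "(\<And>u. cinner u x = cinner u y) \<Longrightarrow> x = y"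
  by (metis cinner_diff_right cinner_self_eq_0 eq_iff_diff_eq_0)

lemma scaleC_zero_right [simp]: "c *\<^sub>C (0::'a::complex_hilbert) = 0"
  by (rule cinner_ext) (simp add: cinner_simps)

lemma scaleC_zero_left [simp]: "0 *\<^sub>C (x::'a::complex_hilbert) = 0"
  by (rule cinner_ext) (simp add: cinner_simps)

lemma scaleC_one [simp]: "1 *\<^sub>C (x::'a::complex_hilbert) = x"
  by (rule cinner_ext) (simp add: cinner_simps)

lemma scaleC_minus_left: "(- c) *\<^sub>C (x::'a::complex_hilbert) = - (c *\<^sub>C x)"
  by (rule cinner_ext) (simp add: cinner_simps)

lemma scaleC_minus_one: "(- 1) *\<^sub>C (x::'a::complex_hilbert) = - x"
  by (simp add: scaleC_minus_left)

lemma scaleC_diff_right: "c *\<^sub>C (x - y::'a::complex_hilbert) = c *\<^sub>C x - c *\<^sub>C y"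
  by (rule cinner_ext) (simp add: cinner_simps algebra_simps)

lemma scaleC_diff_left: "(c - d) *\<^sub>C (x::'a::complex_hilbert) = c *\<^sub>C x - d *\<^sub>C x"
  by (rule cinner_ext) (simp add: cinner_simps algebra_simps)

lemma norm_scaleC: "norm (c *\<^sub>C (x::'a::complex_hilbert)) = cmod c * norm x"
proof -
  have "complex_of_real ((norm (c *\<^sub>C x))\<^sup>2) = complex_of_real ((cmod c * norm x)\<^sup>2)"
    unfolding cinner_self[symmetric] cinner_simps
    by (simp add: cinner_self power_mult_distrib complex_norm_square[unfolded of_real_power] mult_ac)
  then have "(norm (c *\<^sub>C x))\<^sup>2 = (cmod c * norm x)\<^sup>2"
    by (metis of_real_eq_iff)
  then show ?thesis by (simp add: power2_eq_iff_nonneg)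
qed

section \<open>Sesquilinear forms: polarization and the Cauchy-Schwarz inequality\<close>

definition sesquilinear :: "('a::complex_hilbert \<Rightarrow> 'a \<Rightarrow> complex) \<Rightarrow> bool" where
  "sesquilinear B \<longleftrightarrow>
     (\<forall>x y z. B (x + y) z = B x z + B y z) \<and> (\<forall>x y z. B x (y + z) = B x y + B x z) \<and>
     (\<forall>c x y. B (c *\<^sub>C x) y = cnj c * B x y) \<and> (\<forall>c x y. B x (c *\<^sub>C y) = c * B x y)"

lemma sesquilinearI:
  assumes "\<And>x y z. B (x + y) z = B x z + B y z" "\<And>x y z. B x (y + z) = B x y + B x z"
    "\<And>c x y. B (c *\<^sub>C x) y = cnj c * B x y" "\<And>c x y. B x (c *\<^sub>C y) = c * B x y"
  shows "sesquilinear B"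
  using assms by (auto simp: sesquilinear_def)

lemma sesquilinearD:
  assumes "sesquilinear B"
  shows "B (x + y) z = B x z + B y z" "B x (y + z) = B x y + B x z"
    "B (c *\<^sub>C x) y = cnj c * B x y" "B x (c *\<^sub>C y) = c * B x y"
    "B (- x) y = - B x y" "B x (- y) = - B x y"
    "B (x - y) z = B x z - B y z" "B x (y - z) = B x y - B x z"
    "B 0 y = 0" "B x 0 = 0"
proof -
  show *: "B (x + y) z = B x z + B y z" "B x (y + z) = B x y + B x z"
    "B (c *\<^sub>C x) y = cnj c * B x y" "B x (c *\<^sub>C y) = c * B x y" for x y z c
    using assms by (auto simp: sesquilinear_def)
  show **: "B (- x) y = - B x y" "B x (- y) = - B x y" for x y
    using *(3)[of "-1" x y] *(4)[of x "-1" y] by (auto simp: scaleC_minus_one)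
  show "B (x - y) z = B x z - B y z" "B x (y - z) = B x y - B x z"
    using *(1)[of x "- y" z] *(2)[of x y "- z"] by (auto simp: **)
  show "B 0 y = 0" "B x 0 = 0"
    using *(3)[of 0 0 y] *(4)[of x 0 0] by auto
qed

lemma sesquilinear_cinner: "sesquilinear cinner"
  by (rule sesquilinearI) (auto simp: cinner_simps)

text \<open>The form is conjugate-linear on the left, which fixes the signs of the two imaginary
  terms. Weak identities are reduced by it to the diagonal, where the forms of this proof become
  measures and real functions.\<close>

lemma sesquilinear_polarization:
  assumes "sesquilinear B"
  shows "B x y = (B (x + y) (x + y) - B (x - y) (x - y)
    - \<i> * B (x + \<i> *\<^sub>C y) (x + \<i> *\<^sub>C y) + \<i> * B (x - \<i> *\<^sub>C y) (x - \<i> *\<^sub>C y)) / 4"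
  by (simp add: sesquilinearD[OF assms] algebra_simps)

lemma sesquilinear_eqI:
  assumes "sesquilinear B" "sesquilinear B'" "\<And>x. B x x = B' x x"
  shows "B x y = B' x y"
  by (subst (1 2) sesquilinear_polarization) (simp_all only: assms)

text \<open>The conjugate transpose agrees with the form on the diagonal, hence everywhere by
  polarization.\<close>

lemma sesquilinear_hermitian:
  assumes B: "sesquilinear B" and real: "\<And>x. B x x \<in> \<real>"
  shows "B y x = cnj (B x y)"
proof -
  have s: "sesquilinear (\<lambda>x y. cnj (B y x))"
    by (rule sesquilinearI) (auto simp: sesquilinearD[OF B])
  show ?thesis
    by (rule sesquilinear_eqI[OF B s]) (use real in \<open>simp add: Reals_cnj_iff\<close>)
qed

text \<open>Semidefiniteness suffices, with vectors of zero form treated apart. Forms built from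
  spectral projections, to which this is applied later, may degenerate.\<close>

lemma sesquilinear_Cauchy_Schwarz:
  assumes B: "sesquilinear B" and pos: "\<And>x. B x x \<in> \<real>\<^sub>\<ge>\<^sub>0"
  shows "(cmod (B x y))\<^sup>2 \<le> Re (B x x) * Re (B y y)"
proof -
  define b where "b = B x y"
  have re: "B z z \<in> \<real>" for z using pos nonneg_Reals_subset_Reals by blast
  have h: "B y x = cnj b" unfolding b_def by (rule sesquilinear_hermitian[OF B re])
  have nn: "0 \<le> Re (B z z)" for z using pos[of z] by (simp add: complex_nonneg_Reals_iff)
  have key: "0 \<le> Re (B x x) - 2 * t * (cmod b)\<^sup>2 + t\<^sup>2 * (cmod b)\<^sup>2 * Re (B y y)" for t :: real
  proof -
    \<comment> \<open>The factor \<open>cnj b\<close> makes both cross terms equal to the real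
      number - t |b|^2, so a real quadratic in t remains.\<close>
    define c where "c = - complex_of_real t * cnj b"
    have cb: "c * b = - complex_of_real (t * (cmod b)\<^sup>2)"
      unfolding c_def complex_norm_square of_real_mult by (simp add: mult_ac)
    have cc: "cnj c * c = complex_of_real (t\<^sup>2 * (cmod b)\<^sup>2)"
      unfolding c_def complex_norm_square of_real_mult by (simp add: mult_ac power2_eq_square)
    have "B (x + c *\<^sub>C y) (x + c *\<^sub>C y) = B x x + c * b + cnj (c * b) + (cnj c * c) * B y y"
      by (simp add: sesquilinearD[OF B] h b_def[symmetric] algebra_simps)
    also have "Re \<dots> = Re (B x x) - 2 * t * (cmod b)\<^sup>2 + t\<^sup>2 * (cmod b)\<^sup>2 * Re (B y y)"
      unfolding cb cc by simp
    finally show ?thesis using nn by metis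
  qed
  show ?thesis
  proof (cases "Re (B y y) = 0")
    case True
    have "2 * t * (cmod b)\<^sup>2 \<le> Re (B x x)" for t using key[of t] True by simp
    \<comment> \<open>With this t the left side is Re (B x x) + 1, which is impossible unless b =
      0.\<close>
    from this[of "(Re (B x x) + 1) / (2 * (cmod b)\<^sup>2)"] have "b = 0"
      by (cases "b = 0") auto
    then show ?thesis using nn True by (simp add: b_def)
  next
    case False
    then have p: "Re (B y y) > 0" using nn[of y] by simp
    have "0 \<le> Re (B x x) - (cmod b)\<^sup>2 / Re (B y y)"
      using key[of "1 / Re (B y y)"] p by (simp add: power2_eq_square field_simps)
    then show ?thesis using p by (simp add: b_def field_simps)
  qed
qed

lemma cinner_Cauchy_Schwarz: "cmod (cinner x y) \<le> norm x * norm y"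
proof -
  have "(cmod (cinner x y))\<^sup>2 \<le> Re (cinner x x) * Re (cinner y y)"
    by (rule sesquilinear_Cauchy_Schwarz[OF sesquilinear_cinner])
       (simp add: cinner_self)
  then have "(cmod (cinner x y))\<^sup>2 \<le> (norm x * norm y)\<^sup>2"
    by (simp add: Re_cinner_self power_mult_distrib)
  then show ?thesis by (rule power2_le_imp_le) simp
qed

lemma norm_le_if_cinner_le:
  assumes "0 \<le> C" "\<And>u. cmod (cinner u x) \<le> C * norm u"
  shows "norm x \<le> C"
proof -
  have "(norm x)\<^sup>2 \<le> C * norm x"
    using assms(2)[of x] by (simp add: cinner_self norm_power)
  then show ?thesis using assms(1)
    by (cases "x = 0") (auto simp: power2_eq_square)
qed

lemma bounded_bilinear_cinner: "bounded_bilinear cinner"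
proof
  show "\<exists>K. \<forall>a b. norm (cinner a b) \<le> norm a * norm b * K"
    by (rule exI[of _ 1]) (simp add: cinner_Cauchy_Schwarz)
qed (auto simp: cinner_simps scaleR_conv_of_real)

lemmas continuous_on_cinner [continuous_intros] = bounded_bilinear.continuous_on[OF bounded_bilinear_cinner]
lemmas tendsto_cinner [tendsto_intros] = bounded_bilinear.tendsto[OF bounded_bilinear_cinner]
lemmas bounded_linear_cinner_right = bounded_bilinear.bounded_linear_right[OF bounded_bilinear_cinner]

lemma bounded_linear_scaleC: "bounded_linear (\<lambda>x::'a::complex_hilbert. c *\<^sub>C x)"
proof
  show "\<exists>K. \<forall>x::'a. norm (c *\<^sub>C x) \<le> norm x * K"
    by (rule exI[of _ "cmod c"]) (simp add: norm_scaleC)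
  show "c *\<^sub>C (r *\<^sub>R x) = r *\<^sub>R (c *\<^sub>C x)" for r and x :: 'a
    by (rule cinner_ext) (simp add: cinner_simps)
qed (rule scaleC_add_right)

lemmas tendsto_scaleC_right = bounded_linear.tendsto[OF bounded_linear_scaleC]

lemma norm_diff_sq:
  "(norm (x - y::'a::complex_hilbert))\<^sup>2 = (norm x)\<^sup>2 - 2 * Re (cinner x y) + (norm y)\<^sup>2"
proof -
  have "cnj (cinner x y) = cinner y x" by (metis cinner_commute)
  then have "Re (cinner y x) = Re (cinner x y)" by (metis complex_cnj(1) cnj.sel(1))
  then show ?thesis by (simp add: Re_cinner_self[symmetric] cinner_simps)
qed

lemma norm_add_sq:
  "(norm (x + y::'a::complex_hilbert))\<^sup>2 = (norm x)\<^sup>2 + 2 * Re (cinner x y) + (norm y)\<^sup>2"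
  using norm_diff_sq[of x "- y"] by (simp add: cinner_simps)

subsection \<open>Orthogonal projection and the Riesz representation\<close>

definition csubspace :: "'a::complex_hilbert set \<Rightarrow> bool" where
  "csubspace M \<longleftrightarrow> 0 \<in> M \<and> (\<forall>x\<in>M. \<forall>y\<in>M. x + y \<in> M) \<and> (\<forall>c. \<forall>x\<in>M. c *\<^sub>C x \<in> M)"

text \<open>The parallelogram identity, applied at the midpoint of two almost minimal points, makes
  a minimizing sequence Cauchy.\<close>

lemma nearest_point_exists:
  fixes M :: "'a::complex_hilbert set"
  assumes M: "csubspace M" "closed M"
  obtains m where "m \<in> M" "\<And>y. y \<in> M \<Longrightarrow> norm (x - m) \<le> norm (x - y)"
proof -
  define d where "d = infdist x M"
  have ne: "M \<noteq> {}" using M by (auto simp: csubspace_def)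
  have d: "d \<le> norm (x - y)" if "y \<in> M" for y
    using infdist_le[OF that, of x] by (simp add: d_def dist_norm)
  have d0: "d \<ge> 0" by (simp add: d_def infdist_nonneg)
  have "\<exists>y\<in>M. norm (x - y) < d + 1 / real (Suc n)" for n
  proof (rule ccontr)
    assume "\<not> ?thesis"
    then have "d + 1 / real (Suc n) \<le> dist x y" if "y \<in> M" for y
      using that by (auto simp: dist_norm not_less)
    then have "d + 1 / real (Suc n) \<le> infdist x M"
      using ne by (simp add: infdist_def cINF_greatest)
    then show False by (simp add: d_def field_simps)
  qed
  then obtain y where y: "\<And>n. y n \<in> M" "\<And>n. norm (x - y n) < d + 1 / real (Suc n)" by metis
  have par: "(norm (y n - y m))\<^sup>2 \<le> 2 * (norm (x - y n))\<^sup>2 + 2 * (norm (x - y m))\<^sup>2 - 4 * d\<^sup>2" for n m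
  proof -
    have mid: "(1/2) *\<^sub>R (y n + y m) \<in> M"
      using M(1) y(1)[of n] y(1)[of m] unfolding csubspace_def by (metis scaleC_of_real)
    have "2 *\<^sub>R (x - (1/2) *\<^sub>R (y n + y m)) = (x - y n) + (x - y m)"
      by (simp add: algebra_simps scaleR_2)
    moreover have "(norm (2 *\<^sub>R u))\<^sup>2 = 4 * (norm u)\<^sup>2" for u :: 'a
      by (simp add: power_mult_distrib)
    ultimately have "(norm ((x - y n) + (x - y m)))\<^sup>2 = 4 * (norm (x - (1/2) *\<^sub>R (y n + y m)))\<^sup>2"
      by metis
    moreover have "\<dots> \<ge> 4 * d\<^sup>2" using d[OF mid] d0 by (simp add: power_mono)
    moreover have "(norm (y n - y m))\<^sup>2 = (norm ((x - y m) - (x - y n)))\<^sup>2" by simp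
    ultimately show ?thesis
      unfolding norm_diff_sq norm_add_sq using cinner_commute[of "x - y n" "x - y m"]
      by simp
  qed
  have lim: "(\<lambda>n. norm (x - y n)) \<longlonglongrightarrow> d"
  proof (rule tendsto_sandwich)
    show "\<forall>\<^sub>F n in sequentially. d \<le> norm (x - y n)" using d y(1) by simp
    show "\<forall>\<^sub>F n in sequentially. norm (x - y n) \<le> d + 1 / real (Suc n)"
      using y(2) by (auto intro!: always_eventually less_imp_le)
    show "(\<lambda>n. d + 1 / real (Suc n)) \<longlonglongrightarrow> d"
      using tendsto_add[OF tendsto_const[of d] LIMSEQ_inverse_real_of_nat] by (simp add: inverse_eq_divide)
  qed simp
  have "Cauchy y"
  proof (rule CauchyI)
    fix e :: real assume e: "e > 0"
    have "(\<lambda>n. (norm (x - y n))\<^sup>2) \<longlonglongrightarrow> d\<^sup>2" using lim by (rule tendsto_power)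
    then have "\<forall>\<^sub>F n in sequentially. (norm (x - y n))\<^sup>2 < d\<^sup>2 + e\<^sup>2 / 4"
      by (rule order_tendstoD) (use e in simp)
    then obtain N where N: "\<And>n. n \<ge> N \<Longrightarrow> (norm (x - y n))\<^sup>2 < d\<^sup>2 + e\<^sup>2 / 4"
      by (auto simp: eventually_sequentially)
    show "\<exists>N. \<forall>m\<ge>N. \<forall>n\<ge>N. norm (y m - y n) < e"
    proof (intro exI allI impI)
      fix m n assume "m \<ge> N" "n \<ge> N"
      then have "(norm (y m - y n))\<^sup>2 < e\<^sup>2" using par[of m n] N[of m] N[of n] by linarith
      then show "norm (y m - y n) < e" using e by (simp add: power2_less_imp_less)
    qed
  qed
  then obtain m where m: "y \<longlonglongrightarrow> m" using Cauchy_convergent_iff convergent_def by blast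
  have "m \<in> M" using M(2) m y(1) closed_sequentially by blast
  moreover have "norm (x - m) = d"
    using tendsto_norm[OF tendsto_diff[OF tendsto_const[of x] m]] lim LIMSEQ_unique by blast
  ultimately show ?thesis using that d by metis
qed

lemma nearest_point_orthogonal:
  fixes M :: "'a::complex_hilbert set"
  assumes M: "csubspace M" and m: "m \<in> M" and near: "\<And>y. y \<in> M \<Longrightarrow> norm (x - m) \<le> norm (x - y)"
    and y: "y \<in> M"
  shows "cinner (x - m) y = 0"
proof (rule ccontr)
  define b where "b = cinner (x - m) y"
  assume "cinner (x - m) y \<noteq> 0"
  then have b: "b \<noteq> 0" and y0: "y \<noteq> 0" by (auto simp: b_def)
  \<comment> \<open>The coefficient of the projection of x - m onto y; moving m by it lowers the
    squared distance by |b|^2 / ||y||^2.\<close>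
  define c where "c = cnj b / complex_of_real ((norm y)\<^sup>2)"
  have "m + c *\<^sub>C y \<in> M" using M m y by (auto simp: csubspace_def)
  from near[OF this] have "(norm (x - m))\<^sup>2 \<le> (norm (x - m - c *\<^sub>C y))\<^sup>2"
    by (simp add: power_mono diff_diff_eq)
  also have "\<dots> = (norm (x - m))\<^sup>2 - 2 * Re (c * b) + (cmod c * norm y)\<^sup>2"
    unfolding norm_diff_sq by (simp add: cinner_scaleC_right b_def norm_scaleC)
  also have "c * b = complex_of_real ((cmod b)\<^sup>2 / (norm y)\<^sup>2)"
    unfolding of_real_divide complex_norm_square c_def by (simp add: mult_ac)
  also have "cmod c = cmod b / (norm y)\<^sup>2"
    by (simp add: c_def norm_divide norm_power)
  also have "(cmod b / (norm y)\<^sup>2 * norm y)\<^sup>2 = (cmod b)\<^sup>2 / (norm y)\<^sup>2"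
    using y0 by (simp add: field_simps power2_eq_square)
  finally have "(cmod b)\<^sup>2 / (norm y)\<^sup>2 \<le> 0" by simp
  then show False using b y0 by (simp add: divide_le_0_iff)
qed

lemma closed_csubspace_eq_UNIV:
  fixes M :: "'a::complex_hilbert set"
  assumes "csubspace M" "closed M" and orth: "\<And>y. (\<And>u. u \<in> M \<Longrightarrow> cinner y u = 0) \<Longrightarrow> y = 0"
  shows "M = UNIV"
proof -
  have "x \<in> M" for x
  proof -
    obtain m where m: "m \<in> M" "\<And>y. y \<in> M \<Longrightarrow> norm (x - m) \<le> norm (x - y)"
      using nearest_point_exists[OF assms(1,2)] by blast
    have "x - m = 0" by (rule orth) (rule nearest_point_orthogonal[OF assms(1) m])
    then show ?thesis using m by simp
  qed
  then show ?thesis by auto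
qed

text \<open>The representing vector is a multiple of a vector w orthogonal to the kernel:
  \<open>\<phi> w *\<^sub>C x - \<phi> x *\<^sub>C w\<close> lies in the kernel, and pairing it with
  w isolates the value at x.\<close>

lemma Riesz_representation:
  fixes \<phi> :: "'a::complex_hilbert \<Rightarrow> complex"
  assumes add: "\<And>x y. \<phi> (x + y) = \<phi> x + \<phi> y" and scale: "\<And>c x. \<phi> (c *\<^sub>C x) = c * \<phi> x"
    and bound: "\<And>x. cmod (\<phi> x) \<le> C * norm x"
  obtains y where "\<And>x. \<phi> x = cinner y x"
proof (cases "\<forall>x. \<phi> x = 0")
  case True
  then show ?thesis using that[of 0] by simp
next
  case False
  then obtain x0 where x0: "\<phi> x0 \<noteq> 0" by auto
  have bl: "bounded_linear \<phi>"
    by (rule bounded_linear_intro[where K = C])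
       (use add bound scale[of "complex_of_real _"] in \<open>auto simp: scaleC_of_real scaleR_conv_of_real mult.commute\<close>)
  define M where "M = {x. \<phi> x = 0}"
  have M: "csubspace M" using scale[of 0 0] by (auto simp: csubspace_def M_def add scale)
  have "closed M" unfolding M_def
    by (intro closed_Collect_eq continuous_intros linear_continuous_on bl)
  then obtain m where m: "m \<in> M" "\<And>y. y \<in> M \<Longrightarrow> norm (x0 - m) \<le> norm (x0 - y)"
    using nearest_point_exists[OF M] by blast
  define w where "w = x0 - m"
  have w: "cinner w y = 0" if "y \<in> M" for y
    using nearest_point_orthogonal[OF M m that] by (simp add: w_def)
  have dif: "\<phi> (x - y) = \<phi> x - \<phi> y" for x y by (rule linear_diff[OF bounded_linear.linear[OF bl]])
  have pw: "\<phi> w \<noteq> 0" using x0 m(1) by (simp add: w_def dif M_def)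
  then have w0: "w \<noteq> 0" using scale[of 0 0] by auto
  show ?thesis
  proof (rule that)
    fix x
    have "\<phi> w *\<^sub>C x - \<phi> x *\<^sub>C w \<in> M" by (simp add: M_def dif scale)
    from w[OF this] have "\<phi> w * cinner w x = \<phi> x * cinner w w" by (simp add: cinner_simps)
    then show "\<phi> x = cinner ((cnj (\<phi> w) / complex_of_real ((norm w)\<^sup>2)) *\<^sub>C w) x"
      using w0 by (simp add: cinner_simps cinner_self field_simps)
  qed
qed

section \<open>Complex-linear bounded operators: adjoints and inverses\<close>

lemma clinear_opD: "clinear_op T \<Longrightarrow> blinfun_apply T (c *\<^sub>C x) = c *\<^sub>C blinfun_apply T x"
  by (simp add: clinear_op_def)

lemma sesquilinear_cinner_op:
  "clinear_op T \<Longrightarrow> sesquilinear (\<lambda>x y. cinner (blinfun_apply S x) (blinfun_apply T y))" if "clinear_op S" for S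
  using that by (intro sesquilinearI) (auto simp: cinner_simps blinfun.add_right clinear_opD)

lemma sesquilinear_op: "clinear_op T \<Longrightarrow> sesquilinear (\<lambda>x y. cinner x (blinfun_apply T y))"
  by (intro sesquilinearI) (auto simp: cinner_simps blinfun.add_right clinear_opD)

text \<open>Riesz in the left argument, after a conjugation that makes it linear, yields the vector
  T y. Adjoints and the values of the spectral shift operator are both obtained this way.\<close>

lemma sesquilinear_bounded_imp_op:
  assumes B: "sesquilinear B" and bd: "\<And>x y. cmod (B x y) \<le> C * norm x * norm y" and C: "C \<ge> 0"
  shows "\<exists>T. clinear_op T \<and> (\<forall>x y. cinner x (blinfun_apply T y) = B x y) \<and> norm T \<le> C"
proof -
  have "\<exists>v. \<forall>x. B x y = cinner x v" for y
  proof -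
    obtain v where v: "\<And>x. cnj (B x y) = cinner v x"
    proof (rule Riesz_representation[of "\<lambda>x. cnj (B x y)" "C * norm y"])
      show "cmod (cnj (B x y)) \<le> C * norm y * norm x" for x using bd[of x y] by (simp add: mult_ac)
    qed (auto simp: sesquilinearD[OF B])
    have "B x y = cinner x v" for x using v[of x] by (metis cinner_commute complex_cnj_cnj)
    then show ?thesis by blast
  qed
  then obtain T where T: "\<And>x y. B x y = cinner x (T y)" by metis
  have add: "T (x + y) = T x + T y" for x y
    by (rule cinner_ext) (simp add: T[symmetric] sesquilinearD[OF B] cinner_simps)
  have scale: "T (c *\<^sub>C x) = c *\<^sub>C T x" for c x
    by (rule cinner_ext) (simp add: T[symmetric] sesquilinearD[OF B] cinner_simps)
  have bound: "norm (T x) \<le> C * norm x" for x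
    by (rule norm_le_if_cinner_le) (use C bd in \<open>auto simp: T[symmetric] mult_ac\<close>)
  have bl: "bounded_linear T"
    by (rule bounded_linear_intro[where K = C])
       (use add bound scale[of "complex_of_real _"] in \<open>auto simp: scaleC_of_real mult.commute\<close>)
  have "norm (Blinfun T) \<le> C"
    by (rule norm_blinfun_bound) (use bound C in \<open>auto simp: bounded_linear_Blinfun_apply[OF bl]\<close>)
  then show ?thesis
    by (intro exI[of _ "Blinfun T"])
       (auto simp: clinear_op_def bounded_linear_Blinfun_apply[OF bl] scale T)
qed

lemma clinear_op_intros [intro, simp]:
  "clinear_op id_blinfun" "clinear_op 0"
  "clinear_op S \<Longrightarrow> clinear_op T \<Longrightarrow> clinear_op (S + T)"
  "clinear_op S \<Longrightarrow> clinear_op T \<Longrightarrow> clinear_op (S - T)"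
  "clinear_op S \<Longrightarrow> clinear_op T \<Longrightarrow> clinear_op (S o\<^sub>L T)"
  "clinear_op S \<Longrightarrow> clinear_op (r *\<^sub>R S)"
  by (auto simp: clinear_op_def blinfun.add_left blinfun.diff_left blinfun.scaleR_left
      scaleC_add_right scaleC_diff_right scaleC_of_real[symmetric] scaleC_scaleC mult.commute)

lemma scalar_op_apply [simp]: "blinfun_apply (scalar_op c) x = c *\<^sub>C x"
  unfolding scalar_op_def by (simp add: bounded_linear_Blinfun_apply bounded_linear_scaleC)

lemma clinear_scalar_op [intro, simp]: "clinear_op (scalar_op c)"
  by (simp add: clinear_op_def scaleC_scaleC mult.commute)

text \<open>\<open>adj\<close> is a definite description; its existence and uniqueness for
  complex-linear operators are settled here.\<close>

lemma adj_props:
  assumes T: "clinear_op T"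
  shows cinner_adj_right: "cinner x (blinfun_apply (adj T) y) = cinner (blinfun_apply T x) y"
    and cinner_adj_left: "cinner (blinfun_apply (adj T) x) y = cinner x (blinfun_apply T y)"
    and clinear_adj: "clinear_op (adj T)"
    and norm_adj_le: "norm (adj T) \<le> norm T"
proof -
  have B: "sesquilinear (\<lambda>x y. cinner (blinfun_apply T x) y)"
    using sesquilinear_cinner_op[OF T, of id_blinfun] by simp
  have bd: "cmod (cinner (blinfun_apply T x) y) \<le> norm T * norm x * norm y" for x y
    by (rule order_trans[OF cinner_Cauchy_Schwarz]) (simp add: mult_right_mono norm_blinfun)
  obtain S where S: "clinear_op S" "\<And>x y. cinner x (blinfun_apply S y) = cinner (blinfun_apply T x) y" "norm S \<le> norm T"
    using sesquilinear_bounded_imp_op[OF B bd norm_ge_zero] by metis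
  have "adj T = S" unfolding adj_def
  proof (rule the_equality)
    fix S' assume "\<forall>x y. cinner (blinfun_apply T x) y = cinner x (blinfun_apply S' y)"
    then show "S' = S" using S(2) by (metis (no_types) blinfun_eqI cinner_ext)
  qed (simp add: S)
  then show 1: "cinner x (blinfun_apply (adj T) y) = cinner (blinfun_apply T x) y" and "clinear_op (adj T)" "norm (adj T) \<le> norm T" for x y
    using S by auto
  show "cinner (blinfun_apply (adj T) x) y = cinner x (blinfun_apply T y)"
    using 1[of y x] by (metis cinner_commute)
qed

lemma adj_eqI:
  assumes "clinear_op T" "\<And>x y. cinner (blinfun_apply T x) y = cinner x (blinfun_apply S y)"
  shows "adj T = S"
  by (rule blinfun_eqI, rule cinner_ext) (simp add: cinner_adj_right assms)

lemma op_inv_eqI: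
  assumes "S o\<^sub>L T = id_blinfun" "T o\<^sub>L S = id_blinfun"
  shows "op_inv T = S"
  unfolding op_inv_def
proof (rule the_equality)
  fix S' assume S': "S' o\<^sub>L T = id_blinfun \<and> T o\<^sub>L S' = id_blinfun"
  have "S' = S' o\<^sub>L (T o\<^sub>L S)" by (rule blinfun_eqI) (simp add: assms)
  also have "\<dots> = (S' o\<^sub>L T) o\<^sub>L S" by (rule blinfun_eqI) simp
  also have "\<dots> = S" by (rule blinfun_eqI) (simp add: S')
  finally show "S' = S" .
qed (simp add: assms)

text \<open>Boundedness below and a closed graph give a closed range, and a closed range with
  trivial orthogonal complement is everything. Stated on a domain so that it covers bounded
  operators as well as H - z.\<close>

lemma surj_if_bounded_below:
  fixes A :: "'a::complex_hilbert \<Rightarrow> 'a"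
  assumes D: "csubspace D"
    and add: "\<And>x y. x \<in> D \<Longrightarrow> y \<in> D \<Longrightarrow> A (x + y) = A x + A y"
    and scale: "\<And>c x. x \<in> D \<Longrightarrow> A (c *\<^sub>C x) = c *\<^sub>C A x"
    and graph: "\<And>u x y. (\<And>n::nat. u n \<in> D) \<Longrightarrow> u \<longlonglongrightarrow> x \<Longrightarrow> (\<lambda>n. A (u n)) \<longlonglongrightarrow> y \<Longrightarrow> x \<in> D \<and> A x = y"
    and c: "c > 0" and below: "\<And>x. x \<in> D \<Longrightarrow> c * norm x \<le> norm (A x)"
    and dense: "\<And>y. (\<And>u. u \<in> D \<Longrightarrow> cinner y (A u) = 0) \<Longrightarrow> y = 0"
  shows "\<exists>u\<in>D. A u = v"
proof -
  have A0: "A 0 = 0" using D scale[of 0 0] by (auto simp: csubspace_def)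
  have diff: "x - y \<in> D \<and> A (x - y) = A x - A y" if "x \<in> D" "y \<in> D" for x y
  proof -
    have m: "(-1) *\<^sub>C y \<in> D" using D that by (simp add: csubspace_def)
    have "x + (-1) *\<^sub>C y \<in> D" using D that m by (simp add: csubspace_def)
    moreover have "A (x + (-1) *\<^sub>C y) = A x + (-1) *\<^sub>C A y" using that m by (simp only: add scale)
    ultimately show ?thesis by (simp add: scaleC_minus_one)
  qed
  have "A ` D = UNIV"
  proof (rule closed_csubspace_eq_UNIV)
    show "csubspace (A ` D)" unfolding csubspace_def
    proof (intro conjI ballI allI)
      show "0 \<in> A ` D" using A0 D by (force simp: csubspace_def)
    next
      fix x y assume "x \<in> A ` D" "y \<in> A ` D"
      then obtain x' y' where "x' \<in> D" "y' \<in> D" "x = A x'" "y = A y'" by auto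
      then show "x + y \<in> A ` D" using add[of x' y'] D by (metis csubspace_def imageI)
    next
      fix c x assume "x \<in> A ` D"
      then obtain x' where "x' \<in> D" "x = A x'" by auto
      then show "c *\<^sub>C x \<in> A ` D" using scale[of x' c] D by (metis csubspace_def imageI)
    qed
    show "closed (A ` D)" unfolding closed_sequential_limits
    proof (intro allI impI, elim conjE)
      fix f l assume "\<forall>n. f n \<in> A ` D" and l: "f \<longlonglongrightarrow> l"
      then have "\<forall>n. \<exists>u\<in>D. f n = A u" by blast
      then obtain u where u: "\<And>n. u n \<in> D" "\<And>n. f n = A (u n)" by metis
      have "Cauchy u"
      proof (rule CauchyI)
        fix e :: real assume "e > 0"
        then have "c * e > 0" using c by simp
        then obtain N where N: "\<And>m n. m \<ge> N \<Longrightarrow> n \<ge> N \<Longrightarrow> norm (f m - f n) < c * e"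
          using LIMSEQ_imp_Cauchy[OF l] by (metis CauchyD)
        show "\<exists>M. \<forall>m\<ge>M. \<forall>n\<ge>M. norm (u m - u n) < e"
        proof (intro exI allI impI)
          fix m n assume mn: "m \<ge> N" "n \<ge> N"
          have "c * norm (u m - u n) \<le> norm (A (u m - u n))"
            using diff[OF u(1) u(1)] by (intro below) auto
          also have "\<dots> = norm (f m - f n)" using diff[OF u(1) u(1), of m n] by (simp add: u(2))
          also have "\<dots> < c * e" using N mn by simp
          finally show "norm (u m - u n) < e" using c by simp
        qed
      qed
      then obtain x where "u \<longlonglongrightarrow> x" using Cauchy_convergent_iff convergent_def by blast
      then have "x \<in> D \<and> A x = l" using l by (intro graph[OF u(1)]) (simp_all add: u(2)[symmetric])
      then show "l \<in> A ` D" by auto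
    qed
    show "y = 0" if "\<And>u. u \<in> A ` D \<Longrightarrow> cinner y u = 0" for y
      by (rule dense) (use that in auto)
  qed
  then show ?thesis by (metis UNIV_I imageE)
qed

text \<open>The Lax-Milgram argument: the bound on the form gives boundedness below and excludes
  vectors orthogonal to the range. The modulus appears because the applications control only the
  imaginary part of the form.\<close>

lemma coercive_op_inv:
  assumes T: "clinear_op T" and c: "c > 0" and co: "\<And>x. c * (norm x)\<^sup>2 \<le> cmod (cinner x (blinfun_apply T x))"
  shows "op_inv T o\<^sub>L T = id_blinfun" "T o\<^sub>L op_inv T = id_blinfun" "clinear_op (op_inv T)"
    "norm (op_inv T) \<le> 1 / c"
proof -
  have below: "c * norm x \<le> norm (blinfun_apply T x)" for x
  proof (cases "x = 0")
    case False
    have "c * (norm x)\<^sup>2 \<le> norm x * norm (blinfun_apply T x)"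
      using co[of x] cinner_Cauchy_Schwarz[of x "blinfun_apply T x"] by linarith
    then show ?thesis using False by (simp add: power2_eq_square mult.left_commute)
  qed simp
  have "\<exists>u\<in>UNIV. blinfun_apply T u = v" for v
  proof (rule surj_if_bounded_below[OF _ _ _ _ c])
    show "csubspace (UNIV :: 'a set)" by (simp add: csubspace_def)
    show "x \<in> UNIV \<and> blinfun_apply T x = y" if "u \<longlonglongrightarrow> x" "(\<lambda>n. blinfun_apply T (u n)) \<longlonglongrightarrow> y" for u :: "nat \<Rightarrow> 'a" and x y
      using that blinfun.tendsto[OF tendsto_const that(1), of T] LIMSEQ_unique by auto
    show "y = 0" if "\<And>u. u \<in> UNIV \<Longrightarrow> cinner y (blinfun_apply T u) = 0" for y
      using that[of y] co[of y] c by (simp add: mult_le_0_iff)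
  qed (auto simp: blinfun.add_right clinear_opD[OF T] below)
  then obtain S where S: "\<And>v. blinfun_apply T (S v) = v" by metis
  have inj: "x = y" if "blinfun_apply T x = blinfun_apply T y" for x y
    using below[of "x - y"] that c by (simp add: blinfun.diff_right mult_le_0_iff)
  have add: "S (x + y) = S x + S y" for x y by (rule inj) (simp add: S blinfun.add_right)
  have scale: "S (d *\<^sub>C x) = d *\<^sub>C S x" for d x by (rule inj) (simp add: S clinear_opD[OF T])
  have bound: "norm (S x) \<le> (1 / c) * norm x" for x
    using below[of "S x"] c by (simp add: S field_simps)
  have bl: "bounded_linear S"
    by (rule bounded_linear_intro[where K = "1 / c"])
       (use add bound scale[of "complex_of_real _"] in \<open>auto simp: scaleC_of_real mult.commute\<close>)
  have app: "blinfun_apply (Blinfun S) x = S x" for x by (simp add: bounded_linear_Blinfun_apply[OF bl])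
  have 1: "Blinfun S o\<^sub>L T = id_blinfun"
    by (rule blinfun_eqI) (simp add: app inj[OF S])
  have 2: "T o\<^sub>L Blinfun S = id_blinfun"
    by (rule blinfun_eqI) (simp add: app S)
  have eq: "op_inv T = Blinfun S" by (rule op_inv_eqI[OF 1 2])
  show "op_inv T o\<^sub>L T = id_blinfun" "T o\<^sub>L op_inv T = id_blinfun" using 1 2 by (simp_all only: eq)
  show "clinear_op (op_inv T)" unfolding eq clinear_op_def by (simp add: app scale)
  show "norm (op_inv T) \<le> 1 / c"
    unfolding eq by (rule norm_blinfun_bound) (use bound c in \<open>auto simp: app\<close>)
qed

section \<open>Self-adjoint operators and their resolvents\<close>

context
  fixes D :: "'a::complex_hilbert set" and H :: "'a \<Rightarrow> 'a"
  assumes sa: "selfadjoint D H"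
begin

lemma selfadjoint_csubspace: "csubspace D"
  using sa by (auto simp: selfadjoint_def csubspace_def)

lemma selfadjoint_add: "x \<in> D \<Longrightarrow> y \<in> D \<Longrightarrow> x + y \<in> D" "x \<in> D \<Longrightarrow> y \<in> D \<Longrightarrow> H (x + y) = H x + H y"
  and selfadjoint_scaleC: "x \<in> D \<Longrightarrow> c *\<^sub>C x \<in> D" "x \<in> D \<Longrightarrow> H (c *\<^sub>C x) = c *\<^sub>C H x"
  using sa by (auto simp: selfadjoint_def)

lemma selfadjoint_minus: "x \<in> D \<Longrightarrow> - x \<in> D" "x \<in> D \<Longrightarrow> H (- x) = - H x"
  using selfadjoint_scaleC[of x "-1"] by (auto simp: scaleC_minus_one)

lemma selfadjoint_diff: "x \<in> D \<Longrightarrow> y \<in> D \<Longrightarrow> x - y \<in> D" "x \<in> D \<Longrightarrow> y \<in> D \<Longrightarrow> H (x - y) = H x - H y"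
  using selfadjoint_add[of x "- y"] selfadjoint_minus[of y] by auto

lemma selfadjoint_symmetric:
  assumes "x \<in> D" "u \<in> D"
  shows "cinner (H x) u = cinner x (H u)"
proof -
  have "\<forall>x y. (\<forall>u\<in>D. cinner y u = cinner x (H u)) \<longleftrightarrow> x \<in> D \<and> y = H x"
    using sa unfolding selfadjoint_def by blast
  then show ?thesis using assms by blast
qed

lemma selfadjoint_mem:
  assumes "\<And>u. u \<in> D \<Longrightarrow> cinner y u = cinner x (H u)"
  shows "x \<in> D" "y = H x"
proof -
  have "\<forall>x y. (\<forall>u\<in>D. cinner y u = cinner x (H u)) \<longleftrightarrow> x \<in> D \<and> y = H x"
    using sa unfolding selfadjoint_def by blast
  then show "x \<in> D" "y = H x" using assms by blast+
qed

lemma selfadjoint_form_real: "x \<in> D \<Longrightarrow> Im (cinner x (H x)) = 0"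
  using selfadjoint_symmetric[of x x] cinner_commute[of "H x" x]
  by (metis Reals_cnj_iff complex_is_Real_iff)

lemma selfadjoint_orthogonal_dense:
  assumes "\<And>u. u \<in> D \<Longrightarrow> cinner u y = 0"
  shows "y = 0"
proof -
  have "closure D = UNIV" using sa by (simp add: selfadjoint_def)
  then have "y \<in> closure D" by simp
  then obtain u where u: "\<And>n. u n \<in> D" "u \<longlonglongrightarrow> y" by (auto simp: closure_sequential)
  have "(\<lambda>n. cinner (u n) y) \<longlonglongrightarrow> cinner y y" by (intro tendsto_intros u)
  then have "cinner y y = 0" using assms[OF u(1)] LIMSEQ_unique[OF _ tendsto_const] by auto
  then show ?thesis by (simp add: cinner_self_eq_0)
qed

lemma selfadjoint_graph_closed:
  assumes "\<And>n::nat. u n \<in> D" "u \<longlonglongrightarrow> x" "(\<lambda>n. H (u n)) \<longlonglongrightarrow> y"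
  shows "x \<in> D \<and> H x = y"
proof -
  have "cinner y v = cinner x (H v)" if "v \<in> D" for v
  proof (rule LIMSEQ_unique)
    show "(\<lambda>n. cinner (H (u n)) v) \<longlonglongrightarrow> cinner y v" by (intro tendsto_intros assms)
    show "(\<lambda>n. cinner (H (u n)) v) \<longlonglongrightarrow> cinner x (H v)"
      unfolding selfadjoint_symmetric[OF assms(1) that] by (intro tendsto_intros assms)
  qed
  from selfadjoint_mem[OF this] show ?thesis by auto
qed

text \<open>The form of H is real, so the imaginary part of <x, (H - z) x> is exactly - Im z
  ||x||^2.\<close>

lemma selfadjoint_bounded_below:
  assumes "x \<in> D"
  shows "\<bar>Im z\<bar> * norm x \<le> norm (H x - z *\<^sub>C x)"
proof (cases "x = 0")
  case False
  have "Im (cinner x (H x - z *\<^sub>C x)) = - Im z * (norm x)\<^sup>2"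
    using selfadjoint_form_real[OF assms] by (simp add: cinner_simps cinner_self flip: of_real_power)
  then have "\<bar>Im z\<bar> * (norm x)\<^sup>2 \<le> cmod (cinner x (H x - z *\<^sub>C x))"
    using abs_Im_le_cmod[of "cinner x (H x - z *\<^sub>C x)"] by (simp add: abs_mult)
  also have "\<dots> \<le> norm x * norm (H x - z *\<^sub>C x)" by (rule cinner_Cauchy_Schwarz)
  finally show ?thesis using False by (simp add: power2_eq_square)
qed simp

text \<open>A vector orthogonal to the range of H - z would, by self-adjointness, be an eigenvector
  for \<open>cnj z\<close>, which the real form of H forbids. Injectivity and the norm bound come
  from boundedness below.\<close>

lemma resolvent_exists:
  assumes z: "z \<notin> \<real>"
  shows "\<exists>R. clinear_op R \<and> norm R \<le> 1 / \<bar>Im z\<bar> \<and>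
    (\<forall>x. blinfun_apply R x \<in> D \<and> H (blinfun_apply R x) - z *\<^sub>C blinfun_apply R x = x) \<and>
    (\<forall>u\<in>D. blinfun_apply R (H u - z *\<^sub>C u) = u)"
proof -
  have z: "\<bar>Im z\<bar> > 0" using z by (simp add: complex_is_Real_iff)
  have ex: "\<exists>u\<in>D. H u - z *\<^sub>C u = v" for v
  proof (rule surj_if_bounded_below[OF selfadjoint_csubspace _ _ _ z])
    show "H (x + y) - z *\<^sub>C (x + y) = (H x - z *\<^sub>C x) + (H y - z *\<^sub>C y)" if "x \<in> D" "y \<in> D" for x y
      using that by (simp add: selfadjoint_add scaleC_add_right)
    show "H (c *\<^sub>C x) - z *\<^sub>C c *\<^sub>C x = c *\<^sub>C (H x - z *\<^sub>C x)" if "x \<in> D" for c x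
      using that by (simp add: selfadjoint_scaleC scaleC_diff_right scaleC_scaleC mult.commute)
    show "x \<in> D \<and> H x - z *\<^sub>C x = y"
      if "\<And>n::nat. u n \<in> D" "u \<longlonglongrightarrow> x" "(\<lambda>n. H (u n) - z *\<^sub>C u n) \<longlonglongrightarrow> y" for u x y
    proof -
      have "(\<lambda>n. (H (u n) - z *\<^sub>C u n) + z *\<^sub>C u n) \<longlonglongrightarrow> y + z *\<^sub>C x"
        by (intro tendsto_add that tendsto_scaleC_right)
      then have "(\<lambda>n. H (u n)) \<longlonglongrightarrow> y + z *\<^sub>C x" by simp
      from selfadjoint_graph_closed[OF that(1,2) this] show ?thesis by simp
    qed
    show "\<bar>Im z\<bar> * norm x \<le> norm (H x - z *\<^sub>C x)" if "x \<in> D" for x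
      by (rule selfadjoint_bounded_below[OF that])
    show "y = 0" if y: "\<And>u. u \<in> D \<Longrightarrow> cinner y (H u - z *\<^sub>C u) = 0" for y
    proof -
      have "cinner (cnj z *\<^sub>C y) u = cinner y (H u)" if "u \<in> D" for u
        using y[OF that] by (simp add: cinner_simps)
      from selfadjoint_mem[OF this] have "y \<in> D" "cnj z *\<^sub>C y = H y" by auto
      then have "Im (cnj z * complex_of_real ((norm y)\<^sup>2)) = 0"
        using selfadjoint_form_real[of y] by (metis cinner_scaleC_right cinner_self)
      then show ?thesis using z by (simp flip: of_real_power)
    qed
  qed
  define S where "S = (\<lambda>v. SOME u. u \<in> D \<and> H u - z *\<^sub>C u = v)"
  have S: "S v \<in> D" "H (S v) - z *\<^sub>C S v = v" for v
    using someI_ex[of "\<lambda>u. u \<in> D \<and> H u - z *\<^sub>C u = v"] ex[of v] by (auto simp: S_def)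
  have uni: "S (H u - z *\<^sub>C u) = u" if u: "u \<in> D" for u
  proof -
    define v where "v = S (H u - z *\<^sub>C u) - u"
    have v: "v \<in> D" using S u by (simp add: v_def selfadjoint_diff)
    have "H v - z *\<^sub>C v = (H (S (H u - z *\<^sub>C u)) - z *\<^sub>C S (H u - z *\<^sub>C u)) - (H u - z *\<^sub>C u)"
      using S(1)[of "H u - z *\<^sub>C u"] u by (simp add: v_def selfadjoint_diff scaleC_diff_right)
    also have "\<dots> = 0" by (simp only: S(2) diff_self)
    finally have "\<bar>Im z\<bar> * norm v \<le> 0" using selfadjoint_bounded_below[OF v, of z] by simp
    then show ?thesis using z by (simp add: v_def mult_le_0_iff)
  qed
  have add: "S (x + y) = S x + S y" for x y
    using uni[of "S x + S y"] S by (simp add: selfadjoint_add scaleC_add_right add_diff_add)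
  have scale: "S (c *\<^sub>C x) = c *\<^sub>C S x" for c x
  proof -
    have "H (c *\<^sub>C S x) - z *\<^sub>C c *\<^sub>C S x = c *\<^sub>C (H (S x) - z *\<^sub>C S x)"
      using S(1) by (simp add: selfadjoint_scaleC scaleC_diff_right scaleC_scaleC mult.commute)
    then show ?thesis using uni[of "c *\<^sub>C S x"] S by (simp add: selfadjoint_scaleC)
  qed
  have bound: "norm (S x) \<le> (1 / \<bar>Im z\<bar>) * norm x" for x
    using selfadjoint_bounded_below[OF S(1), of z x] z by (simp add: S field_simps)
  have bl: "bounded_linear S"
    by (rule bounded_linear_intro[where K = "1 / \<bar>Im z\<bar>"])
       (use add bound scale[of "complex_of_real _"] in \<open>auto simp: scaleC_of_real mult.commute\<close>)
  have app: "blinfun_apply (Blinfun S) x = S x" for x by (simp add: bounded_linear_Blinfun_apply[OF bl])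
  have "norm (Blinfun S) \<le> 1 / \<bar>Im z\<bar>"
    by (rule norm_blinfun_bound) (use bound z in \<open>auto simp: app\<close>)
  then show ?thesis
    by (intro exI[of _ "Blinfun S"]) (auto simp: app S uni clinear_op_def scale)
qed

lemma resolvent_props:
  assumes z: "z \<notin> \<real>"
  shows clinear_resolvent: "clinear_op (resolvent D H z)"
    and norm_resolvent: "norm (resolvent D H z) \<le> 1 / \<bar>Im z\<bar>"
    and resolvent_mem: "blinfun_apply (resolvent D H z) x \<in> D"
    and resolvent_right: "H (blinfun_apply (resolvent D H z) x) - z *\<^sub>C blinfun_apply (resolvent D H z) x = x"
    and resolvent_left: "u \<in> D \<Longrightarrow> blinfun_apply (resolvent D H z) (H u - z *\<^sub>C u) = u"
proof -
  obtain R where R: "clinear_op R" "norm R \<le> 1 / \<bar>Im z\<bar>"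
    "\<forall>x. blinfun_apply R x \<in> D \<and> H (blinfun_apply R x) - z *\<^sub>C blinfun_apply R x = x"
    "\<forall>u\<in>D. blinfun_apply R (H u - z *\<^sub>C u) = u"
    using resolvent_exists[OF z] by metis
  have "resolvent D H z = R" unfolding resolvent_def
  proof (rule the_equality)
    fix R'
    assume "(\<forall>x. blinfun_apply R' x \<in> D \<and> H (blinfun_apply R' x) - z *\<^sub>C blinfun_apply R' x = x) \<and>
      (\<forall>u\<in>D. blinfun_apply R' (H u - z *\<^sub>C u) = u)"
    then have "blinfun_apply R' x = blinfun_apply R x" for x using R(3,4) by metis
    then show "R' = R" by (rule blinfun_eqI)
  qed (use R in auto)
  then show "clinear_op (resolvent D H z)" "norm (resolvent D H z) \<le> 1 / \<bar>Im z\<bar>"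
    "blinfun_apply (resolvent D H z) x \<in> D"
    "H (blinfun_apply (resolvent D H z) x) - z *\<^sub>C blinfun_apply (resolvent D H z) x = x"
    "u \<in> D \<Longrightarrow> blinfun_apply (resolvent D H z) (H u - z *\<^sub>C u) = u"
    using R by auto
qed

lemma resolvent_eqI:
  "z \<notin> \<real> \<Longrightarrow> u \<in> D \<Longrightarrow> H u - z *\<^sub>C u = x \<Longrightarrow> blinfun_apply (resolvent D H z) x = u"
  using resolvent_left by blast

lemma cinner_resolvent:
  assumes z: "z \<notin> \<real>"
  shows "cinner (blinfun_apply (resolvent D H z) x) y = cinner x (blinfun_apply (resolvent D H (cnj z)) y)"
proof -
  have z': "cnj z \<notin> \<real>" using z by (simp add: complex_is_Real_iff)
  define u v where "u = blinfun_apply (resolvent D H z) x" and "v = blinfun_apply (resolvent D H (cnj z)) y"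
  have uv: "u \<in> D" "v \<in> D" "H u - z *\<^sub>C u = x" "H v - cnj z *\<^sub>C v = y"
    by (simp_all add: u_def v_def resolvent_mem[OF z] resolvent_mem[OF z'] resolvent_right[OF z] resolvent_right[OF z'])
  have "cinner u (H v - cnj z *\<^sub>C v) = cinner (H u - z *\<^sub>C u) v"
    using selfadjoint_symmetric[OF uv(1,2)] by (simp add: cinner_simps)
  then show ?thesis unfolding uv by (simp add: u_def v_def)
qed

text \<open>This makes \<open>M 0 z\<close> dissipative above the real axis, on which both the
  logarithm and the bound by pi rest.\<close>

lemma Im_cinner_resolvent:
  assumes z: "z \<notin> \<real>"
  shows "Im (cinner x (blinfun_apply (resolvent D H z) x)) = Im z * (norm (blinfun_apply (resolvent D H z) x))\<^sup>2"
proof -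
  define u where "u = blinfun_apply (resolvent D H z) x"
  have u: "u \<in> D" "H u - z *\<^sub>C u = x" by (simp_all add: u_def resolvent_mem[OF z] resolvent_right[OF z])
  have "cinner x u = cinner (H u) u - cnj z * cinner u u" unfolding u(2)[symmetric] by (simp add: cinner_simps)
  then show ?thesis using selfadjoint_form_real[OF u(1)] selfadjoint_symmetric[OF u(1) u(1)]
    by (simp add: u_def[symmetric] cinner_self flip: of_real_power)
qed

lemma resolvent_identity:
  assumes z: "z \<notin> \<real>" and w: "w \<notin> \<real>"
  shows "blinfun_apply (resolvent D H z) x - blinfun_apply (resolvent D H w) x =
    (z - w) *\<^sub>C blinfun_apply (resolvent D H z) (blinfun_apply (resolvent D H w) x)"
proof -
  define v where "v = blinfun_apply (resolvent D H w) x"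
  have v: "v \<in> D" "H v - w *\<^sub>C v = x" by (simp_all add: v_def resolvent_mem[OF w] resolvent_right[OF w])
  have "H v - z *\<^sub>C v = (H v - w *\<^sub>C v) - (z - w) *\<^sub>C v"
    by (simp add: scaleC_diff_left)
  also have "\<dots> = x - (z - w) *\<^sub>C v" using v(2) by simp
  finally have "blinfun_apply (resolvent D H z) (x - (z - w) *\<^sub>C v) = v"
    using resolvent_eqI[OF z v(1)] by simp
  then show ?thesis
    by (simp add: blinfun.diff_right clinear_opD[OF clinear_resolvent[OF z]] v_def[symmetric] algebra_simps)
qed

text \<open>A bounded symmetric term can be moved across the relation that defines the adjoint, so
  the domain does not change.\<close>

lemma selfadjoint_add_bounded:
  assumes V: "\<And>x y. cinner (blinfun_apply V x) y = cinner x (blinfun_apply V y)" "clinear_op V"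
  shows "selfadjoint D (\<lambda>x. H x + blinfun_apply V x)"
proof -
  have *: "(\<forall>u\<in>D. cinner y u = cinner x (H u + blinfun_apply V u)) \<longleftrightarrow> x \<in> D \<and> y = H x + blinfun_apply V x" for x y
  proof -
    have "(\<forall>u\<in>D. cinner y u = cinner x (H u + blinfun_apply V u)) \<longleftrightarrow>
      (\<forall>u\<in>D. cinner (y - blinfun_apply V x) u = cinner x (H u))"
      by (auto simp: cinner_simps V algebra_simps)
    also have "\<dots> \<longleftrightarrow> x \<in> D \<and> y - blinfun_apply V x = H x"
      using selfadjoint_mem[of "y - blinfun_apply V x" x] selfadjoint_symmetric[of x] by metis
    finally show ?thesis by (auto simp: algebra_simps)
  qed
  show ?thesis
    using sa * unfolding selfadjoint_def
    by (auto simp: blinfun.add_right clinear_opD[OF V(2)] scaleC_add_right)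
qed

end

subsection \<open>The family \<open>K\<^sup>* (H + s K K\<^sup>* - z)\<^sup>-\<^sup>1 K\<close>\<close>

locale perturbation =
  fixes D :: "'h::complex_hilbert set" and H :: "'h \<Rightarrow> 'h" and K :: "'h \<Rightarrow>\<^sub>L 'h"
  assumes sa: "selfadjoint D H" and K: "clinear_op K"
begin

definition Hs :: "real \<Rightarrow> 'h \<Rightarrow> 'h" where
  "Hs s = (\<lambda>x. H x + s *\<^sub>R blinfun_apply K (blinfun_apply (adj K) x))"

definition R :: "real \<Rightarrow> complex \<Rightarrow> 'h \<Rightarrow>\<^sub>L 'h" where
  "R s z = resolvent D (Hs s) z"

definition M :: "real \<Rightarrow> complex \<Rightarrow> 'h \<Rightarrow>\<^sub>L 'h" where
  "M s z = adj K o\<^sub>L R s z o\<^sub>L K"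

lemma M_apply: "blinfun_apply (M s z) f = blinfun_apply (adj K) (blinfun_apply (R s z) (blinfun_apply K f))"
  by (simp add: M_def)

lemma cinner_M: "cinner f (blinfun_apply (M s z) g) = cinner (blinfun_apply K f) (blinfun_apply (R s z) (blinfun_apply K g))"
  by (simp add: M_apply cinner_adj_right[OF K])

lemma selfadjoint_Hs: "selfadjoint D (Hs s)"
proof -
  have "selfadjoint D (\<lambda>x. H x + blinfun_apply (s *\<^sub>R (K o\<^sub>L adj K)) x)"
    by (rule selfadjoint_add_bounded[OF sa])
       (auto simp: blinfun.scaleR_left cinner_simps cinner_adj_right[OF K] cinner_adj_left[OF K, symmetric]
         intro!: clinear_op_intros K clinear_adj)
  then show ?thesis by (simp add: Hs_def blinfun.scaleR_left)
qed

lemma clinear_R: "z \<notin> \<real> \<Longrightarrow> clinear_op (R s z)"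
  unfolding R_def by (rule clinear_resolvent[OF selfadjoint_Hs])

lemma clinear_M: "z \<notin> \<real> \<Longrightarrow> clinear_op (M s z)"
  unfolding M_def by (intro clinear_op_intros clinear_adj K clinear_R)

lemma norm_R: "z \<notin> \<real> \<Longrightarrow> norm (R s z) \<le> 1 / \<bar>Im z\<bar>"
  unfolding R_def by (rule norm_resolvent[OF selfadjoint_Hs])

lemma norm_sandwich: "norm (adj K o\<^sub>L T o\<^sub>L K) \<le> (norm K)\<^sup>2 * norm T"
proof -
  have "norm (adj K o\<^sub>L T o\<^sub>L K) \<le> norm (adj K) * norm T * norm K"
    by (meson norm_blinfun_compose order_trans mult_right_mono norm_ge_zero)
  also have "\<dots> \<le> norm K * norm T * norm K"
    by (intro mult_right_mono norm_adj_le[OF K]) auto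
  finally show ?thesis by (simp add: power2_eq_square mult_ac)
qed

lemma norm_M: "z \<notin> \<real> \<Longrightarrow> norm (M s z) \<le> (norm K)\<^sup>2 / \<bar>Im z\<bar>"
  using norm_sandwich[of "R s z"] mult_left_mono[OF norm_R[of z s], of "(norm K)\<^sup>2"] by (simp add: M_def)

text \<open>The second resolvent identity for \<open>Hs s\<close> and \<open>Hs t\<close>. The
  perturbation factors through K, so sandwiching by \<open>adj K\<close> and K closes the middle
  term up to a product of two members of the family.\<close>

lemma M_diff_s:
  assumes z: "z \<notin> \<real>"
  shows "M s z - M t z = (t - s) *\<^sub>R (M s z o\<^sub>L M t z)"
proof (rule blinfun_eqI)
  fix f
  define x where "x = blinfun_apply K f"
  define v where "v = blinfun_apply (R t z) x"
  define w where "w = (s - t) *\<^sub>R blinfun_apply K (blinfun_apply (adj K) v)"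
  have v: "v \<in> D" "Hs t v - z *\<^sub>C v = x"
    by (simp_all add: v_def R_def resolvent_mem[OF selfadjoint_Hs z] resolvent_right[OF selfadjoint_Hs z])
  have "Hs s v - z *\<^sub>C v = (Hs t v - z *\<^sub>C v) + w"
    by (simp add: Hs_def w_def scaleR_diff_left)
  then have "blinfun_apply (R s z) (x + w) = v"
    unfolding R_def v(2) by (intro resolvent_eqI[OF selfadjoint_Hs z v(1)])
  then have *: "blinfun_apply (R s z) x - v = - blinfun_apply (R s z) w"
    by (simp add: blinfun.add_right algebra_simps)
  have "blinfun_apply (M s z - M t z) f = blinfun_apply (adj K) (blinfun_apply (R s z) x - v)"
    by (simp add: M_apply blinfun.diff_left blinfun.diff_right x_def v_def)
  also have "\<dots> = blinfun_apply ((t - s) *\<^sub>R (M s z o\<^sub>L M t z)) f"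
    unfolding * by (simp add: w_def v_def x_def M_apply blinfun.scaleR_left blinfun.scaleR_right blinfun.minus_right
        flip: scaleR_minus_left)
  finally show "blinfun_apply (M s z - M t z) f = blinfun_apply ((t - s) *\<^sub>R (M s z o\<^sub>L M t z)) f" .
qed

lemma norm_M_diff_s:
  assumes z: "z \<notin> \<real>"
  shows "norm (M s z - M t z) \<le> \<bar>s - t\<bar> * ((norm K)\<^sup>2 / \<bar>Im z\<bar>)\<^sup>2"
proof -
  have "norm (M s z o\<^sub>L M t z) \<le> norm (M s z) * norm (M t z)" by (rule norm_blinfun_compose)
  also have "\<dots> \<le> ((norm K)\<^sup>2 / \<bar>Im z\<bar>)\<^sup>2"
    unfolding power2_eq_square[of "(norm K)\<^sup>2 / \<bar>Im z\<bar>"] by (intro mult_mono norm_M z) auto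
  finally show ?thesis
    unfolding M_diff_s[OF z] by (simp add: mult_left_mono abs_minus_commute)
qed

lemma norm_M_diff_z:
  assumes z: "z \<notin> \<real>" and w: "w \<notin> \<real>"
  shows "norm (M s z - M s w) \<le> cmod (z - w) * ((norm K)\<^sup>2 / (\<bar>Im z\<bar> * \<bar>Im w\<bar>))"
proof -
  have eq: "R s z - R s w = scalar_op (z - w) o\<^sub>L (R s z o\<^sub>L R s w)"
    by (rule blinfun_eqI) (simp add: blinfun.diff_left R_def resolvent_identity[OF selfadjoint_Hs z w])
  have "norm (scalar_op c :: 'h \<Rightarrow>\<^sub>L 'h) \<le> cmod c" for c
    by (rule norm_blinfun_bound) (auto simp: norm_scaleC)
  then have "norm (R s z - R s w) \<le> cmod (z - w) * (norm (R s z) * norm (R s w))"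
    unfolding eq by (meson norm_blinfun_compose order_trans mult_mono norm_ge_zero)
  also have "\<dots> \<le> cmod (z - w) * (1 / \<bar>Im z\<bar> * (1 / \<bar>Im w\<bar>))"
    by (intro mult_left_mono mult_mono norm_R z w) auto
  finally have *: "norm (R s z - R s w) \<le> cmod (z - w) * (1 / \<bar>Im z\<bar> * (1 / \<bar>Im w\<bar>))" .
  have "M s z - M s w = adj K o\<^sub>L (R s z - R s w) o\<^sub>L K"
    by (rule blinfun_eqI) (simp add: M_apply blinfun.diff_left blinfun.diff_right)
  then show ?thesis
    using norm_sandwich[of "R s z - R s w"] mult_left_mono[OF *, of "(norm K)\<^sup>2"] by (simp add: mult_ac)
qed

lemma Im_cinner_M:
  "z \<notin> \<real> \<Longrightarrow> Im (cinner f (blinfun_apply (M s z) f)) = Im z * (norm (blinfun_apply (R s z) (blinfun_apply K f)))\<^sup>2"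
  unfolding cinner_M R_def by (rule Im_cinner_resolvent[OF selfadjoint_Hs])

lemma cinner_M_left:
  "z \<notin> \<real> \<Longrightarrow> cinner (blinfun_apply (M s z) f) g = cinner f (blinfun_apply (M s (cnj z)) g)"
  using cinner_resolvent[OF selfadjoint_Hs, of z s "blinfun_apply K f" "blinfun_apply K g"]
  by (simp add: M_apply cinner_adj_left[OF K] cinner_adj_right[OF K] R_def)

text \<open>Joint continuity in the coupling and the spectral parameter supplies the product
  measurability needed for averaging over s.\<close>

lemma continuous_on_M: "continuous_on {p. Im (snd p) \<noteq> 0} (\<lambda>p. M (fst p) (snd p))"
  unfolding continuous_on_sequentially comp_def
proof (intro ballI allI impI, elim conjE)
  fix p :: "nat \<Rightarrow> real \<times> complex" and a
  assume a: "a \<in> {p. Im (snd p) \<noteq> 0}" and p: "\<forall>n. p n \<in> {p. Im (snd p) \<noteq> 0}" and lim: "p \<longlonglongrightarrow> a"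
  define c where "c = (norm K)\<^sup>2"
  have ls: "(\<lambda>n. fst (p n)) \<longlonglongrightarrow> fst a" and lz: "(\<lambda>n. snd (p n)) \<longlonglongrightarrow> snd a"
    using lim by (auto intro: tendsto_fst tendsto_snd)
  have bd: "norm (M (fst (p n)) (snd (p n)) - M (fst a) (snd a)) \<le>
    cmod (snd (p n) - snd a) * (c / (\<bar>Im (snd (p n))\<bar> * \<bar>Im (snd a)\<bar>)) +
    \<bar>fst (p n) - fst a\<bar> * (c / \<bar>Im (snd a)\<bar>)\<^sup>2" for n
  proof -
    have "M (fst (p n)) (snd (p n)) - M (fst a) (snd a) =
      (M (fst (p n)) (snd (p n)) - M (fst (p n)) (snd a)) + (M (fst (p n)) (snd a) - M (fst a) (snd a))"
      by simp
    then show ?thesis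
      using norm_M_diff_z[of "snd (p n)" "snd a" "fst (p n)"] norm_M_diff_s[of "snd a" "fst (p n)" "fst a"] a p
        norm_triangle_ineq[of "M (fst (p n)) (snd (p n)) - M (fst (p n)) (snd a)" "M (fst (p n)) (snd a) - M (fst a) (snd a)"]
      by (auto simp: complex_is_Real_iff c_def)
  qed
  have "(\<lambda>n. cmod (snd (p n) - snd a) * (c / (\<bar>Im (snd (p n))\<bar> * \<bar>Im (snd a)\<bar>)) +
    \<bar>fst (p n) - fst a\<bar> * (c / \<bar>Im (snd a)\<bar>)\<^sup>2) \<longlonglongrightarrow> cmod (snd a - snd a) * (c / (\<bar>Im (snd a)\<bar> * \<bar>Im (snd a)\<bar>)) +
    \<bar>fst a - fst a\<bar> * (c / \<bar>Im (snd a)\<bar>)\<^sup>2"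
    using a by (intro tendsto_intros ls lz) auto
  then have "(\<lambda>n. cmod (snd (p n) - snd a) * (c / (\<bar>Im (snd (p n))\<bar> * \<bar>Im (snd a)\<bar>)) +
    \<bar>fst (p n) - fst a\<bar> * (c / \<bar>Im (snd a)\<bar>)\<^sup>2) \<longlonglongrightarrow> 0" by simp
  from Lim_null_comparison[OF always_eventually[OF allI[OF bd]] this]
  show "(\<lambda>n. M (fst (p n)) (snd (p n))) \<longlonglongrightarrow> M (fst a) (snd a)" by (rule LIM_zero_cancel)
qed

lemma continuous_on_M_s: "z \<notin> \<real> \<Longrightarrow> continuous_on S (\<lambda>s. M s z)"
  by (rule continuous_on_compose2[OF continuous_on_M, of S "\<lambda>s. (s, z)", simplified])
     (auto simp: complex_is_Real_iff intro!: continuous_intros)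

end

section \<open>The Stieltjes transform of a finite measure\<close>

text \<open>With this sign a positive measure has a transform with nonnegative imaginary part above
  the real axis.\<close>

definition stieltjes :: "real measure \<Rightarrow> complex \<Rightarrow> complex" where
  "stieltjes M z = (\<integral>x. inverse (complex_of_real x - z) \<partial>M)"

lemma of_real_minus_nonreal: "z \<notin> \<real> \<Longrightarrow> complex_of_real x - z \<noteq> 0"
  by (metis Reals_of_real eq_iff_diff_eq_0)

lemma cmod_inverse_le:
  assumes "z \<notin> \<real>"
  shows "cmod (inverse (complex_of_real x - z)) \<le> 1 / \<bar>Im z\<bar>"
proof -
  have "\<bar>Im z\<bar> > 0" using assms by (simp add: complex_is_Real_iff)
  moreover have "\<bar>Im z\<bar> \<le> cmod (complex_of_real x - z)"
    using abs_Im_le_cmod[of "complex_of_real x - z"] by simp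
  ultimately have "inverse (cmod (complex_of_real x - z)) \<le> inverse \<bar>Im z\<bar>"
    by (intro le_imp_inverse_le)
  then show ?thesis unfolding norm_inverse by (simp add: inverse_eq_divide)
qed

text \<open>Up to a factor pi this is the Poisson kernel of the upper half plane.\<close>

lemma Im_inverse_Complex: "Im (inverse (complex_of_real x - Complex l e)) = e / ((x - l)\<^sup>2 + e\<^sup>2)"
  by (simp add: power2_eq_square)

text \<open>The value 0 of the limit at y = 0 is the source of the half weights at endpoints in the
  inversion formula.\<close>

lemma arctan_scaled_tendsto:
  "(\<lambda>n. arctan (y * real (Suc n))) \<longlonglongrightarrow> pi / 2 * sgn y"
proof -
  have inf: "filterlim (\<lambda>n. c * real (Suc n)) at_top sequentially" if "c > 0" for c :: real
    by (rule filterlim_tendsto_pos_mult_at_top[OF tendsto_const that])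
       (rule filterlim_compose[OF filterlim_real_sequentially filterlim_Suc])
  consider "y > 0" | "y = 0" | "y < 0" by linarith
  then show ?thesis
  proof cases
    case 1
    then show ?thesis using filterlim_compose[OF tendsto_arctan_at_top inf[OF 1]] by simp
  next
    case 3
    then have "- y > 0" by simp
    from tendsto_minus[OF filterlim_compose[OF tendsto_arctan_at_top inf[OF this]]]
    show ?thesis using 3 by (simp add: arctan_minus)
  qed simp
qed

context
  fixes M :: "real measure"
  assumes fin: "finite_measure M" and sets_M [measurable_cong]: "sets M = sets borel"
begin

interpretation finite_measure M by (rule fin)

lemma integrable_inverse_minus: "z \<notin> \<real> \<Longrightarrow> integrable M (\<lambda>x. inverse (complex_of_real x - z))"
  by (rule integrable_const_bound[where B = "1 / \<bar>Im z\<bar>"]) (auto simp: cmod_inverse_le)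

lemma Im_stieltjes:
  assumes "e > 0"
  shows "Im (stieltjes M (Complex l e)) = (\<integral>x. e / ((x - l)\<^sup>2 + e\<^sup>2) \<partial>M)"
proof -
  have "Complex l e \<notin> \<real>" using assms by (simp add: complex_is_Real_iff)
  from integrable_inverse_minus[OF this] show ?thesis
    unfolding stieltjes_def by (subst integral_Im[symmetric]) (simp_all only: Im_inverse_Complex)
qed

lemma poisson_le:
  assumes "e > 0"
  shows "e / ((x - l)\<^sup>2 + e\<^sup>2) \<le> 1 / (e::real)"
proof -
  have "e / ((x - l)\<^sup>2 + e\<^sup>2) \<le> e / e\<^sup>2" using assms by (intro divide_left_mono) (auto simp: add_nonneg_pos)
  then show ?thesis using assms by (simp add: power2_eq_square)
qed

text \<open>Fubini is available because the kernel is at most 1 / e on a product set of finite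
  measure; the inner integral has an arctan primitive.\<close>

lemma integral_Im_stieltjes:
  assumes e: "e > 0" and ab: "a \<le> b"
  shows "(\<integral>l. indicator {a..b} l * Im (stieltjes M (Complex l e)) \<partial>lborel) =
    (\<integral>x. arctan ((b - x) / e) - arctan ((a - x) / e) \<partial>M)"
proof -
  interpret P: pair_sigma_finite M lborel
    by (intro pair_sigma_finite.intro sigma_finite_measure_axioms lborel.sigma_finite_measure_axioms)
  define f where "f = (\<lambda>x l. indicator {a..b} l * (e / ((x - l)\<^sup>2 + e\<^sup>2)))"
  have "integrable (M \<Otimes>\<^sub>M lborel) (case_prod f)"
  proof (rule integrableI_bounded_set[where A = "space M \<times> {a..b}" and B = "1 / e"])
    show "case_prod f \<in> borel_measurable (M \<Otimes>\<^sub>M lborel)" unfolding f_def by measurable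
    show "emeasure (M \<Otimes>\<^sub>M lborel) (space M \<times> {a..b}) < \<infinity>"
      by (subst lborel.emeasure_pair_measure_Times)
         (use ab in \<open>auto simp: ennreal_mult_less_top emeasure_eq_measure\<close>)
    show "AE x in M \<Otimes>\<^sub>M lborel. x \<in> space M \<times> {a..b} \<longrightarrow> norm (case_prod f x) \<le> 1 / e"
    proof (intro AE_I2 impI, clarsimp)
      fix x l
      have "\<bar>f x l\<bar> \<le> \<bar>e / ((x - l)\<^sup>2 + e\<^sup>2)\<bar>" by (auto simp: f_def indicator_def)
      also have "\<dots> \<le> 1 / e" using e poisson_le[OF e, of x l] by (simp add: abs_of_nonneg)
      finally show "\<bar>f x l\<bar> \<le> 1 / e" .
    qed
    show "AE x in M \<Otimes>\<^sub>M lborel. x \<notin> space M \<times> {a..b} \<longrightarrow> case_prod f x = 0"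
      by (intro AE_I2) (auto simp: f_def space_pair_measure indicator_def)
  qed auto
  moreover have "(\<integral>x. f x l \<partial>M) = indicator {a..b} l * Im (stieltjes M (Complex l e))" for l
    unfolding f_def Im_stieltjes[OF e] by (rule integral_mult_right_zero)
  ultimately have "(\<integral>l. indicator {a..b} l * Im (stieltjes M (Complex l e)) \<partial>lborel) = (\<integral>x. (\<integral>l. f x l \<partial>lborel) \<partial>M)"
    using P.Fubini_integral[of f] by simp
  also have "\<dots> = (\<integral>x. arctan ((b - x) / e) - arctan ((a - x) / e) \<partial>M)"
  proof (rule Bochner_Integration.integral_cong[OF refl])
    fix x
    have "(\<integral>l. (e / ((x - l)\<^sup>2 + e\<^sup>2)) * indicator {a..b} l \<partial>lborel) = arctan ((b - x) / e) - arctan ((a - x) / e)"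
    proof (rule integral_FTC_Icc_real[OF ab])
      fix l
      have nz: "(x - l)\<^sup>2 + e\<^sup>2 \<noteq> 0" using e by (metis power2_eq_square sum_power2_eq_zero_iff less_irrefl)
      have "((\<lambda>l. arctan ((l - x) / e)) has_real_derivative (inverse (1 + ((l - x) / e)\<^sup>2)) * (1 / e)) (at l)"
        using e by (auto intro!: derivative_eq_intros simp: divide_inverse)
      moreover have "(inverse (1 + ((l - x) / e)\<^sup>2)) * (1 / e) = e / ((x - l)\<^sup>2 + e\<^sup>2)"
      proof -
        have "1 + ((l - x) / e)\<^sup>2 = ((x - l)\<^sup>2 + e\<^sup>2) / e\<^sup>2"
          using e by (simp add: field_simps power2_commute)
        then show ?thesis using e nz by (simp add: field_simps power2_eq_square)
      qed
      ultimately show "((\<lambda>l. arctan ((l - x) / e)) has_real_derivative e / ((x - l)\<^sup>2 + e\<^sup>2)) (at l)" by simp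
      show "isCont (\<lambda>l. e / ((x - l)\<^sup>2 + e\<^sup>2)) l" using nz by (intro continuous_intros) auto
    qed
    then show "(\<integral>l. f x l \<partial>lborel) = arctan ((b - x) / e) - arctan ((a - x) / e)"
      by (simp add: f_def mult.commute)
  qed
  finally show ?thesis .
qed

text \<open>For a < b the limiting integrand is 1 strictly between them and 1/2 at both endpoints,
  so atoms at endpoints count by half.\<close>

lemma stieltjes_inversion:
  assumes ab: "a \<le> b"
  shows "(\<lambda>n. \<integral>l. indicator {a..b} l * Im (stieltjes M (Complex l (1 / real (Suc n)))) \<partial>lborel)
    \<longlonglongrightarrow> pi * (\<integral>x. (sgn (b - x) - sgn (a - x)) / 2 \<partial>M)"
proof -
  have "(\<lambda>n. \<integral>x. arctan ((b - x) / (1 / real (Suc n))) - arctan ((a - x) / (1 / real (Suc n))) \<partial>M)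
    \<longlonglongrightarrow> (\<integral>x. pi / 2 * sgn (b - x) - pi / 2 * sgn (a - x) \<partial>M)"
  proof (rule integral_dominated_convergence[where w = "\<lambda>_. pi"])
    show "AE x in M. (\<lambda>n. arctan ((b - x) / (1 / real (Suc n))) - arctan ((a - x) / (1 / real (Suc n))))
      \<longlonglongrightarrow> pi / 2 * sgn (b - x) - pi / 2 * sgn (a - x)"
      using tendsto_diff[OF arctan_scaled_tendsto arctan_scaled_tendsto] by simp
    show "AE x in M. norm (arctan ((b - x) / (1 / real (Suc n))) - arctan ((a - x) / (1 / real (Suc n)))) \<le> pi" for n
    proof (rule AE_I2)
      show "norm (arctan u - arctan v) \<le> pi" for u v :: real
        using arctan_bounded[of u] arctan_bounded[of v] by (simp add: abs_le_iff)
    qed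
  qed simp_all
  also have "(\<integral>x. pi / 2 * sgn (b - x) - pi / 2 * sgn (a - x) \<partial>M) = pi * (\<integral>x. (sgn (b - x) - sgn (a - x)) / 2 \<partial>M)"
    by (subst integral_mult_right_zero[symmetric]) (simp add: field_simps)
  finally show ?thesis by (simp add: integral_Im_stieltjes ab)
qed

text \<open>Both endpoints are approached from the right. The half weights disappear and the
  interval that contains its right endpoint remains.\<close>

lemma measure_Ioc_limit:
  assumes ab: "a \<le> b"
  shows "(\<lambda>n. \<integral>x. (sgn (b + 1 / real (Suc n) - x) - sgn (a + 1 / real (Suc n) - x)) / 2 \<partial>M) \<longlonglongrightarrow> measure M {a<..b}"
proof -
  have lim: "(\<lambda>n. sgn (c + 1 / real (Suc n) - x)) \<longlonglongrightarrow> (if x \<le> c then 1 else -1)" for c x :: real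
  proof (cases "x \<le> c")
    case True
    have "sgn (c + 1 / real (Suc n) - x) = 1" for n
    proof -
      have "0 < 1 / real (Suc n)" by (rule divide_pos_pos) auto
      then have "c + 1 / real (Suc n) - x > 0" using True by linarith
      then show ?thesis by (simp only: sgn_1_pos)
    qed
    then show ?thesis using True by simp
  next
    case False
    have "(\<lambda>n. c + 1 / real (Suc n) - x) \<longlonglongrightarrow> c + 0 - x"
      by (intro tendsto_intros LIMSEQ_Suc[OF lim_1_over_n])
    then have "\<forall>\<^sub>F n in sequentially. c + 1 / real (Suc n) - x < 0"
      by (rule order_tendstoD(2)) (use False in simp)
    then have "\<forall>\<^sub>F n in sequentially. sgn (c + 1 / real (Suc n) - x) = -1" by eventually_elim simp
    then show ?thesis using False by (simp add: tendsto_eventually)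
  qed
  have "(\<lambda>n. \<integral>x. (sgn (b + 1 / real (Suc n) - x) - sgn (a + 1 / real (Suc n) - x)) / 2 \<partial>M)
    \<longlonglongrightarrow> (\<integral>x. ((if x \<le> b then 1 else -1) - (if x \<le> a then 1 else -1)) / 2 \<partial>M)"
  proof (rule integral_dominated_convergence[where w = "\<lambda>_. 1"])
    show "AE x in M. (\<lambda>n. (sgn (b + 1 / real (Suc n) - x) - sgn (a + 1 / real (Suc n) - x)) / 2)
      \<longlonglongrightarrow> ((if x \<le> b then 1 else -1) - (if x \<le> a then 1 else -1)) / 2"
      by (intro AE_I2 tendsto_divide tendsto_diff lim tendsto_const) simp
    show "AE x in M. norm ((sgn (b + 1 / real (Suc n) - x) - sgn (a + 1 / real (Suc n) - x)) / 2) \<le> 1" for n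
      by (auto simp: sgn_if)
  qed auto
  also have "(\<integral>x. ((if x \<le> b then 1 else -1) - (if x \<le> a then 1 else -1)) / 2 \<partial>M) = (\<integral>x. (indicator {a<..b} x :: real) \<partial>M)"
    using ab by (intro Bochner_Integration.integral_cong) (auto simp: indicator_def)
  finally show ?thesis by simp
qed

text \<open>The pi of the hypothesis cancels the pi of the inversion formula; this is how a bound on
  an imaginary part becomes a bound on a density.\<close>

lemma measure_Ioc_le:
  assumes ab: "a \<le> b" and C: "\<And>z. Im z > 0 \<Longrightarrow> Im (stieltjes M z) \<le> pi * C"
  shows "measure M {a<..b} \<le> C * (b - a)"
proof (rule LIMSEQ_le_const2[OF measure_Ioc_limit[OF ab]], intro exI allI impI)
  fix n
  define h where "h = 1 / real (Suc n)"
  \<comment> \<open>Nonnegativity of C follows from its own hypothesis, as the transform has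
    nonnegative imaginary part.\<close>
  have C0: "0 \<le> C"
  proof -
    have "0 \<le> Im (stieltjes M (Complex 0 1))" by (subst Im_stieltjes) auto
    also have "\<dots> \<le> pi * C" by (rule C) simp
    finally show ?thesis using pi_gt_zero by (simp add: zero_le_mult_iff)
  qed
  have "pi * (\<integral>x. (sgn ((b + h) - x) - sgn ((a + h) - x)) / 2 \<partial>M) \<le> pi * (C * (b - a))"
  proof (rule LIMSEQ_le_const2[OF stieltjes_inversion], safe intro!: exI[of _ 0])
    show "a + h \<le> b + h" using ab by simp
    fix m
    have "(\<integral>l. indicator {a + h..b + h} l * Im (stieltjes M (Complex l (1 / real (Suc m)))) \<partial>lborel) \<le>
       (\<integral>l. indicator {a + h..b + h} l * (pi * C) \<partial>lborel)"
    proof (rule integral_mono_AE')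
      show "integrable lborel (\<lambda>l. indicator {a + h..b + h} l * (pi * C))"
        by (intro integrable_mult_left integrable_real_indicator) (auto simp: emeasure_lborel_Icc_eq)
    qed (use C C0 in \<open>auto simp: indicator_def\<close>)
    also have "\<dots> = pi * (C * (b - a))" using ab by simp
    finally show "(\<integral>l. indicator {a + h..b + h} l * Im (stieltjes M (Complex l (1 / real (Suc m)))) \<partial>lborel) \<le> pi * (C * (b - a))" .
  qed
  then show "(\<integral>x. (sgn (b + 1 / real (Suc n) - x) - sgn (a + 1 / real (Suc n) - x)) / 2 \<partial>M) \<le> C * (b - a)"
    unfolding h_def by (simp only: mult_le_cancel_left_pos[OF pi_gt_zero])
qed

end

section \<open>Uniqueness of the transform and measurable families of measures\<close>

lemma measure_eqI_Ioc:
  fixes M N :: "real measure"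
  assumes M: "finite_measure M" "sets M = sets borel" and N: "finite_measure N" "sets N = sets borel"
    and eq: "\<And>a b. a \<le> b \<Longrightarrow> measure M {a<..b} = measure N {a<..b}"
  shows "M = N"
proof (rule measure_eqI_lessThan[OF M(2) N(2)])
  interpret M: finite_measure M by (rule M)
  interpret N: finite_measure N by (rule N)
  fix x :: real
  show "emeasure M {x<..} < \<infinity>" by (simp add: less_top[symmetric])
  have "\<exists>n. y \<le> x + real n" for y using real_arch_simple[of "y - x"] by (auto simp: algebra_simps)
  then have U: "{x<..} = (\<Union>n. {x<..x + real n})" by auto
  have i: "incseq (\<lambda>n. {x<..x + real n})" by (auto simp: incseq_def)
  have "(\<lambda>n. emeasure M {x<..x + real n}) \<longlonglongrightarrow> emeasure M {x<..}"
    unfolding U by (rule Lim_emeasure_incseq[OF _ i]) (simp add: M(2) image_subset_iff)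
  moreover have "(\<lambda>n. emeasure N {x<..x + real n}) \<longlonglongrightarrow> emeasure N {x<..}"
    unfolding U by (rule Lim_emeasure_incseq[OF _ i]) (simp add: N(2) image_subset_iff)
  moreover have "emeasure M {x<..x + real n} = emeasure N {x<..x + real n}" for n
    by (simp add: M.emeasure_eq_measure N.emeasure_eq_measure eq)
  ultimately show "emeasure M {x<..} = emeasure N {x<..}" using LIMSEQ_unique by simp
qed

text \<open>Inversion looks only at points above the real axis, so agreement there suffices.\<close>

lemma stieltjes_unique:
  fixes M N :: "real measure"
  assumes M: "finite_measure M" "sets M = sets borel" and N: "finite_measure N" "sets N = sets borel"
    and eq: "\<And>z. Im z > 0 \<Longrightarrow> stieltjes M z = stieltjes N z"
  shows "M = N"
proof (rule measure_eqI_Ioc[OF M N])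
  fix a b :: real assume ab: "a \<le> b"
  have *: "(\<integral>x. (sgn (b + h - x) - sgn (a + h - x)) / 2 \<partial>M) = (\<integral>x. (sgn (b + h - x) - sgn (a + h - x)) / 2 \<partial>N)" for h
  proof -
    have ab': "a + h \<le> b + h" using ab by simp
    have e: "stieltjes M (Complex l (1 / real (Suc n))) = stieltjes N (Complex l (1 / real (Suc n)))" for l n
      by (rule eq) simp
    show ?thesis
      using LIMSEQ_unique[OF stieltjes_inversion[OF M ab', unfolded e] stieltjes_inversion[OF N ab']] by simp
  qed
  show "measure M {a<..b} = measure N {a<..b}"
    by (rule LIMSEQ_unique[OF measure_Ioc_limit[OF M ab, unfolded *] measure_Ioc_limit[OF N ab]])
qed

text \<open>Measurability in the parameter passes from the transform to the measures: inversion
  writes the mass of a half-open interval as an iterated limit of parameter integrals, and the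
  pi-lambda theorem extends this to Borel sets.\<close>

lemma measurable_measure_stieltjes:
  fixes N :: "'s \<Rightarrow> real measure"
  assumes N: "\<And>s. s \<in> space S \<Longrightarrow> finite_measure (N s)" "\<And>s. s \<in> space S \<Longrightarrow> sets (N s) = sets borel"
    and meas: "\<And>e. e > 0 \<Longrightarrow> (\<lambda>(s, l). stieltjes (N s) (Complex l e)) \<in> borel_measurable (S \<Otimes>\<^sub>M lborel)"
    and A: "A \<in> sets borel"
  shows "(\<lambda>s. measure (N s) A) \<in> borel_measurable S"
proof -
  have lim: "g \<in> borel_measurable S"
    if "\<And>n. f n \<in> borel_measurable S" "\<And>s. s \<in> space S \<Longrightarrow> (\<lambda>n. f n s) \<longlonglongrightarrow> g s"
    for f :: "nat \<Rightarrow> 's \<Rightarrow> real" and g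
    by (rule borel_measurable_LIMSEQ_real[OF that(2,1)])
  have Ioc: "(\<lambda>s. measure (N s) {a<..b}) \<in> borel_measurable S" if ab: "a \<le> b" for a b
  proof (rule lim[OF _ measure_Ioc_limit[OF N(1) N(2) ab]])
    fix n
    define h where "h = 1 / real (Suc n)"
    have ab': "a + h \<le> b + h" using ab by simp
    have "(\<lambda>s. pi * (\<integral>x. (sgn (b + h - x) - sgn (a + h - x)) / 2 \<partial>N s)) \<in> borel_measurable S"
    proof (rule lim[OF _ stieltjes_inversion[OF N(1) N(2) ab']])
      fix m
      have [measurable]: "(\<lambda>(s, l). stieltjes (N s) (Complex l (1 / real (Suc m)))) \<in> borel_measurable (S \<Otimes>\<^sub>M lborel)"
        by (rule meas) simp
      show "(\<lambda>s. \<integral>l. indicator {a + h..b + h} l * Im (stieltjes (N s) (Complex l (1 / real (Suc m)))) \<partial>lborel) \<in> borel_measurable S"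
        by measurable
    qed
    from borel_measurable_times[OF borel_measurable_const this, of "1 / pi"]
    show "(\<lambda>s. \<integral>x. (sgn (b + 1 / real (Suc n) - x) - sgn (a + 1 / real (Suc n) - x)) / 2 \<partial>N s) \<in> borel_measurable S"
      by (simp add: h_def del: integral_divide_zero of_nat_Suc)
  qed
  \<comment> \<open>The complement step of the induction below subtracts from the total mass, which
    is not a half-open interval and needs a limit of its own.\<close>
  have UNIV: "(\<lambda>s. measure (N s) UNIV) \<in> borel_measurable S"
  proof (rule lim)
    show "(\<lambda>s. measure (N s) {- real n<..real n}) \<in> borel_measurable S" for n by (rule Ioc) simp
    fix s assume s: "s \<in> space S"
    interpret finite_measure "N s" by (rule N[OF s])
    have U: "UNIV = (\<Union>n. {- real n<..real n})"
    proof -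
      have "\<exists>n. - real n < x \<and> x \<le> real n" for x
        using reals_Archimedean2[of "\<bar>x\<bar>"] by (metis abs_less_iff less_eq_real_def minus_less_iff)
      then show ?thesis by auto
    qed
    have "(\<lambda>n. measure (N s) {- real n<..real n}) \<longlonglongrightarrow> measure (N s) (\<Union>n. {- real n<..real n})"
      by (rule finite_Lim_measure_incseq) (auto simp: incseq_def N(2)[OF s])
    then show "(\<lambda>n. measure (N s) {- real n<..real n}) \<longlonglongrightarrow> measure (N s) UNIV"
      by (simp only: U[symmetric])
  qed
  have gen: "sets borel = sigma_sets UNIV (range (\<lambda>(a, b). {a<..b::real}))"
    by (simp add: borel_sigma_sets_Ioc sets_measure_of)
  show ?thesis
  proof (rule sigma_sets_induct_disjoint[of "range (\<lambda>(a, b). {a<..b::real})" UNIV A])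
    show "Int_stable (range (\<lambda>(a, b). {a<..b::real}))"
      unfolding Int_stable_def
    proof (intro ballI)
      fix X Y assume "X \<in> range (\<lambda>(a, b). {a<..b::real})" "Y \<in> range (\<lambda>(a, b). {a<..b::real})"
      then obtain a b c d where "X = {a<..b}" "Y = {c<..d}" by auto
      then have "X \<inter> Y = (\<lambda>(a, b). {a<..b}) (max a c, min b d)" by auto
      then show "X \<inter> Y \<in> range (\<lambda>(a, b). {a<..b::real})" by (metis rangeI)
    qed
    show "A \<in> sigma_sets UNIV (range (\<lambda>(a, b). {a<..b::real}))" using A gen by simp
  next
    fix X assume "X \<in> range (\<lambda>(a, b). {a<..b::real})"
    then obtain a b where X: "X = {a<..b}" by auto
    show "(\<lambda>s. measure (N s) X) \<in> borel_measurable S" by (cases "a \<le> b") (auto simp: X Ioc)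
  next
    fix X assume X: "X \<in> sigma_sets UNIV (range (\<lambda>(a, b). {a<..b::real}))"
      "(\<lambda>s. measure (N s) X) \<in> borel_measurable S"
    have "measure (N s) (UNIV - X) = measure (N s) UNIV - measure (N s) X" if s: "s \<in> space S" for s
      using finite_measure.finite_measure_compl[OF N(1)[OF s], of X] X(1) N(2)[OF s] gen
        sets_eq_imp_space_eq[OF N(2)[OF s]] by simp
    then show "(\<lambda>s. measure (N s) (UNIV - X)) \<in> borel_measurable S"
      using borel_measurable_diff[OF UNIV X(2)] by (simp cong: measurable_cong)
  next
    fix X :: "nat \<Rightarrow> real set"
    assume X: "disjoint_family X" "range X \<subseteq> sigma_sets UNIV (range (\<lambda>(a, b). {a<..b::real}))"
      "\<And>i. (\<lambda>s. measure (N s) (X i)) \<in> borel_measurable S"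
    show "(\<lambda>s. measure (N s) (\<Union>i. X i)) \<in> borel_measurable S"
    proof (rule lim)
      show "(\<lambda>s. \<Sum>i<n. measure (N s) (X i)) \<in> borel_measurable S" for n
        by (intro borel_measurable_sum X)
      show "(\<lambda>n. \<Sum>i<n. measure (N s) (X i)) \<longlonglongrightarrow> measure (N s) (\<Union>i. X i)" if s: "s \<in> space S" for s
        using finite_measure.finite_measure_UNION[OF N(1)[OF s] _ X(1)] X(2) N(2)[OF s] gen
        by (simp add: sums_def)
    qed
  qed auto
qed

subsection \<open>Mixtures of measures\<close>

text \<open>All conditions are confined to \<open>space S\<close>: in the application nothing is
  known about the measures for couplings outside the unit interval. The uniform bound c makes the
  mixture finite.\<close>

locale measure_mixture = finite_measure S for S :: "'s measure" +
  fixes N :: "'s \<Rightarrow> real measure" and c :: real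
  assumes sets_N: "\<And>s. s \<in> space S \<Longrightarrow> sets (N s) = sets borel"
    and bound_N: "\<And>s. s \<in> space S \<Longrightarrow> emeasure (N s) UNIV \<le> ennreal c"
    and measurable_N: "\<And>A. A \<in> sets borel \<Longrightarrow> (\<lambda>s. measure (N s) A) \<in> borel_measurable S"
begin

definition mixture :: "real measure" where
  "mixture = measure_of UNIV (sets borel) (\<lambda>A. \<integral>\<^sup>+s. emeasure (N s) A \<partial>S)"

lemma space_N: "s \<in> space S \<Longrightarrow> space (N s) = UNIV"
  using sets_eq_imp_space_eq[OF sets_N] by simp

lemma finite_N:
  assumes "s \<in> space S"
  shows "finite_measure (N s)"
proof
  have "emeasure (N s) UNIV < \<infinity>" using bound_N[OF assms] by (rule le_less_trans) simp
  then show "emeasure (N s) (space (N s)) \<noteq> \<infinity>" using space_N[OF assms] by simp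
qed

lemma measurable_emeasure_N: "A \<in> sets borel \<Longrightarrow> (\<lambda>s. emeasure (N s) A) \<in> borel_measurable S"
  using measurable_compose[OF measurable_N measurable_ennreal]
  by (subst measurable_cong[of S _ "\<lambda>s. ennreal (measure (N s) A)"])
     (auto simp: finite_measure.emeasure_eq_measure[OF finite_N])

lemma sets_mixture [simp, measurable_cong]: "sets mixture = sets borel"
  unfolding mixture_def by (metis sets.sigma_sets_eq sets_measure_of sets.space_closed space_borel)

lemma space_mixture [simp]: "space mixture = UNIV"
  using sets_eq_imp_space_eq[OF sets_mixture] by simp

lemma emeasure_mixture:
  assumes "A \<in> sets borel"
  shows "emeasure mixture A = (\<integral>\<^sup>+s. emeasure (N s) A \<partial>S)"
  unfolding mixture_def
proof (rule emeasure_measure_of_sigma[OF _ _ _ assms])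
  show "sigma_algebra UNIV (sets (borel :: real measure))"
    using sets.sigma_algebra_axioms[of "borel :: real measure"] by simp
  show "positive (sets borel) (\<lambda>A. \<integral>\<^sup>+s. emeasure (N s) A \<partial>S)" by (simp add: positive_def)
  show "countably_additive (sets borel) (\<lambda>A. \<integral>\<^sup>+s. emeasure (N s) A \<partial>S)"
  proof (rule countably_additiveI)
    fix A :: "nat \<Rightarrow> real set"
    assume A: "range A \<subseteq> sets borel" "disjoint_family A"
    have "(\<Sum>i. \<integral>\<^sup>+s. emeasure (N s) (A i) \<partial>S) = (\<integral>\<^sup>+s. (\<Sum>i. emeasure (N s) (A i)) \<partial>S)"
      using A(1) by (intro nn_integral_suminf[symmetric] measurable_emeasure_N) auto
    also have "\<dots> = (\<integral>\<^sup>+s. emeasure (N s) (\<Union>i. A i) \<partial>S)"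
      using A by (intro nn_integral_cong suminf_emeasure) (auto simp: sets_N)
    finally show "(\<Sum>i. \<integral>\<^sup>+s. emeasure (N s) (A i) \<partial>S) = (\<integral>\<^sup>+s. emeasure (N s) (\<Union>i. A i) \<partial>S)" .
  qed
qed

lemma finite_mixture: "finite_measure mixture"
proof
  have "emeasure mixture UNIV \<le> (\<integral>\<^sup>+s. ennreal c \<partial>S)"
    by (subst emeasure_mixture, simp, rule nn_integral_mono, rule bound_N)
  also have "\<dots> < \<infinity>" by (simp add: ennreal_mult_less_top emeasure_eq_measure)
  finally show "emeasure mixture (space mixture) \<noteq> \<infinity>" by simp
qed

lemma measure_mixture_eq:
  assumes A: "A \<in> sets borel"
  shows "integrable S (\<lambda>s. measure (N s) A)" "measure mixture A = (\<integral>s. measure (N s) A \<partial>S)"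
proof -
  have "measure (N s) A \<le> \<bar>c\<bar>" if s: "s \<in> space S" for s
  proof -
    have "emeasure (N s) A \<le> ennreal c"
      using emeasure_mono[of A UNIV "N s"] bound_N[OF s] sets_N[OF s] by (auto intro: order_trans)
    also have "\<dots> \<le> ennreal \<bar>c\<bar>" by (intro ennreal_leI) simp
    finally show ?thesis
      by (simp add: finite_measure.emeasure_eq_measure[OF finite_N[OF s]])
  qed
  then show int: "integrable S (\<lambda>s. measure (N s) A)"
    by (intro integrable_const_bound[where B = "\<bar>c\<bar>"] measurable_N A AE_I2) auto
  have "emeasure mixture A = (\<integral>\<^sup>+s. ennreal (measure (N s) A) \<partial>S)"
    unfolding emeasure_mixture[OF A]
    by (intro nn_integral_cong) (simp add: finite_measure.emeasure_eq_measure[OF finite_N])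
  also have "\<dots> = ennreal (\<integral>s. measure (N s) A \<partial>S)" by (rule nn_integral_eq_integral[OF int]) auto
  finally show "measure mixture A = (\<integral>s. measure (N s) A \<partial>S)"
    by (simp add: measure_def integral_nonneg_AE)
qed

text \<open>Measurability of the inner integral is carried along with the identity, since the steps
  for sums and suprema integrate it over S.\<close>

lemma nn_integral_mixture:
  assumes "f \<in> borel_measurable borel"
  shows "(\<lambda>s. \<integral>\<^sup>+x. f x \<partial>N s) \<in> borel_measurable S \<and> (\<integral>\<^sup>+x. f x \<partial>mixture) = (\<integral>\<^sup>+s. (\<integral>\<^sup>+x. f x \<partial>N s) \<partial>S)"
  using assms
proof (induction f rule: borel_measurable_induct)
  case (cong f g)
  then show ?case by (simp add: fun_eq_iff[symmetric] cong: nn_integral_cong)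
next
  case (set A)
  then have "(\<integral>\<^sup>+x. indicator A x \<partial>N s) = emeasure (N s) A" if "s \<in> space S" for s
    using sets_N[OF that] by simp
  then show ?case
    using set measurable_emeasure_N[of A] by (simp add: emeasure_mixture cong: nn_integral_cong measurable_cong)
next
  case (mult u c)
  have "(\<integral>\<^sup>+x. c * u x \<partial>N s) = c * (\<integral>\<^sup>+x. u x \<partial>N s)" if "s \<in> space S" for s
    using mult(2) sets_N[OF that] by (intro nn_integral_cmult) (simp cong: measurable_cong_sets)
  moreover have "(\<integral>\<^sup>+x. c * u x \<partial>mixture) = c * (\<integral>\<^sup>+x. u x \<partial>mixture)"
    using mult(2) by (intro nn_integral_cmult) (simp cong: measurable_cong_sets)
  moreover have "(\<lambda>s. c * (\<integral>\<^sup>+x. u x \<partial>N s)) \<in> borel_measurable S"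
    using conjunct1[OF mult(4)] by measurable
  ultimately show ?case
    using mult by (simp add: nn_integral_cmult cong: nn_integral_cong measurable_cong)
next
  case (add u v)
  have "(\<integral>\<^sup>+x. v x + u x \<partial>N s) = (\<integral>\<^sup>+x. v x \<partial>N s) + (\<integral>\<^sup>+x. u x \<partial>N s)" if "s \<in> space S" for s
    using add sets_N[OF that] by (intro nn_integral_add) (simp_all cong: measurable_cong_sets)
  moreover have "(\<integral>\<^sup>+x. v x + u x \<partial>mixture) = (\<integral>\<^sup>+x. v x \<partial>mixture) + (\<integral>\<^sup>+x. u x \<partial>mixture)"
    using add by (intro nn_integral_add) (simp_all cong: measurable_cong_sets)
  moreover have "(\<lambda>s. (\<integral>\<^sup>+x. v x \<partial>N s) + (\<integral>\<^sup>+x. u x \<partial>N s)) \<in> borel_measurable S"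
    using conjunct1[OF add.IH(1)] conjunct1[OF add.IH(2)] by measurable
  ultimately show ?case
    using add by (simp add: nn_integral_add cong: nn_integral_cong measurable_cong)
next
  case (seq U)
  have i: "(\<integral>\<^sup>+x. (SUP i. U i x) \<partial>N s) = (SUP i. \<integral>\<^sup>+x. U i x \<partial>N s)" if "s \<in> space S" for s
    using seq sets_N[OF that] by (intro nn_integral_monotone_convergence_SUP) (simp_all cong: measurable_cong_sets)
  have m: "(\<integral>\<^sup>+x. (SUP i. U i x) \<partial>mixture) = (SUP i. \<integral>\<^sup>+x. U i x \<partial>mixture)"
    using seq by (intro nn_integral_monotone_convergence_SUP) (simp_all cong: measurable_cong_sets)
  have "(\<integral>\<^sup>+s. (SUP i. \<integral>\<^sup>+x. U i x \<partial>N s) \<partial>S) = (SUP i. \<integral>\<^sup>+s. (\<integral>\<^sup>+x. U i x \<partial>N s) \<partial>S)"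
    using seq by (intro nn_integral_monotone_convergence_SUP) (auto simp: incseq_def le_fun_def intro!: nn_integral_mono)
  moreover have "(\<lambda>s. SUP i. \<integral>\<^sup>+x. U i x \<partial>N s) \<in> borel_measurable S"
    using seq by (intro borel_measurable_SUP) auto
  moreover have "(\<integral>\<^sup>+x. U i x \<partial>mixture) = (\<integral>\<^sup>+s. (\<integral>\<^sup>+x. U i x \<partial>N s) \<partial>S)" for i
    using seq by blast
  ultimately show ?case
    using i m by (simp add: SUP_apply image_comp cong: nn_integral_cong measurable_cong)
qed

lemma integral_mixture_nonneg:
  fixes f :: "real \<Rightarrow> real"
  assumes f [measurable]: "f \<in> borel_measurable borel" and b: "\<And>x. 0 \<le> f x" "\<And>x. f x \<le> B"
  shows "integrable S (\<lambda>s. \<integral>x. f x \<partial>N s)" "(\<integral>x. f x \<partial>mixture) = (\<integral>s. (\<integral>x. f x \<partial>N s) \<partial>S)"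
proof -
  have B: "0 \<le> B" using b[of 0] by simp
  have "(\<integral>\<^sup>+x. ennreal (f x) \<partial>N s) = ennreal (\<integral>x. f x \<partial>N s) \<and> (\<integral>x. f x \<partial>N s) \<le> B * \<bar>c\<bar>" if s: "s \<in> space S" for s
  proof
    interpret N: finite_measure "N s" by (rule finite_N[OF s])
    note [measurable_cong] = sets_N[OF s]
    have i: "integrable (N s) f" by (rule N.integrable_const_bound[where B = B]) (use b in auto)
    show "(\<integral>\<^sup>+x. ennreal (f x) \<partial>N s) = ennreal (\<integral>x. f x \<partial>N s)"
      by (rule nn_integral_eq_integral[OF i]) (use b in auto)
    have "(\<integral>x. f x \<partial>N s) \<le> (\<integral>x. B \<partial>N s)" by (rule integral_mono[OF i]) (use b in auto)
    also have "\<dots> = B * measure (N s) UNIV" by (simp add: space_N[OF s])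
    also have "\<dots> \<le> B * \<bar>c\<bar>"
    proof (rule mult_left_mono[OF _ B])
      have "ennreal (measure (N s) UNIV) \<le> ennreal \<bar>c\<bar>"
        unfolding N.emeasure_eq_measure[symmetric]
        by (rule order_trans[OF bound_N[OF s]]) (simp add: ennreal_leI)
      then show "measure (N s) UNIV \<le> \<bar>c\<bar>" by simp
    qed
    finally show "(\<integral>x. f x \<partial>N s) \<le> B * \<bar>c\<bar>" .
  qed
  note N = this
  have nn: "0 \<le> (\<integral>x. f x \<partial>N s)" for s using b by simp
  have "(\<lambda>s. \<integral>\<^sup>+x. ennreal (f x) \<partial>N s) \<in> borel_measurable S"
    and mix: "(\<integral>\<^sup>+x. ennreal (f x) \<partial>mixture) = (\<integral>\<^sup>+s. (\<integral>\<^sup>+x. ennreal (f x) \<partial>N s) \<partial>S)"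
    using nn_integral_mixture[of "\<lambda>x. ennreal (f x)"] by auto
  then have "(\<lambda>s. ennreal (\<integral>x. f x \<partial>N s)) \<in> borel_measurable S"
    using N by (simp cong: measurable_cong)
  then have "(\<lambda>s. enn2real (ennreal (\<integral>x. f x \<partial>N s))) \<in> borel_measurable S" by measurable
  then have "(\<lambda>s. \<integral>x. f x \<partial>N s) \<in> borel_measurable S" using nn by simp
  then show int: "integrable S (\<lambda>s. \<integral>x. f x \<partial>N s)"
    using N nn by (intro integrable_const_bound[where B = "B * \<bar>c\<bar>"] AE_I2) auto
  have i: "integrable mixture f"
    by (rule finite_measure.integrable_const_bound[OF finite_mixture, where B = B]) (use b in auto)
  have "ennreal (\<integral>x. f x \<partial>mixture) = (\<integral>\<^sup>+x. ennreal (f x) \<partial>mixture)"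
    by (rule nn_integral_eq_integral[OF i, symmetric]) (use b in auto)
  also have "\<dots> = (\<integral>\<^sup>+s. ennreal (\<integral>x. f x \<partial>N s) \<partial>S)"
    unfolding mix using N by (intro nn_integral_cong) simp
  also have "\<dots> = ennreal (\<integral>s. (\<integral>x. f x \<partial>N s) \<partial>S)"
    by (rule nn_integral_eq_integral[OF int]) (use nn in auto)
  finally show "(\<integral>x. f x \<partial>mixture) = (\<integral>s. (\<integral>x. f x \<partial>N s) \<partial>S)"
    using b nn by (subst (asm) ennreal_inj) auto
qed

text \<open>Adding B moves f into the range from 0 to 2 B, where the nonnegative case applies; the
  constant is subtracted again because the measures are finite.\<close>

lemma integral_mixture_real:
  fixes f :: "real \<Rightarrow> real"
  assumes f [measurable]: "f \<in> borel_measurable borel" and b: "\<And>x. \<bar>f x\<bar> \<le> B"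
  shows "integrable S (\<lambda>s. \<integral>x. f x \<partial>N s) \<and> (\<integral>x. f x \<partial>mixture) = (\<integral>s. (\<integral>x. f x \<partial>N s) \<partial>S)"
proof -
  have b': "0 \<le> f x + B" "f x + B \<le> 2 * B" for x using b[of x] by (simp_all add: abs_le_iff)
  have B: "0 \<le> B" using b[of 0] by simp
  have eq: "(\<integral>x. f x \<partial>P) = (\<integral>x. f x + B \<partial>P) - (\<integral>x. B \<partial>P)" if "finite_measure P" and [measurable_cong]: "sets P = sets borel" for P
  proof -
    interpret P: finite_measure P by fact
    have "integrable P f" by (rule P.integrable_const_bound[where B = B]) (use b in auto)
    then show ?thesis by simp
  qed
  note 1 = integral_mixture_nonneg[of "\<lambda>x. f x + B" "2 * B", OF _ b', simplified]
  note 2 = integral_mixture_nonneg[of "\<lambda>x. B" B, OF _ B order_refl]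
  have N: "(\<integral>x. f x \<partial>N s) = (\<integral>x. f x + B \<partial>N s) - (\<integral>x. B \<partial>N s)" if "s \<in> space S" for s
    by (rule eq[OF finite_N sets_N]) (rule that)+
  have "integrable S (\<lambda>s. (\<integral>x. f x + B \<partial>N s) - (\<integral>x. B \<partial>N s))"
    by (intro Bochner_Integration.integrable_diff 1 2) auto
  then have "integrable S (\<lambda>s. \<integral>x. f x \<partial>N s)"
    by (subst Bochner_Integration.integrable_cong[OF refl N]) auto
  moreover have "(\<integral>s. (\<integral>x. f x \<partial>N s) \<partial>S) = (\<integral>s. (\<integral>x. f x + B \<partial>N s) - (\<integral>x. B \<partial>N s) \<partial>S)"
    by (rule Bochner_Integration.integral_cong[OF refl N])
  moreover have "\<dots> = (\<integral>x. f x + B \<partial>mixture) - (\<integral>x. B \<partial>mixture)"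
    by (subst Bochner_Integration.integral_diff) (use 1 2 in auto)
  ultimately show ?thesis using eq[OF finite_mixture sets_mixture] by simp
qed

lemma stieltjes_mixture:
  assumes z: "z \<notin> \<real>"
  shows "integrable S (\<lambda>s. stieltjes (N s) z)" "stieltjes mixture z = (\<integral>s. stieltjes (N s) z \<partial>S)"
proof -
  have bd: "\<bar>Re (inverse (complex_of_real x - z))\<bar> \<le> 1 / \<bar>Im z\<bar>" "\<bar>Im (inverse (complex_of_real x - z))\<bar> \<le> 1 / \<bar>Im z\<bar>" for x
    using cmod_inverse_le[OF z, of x] abs_Re_le_cmod order_trans abs_Im_le_cmod by blast+
  have m: "(\<lambda>x. Re (inverse (complex_of_real x - z))) \<in> borel_measurable borel"
    "(\<lambda>x. Im (inverse (complex_of_real x - z))) \<in> borel_measurable borel" by measurable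
  have i: "integrable P (\<lambda>x. inverse (complex_of_real x - z))" if "finite_measure P" "sets P = sets borel" for P
    by (rule integrable_inverse_minus[OF that z])
  have st: "stieltjes P z = complex_of_real (\<integral>x. Re (inverse (complex_of_real x - z)) \<partial>P)
    + \<i> * complex_of_real (\<integral>x. Im (inverse (complex_of_real x - z)) \<partial>P)" if P: "finite_measure P" "sets P = sets borel" for P
    unfolding stieltjes_def integral_Re[OF i[OF P]] integral_Im[OF i[OF P]] by (rule complex_eq)
  note 1 = integral_mixture_real[OF m(1) bd(1)] and 2 = integral_mixture_real[OF m(2) bd(2)]
  have N: "stieltjes (N s) z = complex_of_real (\<integral>x. Re (inverse (complex_of_real x - z)) \<partial>N s)
    + \<i> * complex_of_real (\<integral>x. Im (inverse (complex_of_real x - z)) \<partial>N s)" if "s \<in> space S" for s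
    by (rule st[OF finite_N sets_N]) (rule that)+
  have i1: "integrable S (\<lambda>s. complex_of_real (\<integral>x. Re (inverse (complex_of_real x - z)) \<partial>N s))"
    using 1 by simp
  have i2: "integrable S (\<lambda>s. \<i> * complex_of_real (\<integral>x. Im (inverse (complex_of_real x - z)) \<partial>N s))"
    using 2 by (intro integrable_mult_right) simp
  show "integrable S (\<lambda>s. stieltjes (N s) z)"
  proof -
    have "integrable S (\<lambda>s. stieltjes (N s) z) \<longleftrightarrow>
      integrable S (\<lambda>s. complex_of_real (\<integral>x. Re (inverse (complex_of_real x - z)) \<partial>N s)
        + \<i> * complex_of_real (\<integral>x. Im (inverse (complex_of_real x - z)) \<partial>N s))"
      by (rule Bochner_Integration.integrable_cong[OF refl]) (rule N)
    then show ?thesis using Bochner_Integration.integrable_add[OF i1 i2] by simp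
  qed
  have "(\<integral>s. stieltjes (N s) z \<partial>S) = (\<integral>s. complex_of_real (\<integral>x. Re (inverse (complex_of_real x - z)) \<partial>N s)
    + \<i> * complex_of_real (\<integral>x. Im (inverse (complex_of_real x - z)) \<partial>N s) \<partial>S)"
    by (rule Bochner_Integration.integral_cong[OF refl N])
  also have "\<dots> = (\<integral>s. complex_of_real (\<integral>x. Re (inverse (complex_of_real x - z)) \<partial>N s) \<partial>S)
    + (\<integral>s. \<i> * complex_of_real (\<integral>x. Im (inverse (complex_of_real x - z)) \<partial>N s) \<partial>S)"
    by (rule Bochner_Integration.integral_add[OF i1 i2])
  also have "\<dots> = stieltjes mixture z"
    unfolding st[OF finite_mixture sets_mixture] using 1 2 by simp
  finally show "stieltjes mixture z = (\<integral>s. stieltjes (N s) z \<partial>S)" by simp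
qed

end

section \<open>Spectral families\<close>

context
  fixes E :: "real set \<Rightarrow> ('a::complex_hilbert \<Rightarrow>\<^sub>L 'a)"
  assumes pvm: "is_pvm E"
begin

abbreviation "specm \<equiv> scalar_spectral_measure E"

lemma pvm_clinear: "\<Delta> \<in> sets borel \<Longrightarrow> clinear_op (E \<Delta>)"
  and pvm_idem: "\<Delta> \<in> sets borel \<Longrightarrow> blinfun_apply (E \<Delta>) (blinfun_apply (E \<Delta>) x) = blinfun_apply (E \<Delta>) x"
  and pvm_empty: "E {} = 0" and pvm_UNIV: "E UNIV = id_blinfun"
  and pvm_Int: "\<Delta> \<in> sets borel \<Longrightarrow> \<Gamma> \<in> sets borel \<Longrightarrow> blinfun_apply (E \<Delta>) (blinfun_apply (E \<Gamma>) x) = blinfun_apply (E (\<Delta> \<inter> \<Gamma>)) x"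
  and pvm_sums: "range F \<subseteq> sets borel \<Longrightarrow> disjoint_family F \<Longrightarrow> (\<lambda>n. blinfun_apply (E (F n)) x) sums blinfun_apply (E (\<Union>n. F n)) x"
  using pvm unfolding is_pvm_def is_projection_def by (metis blinfun_apply_blinfun_compose)+

lemma pvm_adj:
  assumes "\<Delta> \<in> sets borel"
  shows "cinner (blinfun_apply (E \<Delta>) x) y = cinner x (blinfun_apply (E \<Delta>) y)"
proof -
  have "adj (E \<Delta>) = E \<Delta>" using pvm assms by (simp add: is_pvm_def is_projection_def)
  then show ?thesis using cinner_adj_right[OF pvm_clinear[OF assms], of x y] by simp
qed

lemma pvm_form: "\<Delta> \<in> sets borel \<Longrightarrow> cinner x (blinfun_apply (E \<Delta>) x) = complex_of_real ((norm (blinfun_apply (E \<Delta>) x))\<^sup>2)"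
  by (metis pvm_adj pvm_idem cinner_self)

lemma sets_specm [simp, measurable_cong]: "sets (specm x) = sets borel"
  unfolding scalar_spectral_measure_def by (metis sets.sigma_sets_eq sets_measure_of sets.space_closed space_borel)

lemma space_specm [simp]: "space (specm x) = UNIV"
  using sets_eq_imp_space_eq[OF sets_specm] by simp

lemma emeasure_specm:
  assumes "\<Delta> \<in> sets borel"
  shows "emeasure (specm x) \<Delta> = ennreal ((norm (blinfun_apply (E \<Delta>) x))\<^sup>2)"
proof -
  have "emeasure (specm x) \<Delta> = ennreal (Re (cinner x (blinfun_apply (E \<Delta>) x)))"
    unfolding scalar_spectral_measure_def
  proof (rule emeasure_measure_of_sigma[OF _ _ _ assms])
    show "sigma_algebra UNIV (sets (borel :: real measure))"
      using sets.sigma_algebra_axioms[of "borel :: real measure"] by simp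
    show "positive (sets borel) (\<lambda>\<Delta>. ennreal (Re (cinner x (blinfun_apply (E \<Delta>) x))))"
      by (simp add: positive_def pvm_empty)
    show "countably_additive (sets borel) (\<lambda>\<Delta>. ennreal (Re (cinner x (blinfun_apply (E \<Delta>) x))))"
    proof (rule countably_additiveI)
      fix F :: "nat \<Rightarrow> real set"
      assume F: "range F \<subseteq> sets borel" "disjoint_family F" "\<Union> (range F) \<in> sets borel"
      have "(\<lambda>n. cinner x (blinfun_apply (E (F n)) x)) sums cinner x (blinfun_apply (E (\<Union>n. F n)) x)"
        by (rule bounded_linear.sums[OF bounded_linear_cinner_right pvm_sums[OF F(1,2)]])
      then have "(\<lambda>n. Re (cinner x (blinfun_apply (E (F n)) x))) sums Re (cinner x (blinfun_apply (E (\<Union>n. F n)) x))"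
        by (rule sums_Re)
      then show "(\<Sum>i. ennreal (Re (cinner x (blinfun_apply (E (F i)) x)))) = ennreal (Re (cinner x (blinfun_apply (E (\<Union> (range F))) x)))"
        by (rule suminf_ennreal_eq[rotated]) (use F in \<open>simp add: pvm_form subset_iff\<close>)
    qed
  qed
  then show ?thesis by (simp add: pvm_form[OF assms])
qed

lemma finite_specm: "finite_measure (specm x)"
  by standard (simp add: emeasure_specm)

lemma measure_specm: "\<Delta> \<in> sets borel \<Longrightarrow> measure (specm x) \<Delta> = (norm (blinfun_apply (E \<Delta>) x))\<^sup>2"
  by (simp add: measure_def emeasure_specm)

lemma measure_specm_UNIV: "measure (specm x) UNIV = (norm x)\<^sup>2"
  by (simp add: measure_specm pvm_UNIV)

text \<open>By multiplicativity of E, projecting a vector cuts its spectral measure down to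
  \<Delta>. Domain and form of projected vectors can then be computed from the measure of x.\<close>

lemma specm_range:
  assumes \<Delta>: "\<Delta> \<in> sets borel"
  shows "specm (blinfun_apply (E \<Delta>) x) = density (specm x) (\<lambda>l. ennreal (indicator \<Delta> l))"
proof (rule measure_eqI)
  fix \<Gamma> assume "\<Gamma> \<in> sets (specm (blinfun_apply (E \<Delta>) x))"
  then have \<Gamma>: "\<Gamma> \<in> sets borel" by simp
  have "emeasure (density (specm x) (\<lambda>l. ennreal (indicator \<Delta> l))) \<Gamma> = (\<integral>\<^sup>+l. indicator \<Delta> l * indicator \<Gamma> l \<partial>specm x)"
    using \<Delta> \<Gamma> by (subst emeasure_density) (auto simp: ennreal_indicator)
  also have "\<dots> = (\<integral>\<^sup>+l. indicator (\<Gamma> \<inter> \<Delta>) l \<partial>specm x)"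
    by (intro nn_integral_cong) (auto simp: indicator_def)
  also have "\<dots> = emeasure (specm x) (\<Gamma> \<inter> \<Delta>)"
    using \<Delta> \<Gamma> by (intro nn_integral_indicator) auto
  finally show "emeasure (specm (blinfun_apply (E \<Delta>) x)) \<Gamma> = emeasure (density (specm x) (\<lambda>l. ennreal (indicator \<Delta> l))) \<Gamma>"
    using \<Delta> \<Gamma> by (simp add: emeasure_specm pvm_Int)
qed simp

end

section \<open>A spectral family reduces its operator: commutation, localization and the resolvent
  formula\<close>

context
  fixes D :: "'a::complex_hilbert set" and H :: "'a \<Rightarrow> 'a" and E :: "real set \<Rightarrow> ('a \<Rightarrow>\<^sub>L 'a)"
  assumes sa: "selfadjoint D H" and sf: "spectral_family D H E"
begin

lemma sf_pvm: "is_pvm E"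
  and sf_dom: "x \<in> D \<longleftrightarrow> (\<integral>\<^sup>+l. ennreal (l\<^sup>2) \<partial>specm E x) < \<infinity>"
  and sf_form: "x \<in> D \<Longrightarrow> cinner x (H x) = complex_of_real (LINT l|specm E x. l)"
  using sf unfolding spectral_family_def by auto

lemmas [measurable_cong] = sets_specm[OF sf_pvm]

lemma spectral_domain_invariant:
  assumes \<Delta>: "\<Delta> \<in> sets borel" and x: "x \<in> D"
  shows "blinfun_apply (E \<Delta>) x \<in> D"
proof -
  have "(\<integral>\<^sup>+l. ennreal (l\<^sup>2) \<partial>specm E (blinfun_apply (E \<Delta>) x)) = (\<integral>\<^sup>+l. ennreal (indicator \<Delta> l) * ennreal (l\<^sup>2) \<partial>specm E x)"
    unfolding specm_range[OF sf_pvm \<Delta>] using \<Delta> by (intro nn_integral_density) auto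
  also have "\<dots> \<le> (\<integral>\<^sup>+l. ennreal (l\<^sup>2) \<partial>specm E x)"
    by (intro nn_integral_mono) (auto simp: indicator_def)
  also have "\<dots> < \<infinity>" using x by (simp add: sf_dom)
  finally show ?thesis by (simp add: sf_dom)
qed

lemma integrable_id_specm:
  assumes x: "x \<in> D"
  shows "integrable (specm E x) (\<lambda>l. l)"
proof -
  interpret finite_measure "specm E x" by (rule finite_specm[OF sf_pvm])
  have "integrable (specm E x) (\<lambda>l. l\<^sup>2)"
    using x by (intro integrableI_nonneg) (auto simp: sf_dom)
  then have "integrable (specm E x) (\<lambda>l. 1 + l\<^sup>2)" by simp
  then show ?thesis
  proof (rule Bochner_Integration.integrable_bound)
    have "\<bar>l\<bar> \<le> 1 + l\<^sup>2" for l :: real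
    proof -
      have "0 \<le> (\<bar>l\<bar> - 1)\<^sup>2" by simp
      then have "2 * \<bar>l\<bar> \<le> 1 + l\<^sup>2" by (simp add: power2_eq_square algebra_simps)
      then show ?thesis by linarith
    qed
    then show "AE l in specm E x. norm l \<le> norm (1 + l\<^sup>2)" by auto
  qed simp
qed

text \<open>The first moment splits over \<Delta> and its complement, so the form of H has no cross
  terms. Commutation of E and H is derived from this and the invariance of the domain.\<close>

lemma spectral_form_split:
  assumes \<Delta>: "\<Delta> \<in> sets borel" and x: "x \<in> D"
  shows "cinner x (H x) = cinner (blinfun_apply (E \<Delta>) x) (H (blinfun_apply (E \<Delta>) x))
    + cinner (blinfun_apply (E (- \<Delta>)) x) (H (blinfun_apply (E (- \<Delta>)) x))"
proof -
  have part: "cinner (blinfun_apply (E \<Gamma>) x) (H (blinfun_apply (E \<Gamma>) x)) = complex_of_real (\<integral>l. indicator \<Gamma> l * l \<partial>specm E x)"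
    if \<Gamma>: "\<Gamma> \<in> sets borel" for \<Gamma>
    unfolding sf_form[OF spectral_domain_invariant[OF \<Gamma> x]] specm_range[OF sf_pvm \<Gamma>]
    using \<Gamma> by (subst integral_density) auto
  have i: "integrable (specm E x) (\<lambda>l. indicator \<Gamma> l * l)" if "\<Gamma> \<in> sets borel" for \<Gamma>
    using integrable_mult_indicator[of \<Gamma> "specm E x" "\<lambda>l. l"] that integrable_id_specm[OF x]
    by (simp add: sets_specm[OF sf_pvm])
  have "(LINT l|specm E x. l) = (\<integral>l. indicator \<Delta> l * l + indicator (- \<Delta>) l * l \<partial>specm E x)"
    by (intro Bochner_Integration.integral_cong) (auto simp: indicator_def)
  also have "\<dots> = (\<integral>l. indicator \<Delta> l * l \<partial>specm E x) + (\<integral>l. indicator (- \<Delta>) l * l \<partial>specm E x)"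
    by (intro Bochner_Integration.integral_add i) (use \<Delta> in auto)
  finally show ?thesis using \<Delta> by (simp add: part sf_form[OF x])
qed

lemma pvm_compl_range:
  assumes \<Delta>: "\<Delta> \<in> sets borel"
  shows "blinfun_apply (E \<Delta>) x + blinfun_apply (E (- \<Delta>)) x = x"
proof -
  define F where "F = (\<lambda>n::nat. if n = 0 then \<Delta> else if n = 1 then - \<Delta> else {})"
  have "(\<lambda>n. blinfun_apply (E (F n)) x) sums blinfun_apply (E (\<Union>n. F n)) x"
    using \<Delta> by (intro pvm_sums[OF sf_pvm]) (auto simp: F_def disjoint_family_on_def)
  moreover have "(\<Union>n. F n) = UNIV"
  proof -
    have "\<Delta> \<union> - \<Delta> \<subseteq> (\<Union>n. F n)" using UN_upper[of 0 UNIV F] UN_upper[of 1 UNIV F] by (auto simp: F_def)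
    then show ?thesis by auto
  qed
  moreover have "(\<lambda>n. blinfun_apply (E (F n)) x) sums (\<Sum>n\<in>{0, 1}. blinfun_apply (E (F n)) x)"
    by (rule sums_finite) (auto simp: F_def pvm_empty[OF sf_pvm])
  ultimately have "(\<Sum>n\<in>{0, 1}. blinfun_apply (E (F n)) x) = x"
    using sums_unique2 by (fastforce simp: pvm_UNIV[OF sf_pvm])
  then show ?thesis by (simp add: F_def)
qed

text \<open>The split form of v + w, with v and w in complementary ranges, forces the real part of
  the cross term to vanish; replacing y by i y removes the imaginary part.\<close>

lemma spectral_cross_zero:
  assumes \<Delta>: "\<Delta> \<in> sets borel" and x: "x \<in> D" and y: "y \<in> D"
  shows "cinner (blinfun_apply (E \<Delta>) y) (H (blinfun_apply (E (- \<Delta>)) x)) = 0"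
proof -
  have \<Delta>': "- \<Delta> \<in> sets borel" using \<Delta> by simp
  define w where "w = blinfun_apply (E (- \<Delta>)) x"
  have w: "w \<in> D" unfolding w_def by (rule spectral_domain_invariant[OF \<Delta>' x])
  have "Re (cinner v (H w)) = 0" if v: "v = blinfun_apply (E \<Delta>) y'" and y': "y' \<in> D" for v y'
  proof -
    have vD: "v \<in> D" unfolding v by (rule spectral_domain_invariant[OF \<Delta> y'])
    have Ev: "blinfun_apply (E \<Delta>) (v + w) = v" "blinfun_apply (E (- \<Delta>)) (v + w) = w"
      by (simp_all add: v w_def blinfun.add_right pvm_Int[OF sf_pvm] \<Delta> \<Delta>' pvm_empty[OF sf_pvm])
    have vw: "v + w \<in> D" by (rule selfadjoint_add[OF sa vD w])
    have "cinner (v + w) (H (v + w)) = cinner v (H v) + cinner w (H w)"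
      using spectral_form_split[OF \<Delta> vw] by (simp add: Ev)
    then have "cinner v (H w) + cinner w (H v) = 0"
      by (simp add: selfadjoint_add[OF sa vD w] cinner_simps add.commute)
    moreover have "cinner w (H v) = cnj (cinner v (H w))"
      using selfadjoint_symmetric[OF sa w vD] by (metis cinner_commute)
    ultimately show ?thesis by (simp add: complex_eq_iff)
  qed
  note re = this
  have iy: "\<i> *\<^sub>C y \<in> D" by (rule selfadjoint_scaleC[OF sa y])
  have "Re (cinner (\<i> *\<^sub>C blinfun_apply (E \<Delta>) y) (H w)) = 0"
    by (rule re[OF _ iy]) (simp add: clinear_opD[OF pvm_clinear[OF sf_pvm \<Delta>]])
  then show ?thesis using re[OF refl y] by (simp add: complex_eq_iff cinner_scaleC_left w_def)
qed

text \<open>Vanishing cross terms and density of D give E(\<Gamma>) H E(-\<Gamma>) = 0 on D. Used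
  for \<Delta> and for its complement, this is commutation.\<close>

lemma spectral_commute:
  assumes \<Delta>: "\<Delta> \<in> sets borel" and x: "x \<in> D"
  shows "blinfun_apply (E \<Delta>) (H x) = H (blinfun_apply (E \<Delta>) x)"
proof -
  have z: "blinfun_apply (E \<Gamma>) (H (blinfun_apply (E (- \<Gamma>)) x)) = 0" if \<Gamma>: "\<Gamma> \<in> sets borel" for \<Gamma>
    by (rule selfadjoint_orthogonal_dense[OF sa])
       (simp add: pvm_adj[OF sf_pvm \<Gamma>, symmetric] spectral_cross_zero[OF \<Gamma> x])
  have D: "blinfun_apply (E \<Delta>) x \<in> D" "blinfun_apply (E (- \<Delta>)) x \<in> D"
    using \<Delta> x by (auto intro: spectral_domain_invariant)
  have "H x = H (blinfun_apply (E \<Delta>) x) + H (blinfun_apply (E (- \<Delta>)) x)"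
    using selfadjoint_add(2)[OF sa D] by (simp add: pvm_compl_range[OF \<Delta>])
  then have "blinfun_apply (E \<Delta>) (H x) = blinfun_apply (E \<Delta>) (H (blinfun_apply (E \<Delta>) x))"
    using z[OF \<Delta>] by (simp add: blinfun.add_right)
  also have "\<dots> = H (blinfun_apply (E \<Delta>) x)"
    using pvm_compl_range[OF \<Delta>, of "H (blinfun_apply (E \<Delta>) x)"] z[of "- \<Delta>"] \<Delta> by simp
  finally show ?thesis .
qed

lemma spectral_range_dom:
  assumes \<Delta>: "\<Delta> \<in> sets borel" and b: "\<Delta> \<subseteq> {a..<a + h}"
  shows "blinfun_apply (E \<Delta>) x \<in> D"
proof -
  interpret finite_measure "specm E x" by (rule finite_specm[OF sf_pvm])
  define c where "c = (\<bar>a\<bar> + \<bar>h\<bar>)\<^sup>2"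
  have le: "ennreal (indicator \<Delta> l) * ennreal (l\<^sup>2) \<le> ennreal c" for l :: real
  proof (cases "l \<in> \<Delta>")
    case True
    then have "\<bar>l\<bar> \<le> \<bar>a\<bar> + \<bar>h\<bar>" using b by fastforce
    then have "l\<^sup>2 \<le> c" unfolding c_def by (metis abs_ge_zero power2_abs power_mono)
    then show ?thesis using True by (simp add: ennreal_leI)
  qed simp
  have "(\<integral>\<^sup>+l. ennreal (l\<^sup>2) \<partial>specm E (blinfun_apply (E \<Delta>) x)) = (\<integral>\<^sup>+l. ennreal (indicator \<Delta> l) * ennreal (l\<^sup>2) \<partial>specm E x)"
    unfolding specm_range[OF sf_pvm \<Delta>] using \<Delta> by (intro nn_integral_density) auto
  also have "\<dots> \<le> (\<integral>\<^sup>+l. ennreal c \<partial>specm E x)"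
    by (intro nn_integral_mono le)
  also have "\<dots> < \<infinity>" by (simp add: ennreal_mult_less_top emeasure_eq_measure)
  finally show ?thesis by (simp add: sf_dom)
qed

text \<open>The spectral measure of v lives on \<Delta>, where l - a lies between 0 and h, and the
  form of H - a at v is the integral of l - a.\<close>

lemma spectral_local_form:
  assumes \<Delta>: "\<Delta> \<in> sets borel" and b: "\<Delta> \<subseteq> {a..<a + h}" and v: "v = blinfun_apply (E \<Delta>) v" and vD: "v \<in> D"
  shows "0 \<le> Re (cinner v (H v - a *\<^sub>R v))" "Re (cinner v (H v - a *\<^sub>R v)) \<le> h * (norm v)\<^sup>2"
proof -
  interpret finite_measure "specm E v" by (rule finite_specm[OF sf_pvm])
  have "specm E v = density (specm E v) (\<lambda>l. ennreal (indicator \<Delta> l))"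
    using specm_range[OF sf_pvm \<Delta>, of v] v by simp
  then have "emeasure (specm E v) (- \<Delta>) = emeasure (density (specm E v) (\<lambda>l. ennreal (indicator \<Delta> l))) (- \<Delta>)"
    by simp
  also have "\<dots> = (\<integral>\<^sup>+l. ennreal (indicator \<Delta> l) * indicator (- \<Delta>) l \<partial>specm E v)"
    using \<Delta> by (intro emeasure_density) auto
  also have "\<dots> = (\<integral>\<^sup>+l. 0 \<partial>specm E v)" by (intro nn_integral_cong) (auto simp: indicator_def)
  finally have "- \<Delta> \<in> null_sets (specm E v)" using \<Delta> by (auto simp: sets_specm[OF sf_pvm])
  then have ae: "AE l in specm E v. a \<le> l \<and> l \<le> a + h"
    by (rule AE_I') (use b in \<open>fastforce\<close>)
  have eq: "Re (cinner v (H v - a *\<^sub>R v)) = (\<integral>l. l - a \<partial>specm E v)"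
    using integrable_id_specm[OF vD]
    by (simp add: cinner_simps sf_form[OF vD] cinner_self measure_specm_UNIV[OF sf_pvm] space_specm[OF sf_pvm] flip: of_real_power)
  show "0 \<le> Re (cinner v (H v - a *\<^sub>R v))" unfolding eq by (rule integral_nonneg_AE) (use ae in auto)
  have "(\<integral>l. l - a \<partial>specm E v) \<le> (\<integral>l. h \<partial>specm E v)"
    by (rule integral_mono_AE) (use ae integrable_id_specm[OF vD] in auto)
  then show "Re (cinner v (H v - a *\<^sub>R v)) \<le> h * (norm v)\<^sup>2"
    unfolding eq by (simp add: measure_specm_UNIV[OF sf_pvm] space_specm[OF sf_pvm] mult.commute)
qed

text \<open>Form bounds 0 and h for the symmetric operator H - a on the range of E(\<Delta>) bound
  its norm there by h. Positivity is tested on v - t y with y = (H - a) v, which stays in that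
  range.\<close>

lemma spectral_local_norm:
  assumes \<Delta>: "\<Delta> \<in> sets borel" and b: "\<Delta> \<subseteq> {a..<a + h}" and h: "h > 0" and v: "v = blinfun_apply (E \<Delta>) v"
  shows "norm (H v - a *\<^sub>R v) \<le> h * norm v"
proof -
  have dom: "u \<in> D" if "u = blinfun_apply (E \<Delta>) u" for u
    using spectral_range_dom[OF \<Delta> b, of u] that by simp
  have aR: "a *\<^sub>R u \<in> D" "H (a *\<^sub>R u) = a *\<^sub>R H u" if "u \<in> D" for u a
    using selfadjoint_scaleC[OF sa that, of "complex_of_real a"] by (simp_all add: scaleC_of_real)
  have vD: "v \<in> D" by (rule dom[OF v])
  define y where "y = H v - a *\<^sub>R v"
  have y: "y = blinfun_apply (E \<Delta>) y"
    using spectral_commute[OF \<Delta> vD] v by (simp add: y_def blinfun.diff_right blinfun.scaleR_right)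
  have yD: "y \<in> D" by (rule dom[OF y])
  \<comment> \<open>This t minimizes h ||v||^2 - 2 t ||y||^2 + t^2 h ||y||^2.\<close>
  define t where "t = 1 / h"
  have tyD: "t *\<^sub>R y \<in> D" by (rule aR[OF yD])
  define u where "u = v - t *\<^sub>R y"
  have u: "u = blinfun_apply (E \<Delta>) u" using v y by (simp add: u_def blinfun.diff_right blinfun.scaleR_right)
  define w where "w = H y - a *\<^sub>R y"
  have Hu: "H u - a *\<^sub>R u = y - t *\<^sub>R w"
    unfolding u_def selfadjoint_diff(2)[OF sa vD tyD] aR(2)[OF yD] by (simp add: y_def w_def algebra_simps)
  have "cinner v (H y - a *\<^sub>R y) = cinner (H v) y - cinner (a *\<^sub>R v) y"
    using selfadjoint_symmetric[OF sa vD yD] by (simp add: cinner_diff_right cinner_scaleR_left cinner_scaleR_right)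
  also have "\<dots> = cinner y y" by (simp add: y_def cinner_diff_left)
  finally have "Re (cinner v w) = (norm y)\<^sup>2" by (simp add: Re_cinner_self w_def)
  moreover have "0 \<le> Re (cinner u (H u - a *\<^sub>R u))"
    by (rule spectral_local_form(1)[OF \<Delta> b u dom[OF u]])
  ultimately have "0 \<le> Re (cinner v y) - 2 * t * (norm y)\<^sup>2 + t\<^sup>2 * Re (cinner y w)"
    unfolding Hu unfolding u_def
    by (simp add: cinner_diff_left cinner_diff_right cinner_scaleR_left cinner_scaleR_right Re_cinner_self power2_eq_square algebra_simps)
  also have "\<dots> \<le> h * (norm v)\<^sup>2 - 2 * t * (norm y)\<^sup>2 + t\<^sup>2 * (h * (norm y)\<^sup>2)"
    using spectral_local_form(2)[OF \<Delta> b v vD] spectral_local_form(2)[OF \<Delta> b y yD]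
    using h by (intro add_mono diff_mono mult_left_mono) (auto simp: y_def w_def t_def)
  also have "\<dots> = h * (norm v)\<^sup>2 - (norm y)\<^sup>2 / h"
    using h by (simp add: t_def power2_eq_square field_simps)
  finally have "(norm y)\<^sup>2 \<le> (h * norm v)\<^sup>2" using h by (simp add: field_simps power2_eq_square)
  from power2_le_imp_le[OF this] show ?thesis using h by (simp add: y_def)
qed

text \<open>On the range of E(\<Delta>) the operator H equals a up to an error of norm h. One factor
  1 / |Im z| of the estimate comes from the resolvent, the other from 1 / |a - z|.\<close>

lemma spectral_resolvent_local:
  assumes \<Delta>: "\<Delta> \<in> sets borel" and b: "\<Delta> \<subseteq> {a..<a + h}" and h: "h > 0" and z: "z \<notin> \<real>"
  shows "cmod (cinner x (blinfun_apply (E \<Delta>) (blinfun_apply (resolvent D H z) x))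
    - inverse (complex_of_real a - z) * (norm (blinfun_apply (E \<Delta>) x))\<^sup>2) \<le> h / (Im z)\<^sup>2 * (norm (blinfun_apply (E \<Delta>) x))\<^sup>2"
proof -
  have iz: "\<bar>Im z\<bar> > 0" using z by (simp add: complex_is_Real_iff)
  define R where "R = blinfun_apply (resolvent D H z) x"
  have R: "R \<in> D" "H R - z *\<^sub>C R = x" by (simp_all add: R_def resolvent_mem[OF sa z] resolvent_right[OF sa z])
  define u where "u = blinfun_apply (E \<Delta>) R"
  define v where "v = blinfun_apply (E \<Delta>) x"
  define y where "y = H u - a *\<^sub>R u"
  have uD: "u \<in> D" unfolding u_def by (rule spectral_range_dom[OF \<Delta> b])
  have u: "u = blinfun_apply (E \<Delta>) u" by (simp add: u_def pvm_idem[OF sf_pvm \<Delta>])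
  have v: "H u - z *\<^sub>C u = v"
    by (simp add: u_def v_def R(2)[symmetric] blinfun.diff_right spectral_commute[OF \<Delta> R(1)]
        clinear_opD[OF pvm_clinear[OF sf_pvm \<Delta>]])
  have nu: "norm u \<le> norm v / \<bar>Im z\<bar>"
    using selfadjoint_bounded_below[OF sa uD, of z] iz by (simp add: v field_simps)
  have ny: "norm y \<le> h * norm u" unfolding y_def by (rule spectral_local_norm[OF \<Delta> b h u])
  define w where "w = complex_of_real a - z"
  have w: "w \<noteq> 0" unfolding w_def by (rule of_real_minus_nonreal[OF z])
  have "v = w *\<^sub>C u + y"
    using v by (simp add: y_def w_def scaleC_diff_left scaleC_of_real algebra_simps)
  then have "inverse w *\<^sub>C v = u + inverse w *\<^sub>C y"
    using w by (simp add: scaleC_add_right scaleC_scaleC)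
  then have "cinner v u = inverse w * (norm v)\<^sup>2 - inverse w * cinner v y"
    by (metis add_diff_cancel cinner_diff_right cinner_scaleC_right cinner_self)
  moreover have "cinner x u = cinner v u"
    unfolding v_def u_def by (simp add: pvm_adj[OF sf_pvm \<Delta>] pvm_idem[OF sf_pvm \<Delta>])
  ultimately have "cmod (cinner x u - inverse w * (norm v)\<^sup>2) = cmod (inverse w) * cmod (cinner v y)"
    by (simp add: norm_mult)
  also have "\<dots> \<le> (1 / \<bar>Im z\<bar>) * (norm v * (h * (norm v / \<bar>Im z\<bar>)))"
  proof (intro mult_mono)
    show "cmod (inverse w) \<le> 1 / \<bar>Im z\<bar>" unfolding w_def by (rule cmod_inverse_le[OF z])
    have "cmod (cinner v y) \<le> norm v * norm y" by (rule cinner_Cauchy_Schwarz)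
    also have "\<dots> \<le> norm v * (h * (norm v / \<bar>Im z\<bar>))"
      using order_trans[OF ny mult_left_mono[OF nu]] h by (intro mult_left_mono) auto
    finally show "cmod (cinner v y) \<le> norm v * (h * (norm v / \<bar>Im z\<bar>))" .
  qed auto
  also have "\<dots> = h / (Im z)\<^sup>2 * (norm v)\<^sup>2" by (subst power2_abs[of "Im z", symmetric]) (simp add: power2_eq_square mult_ac del: power2_abs abs_mult_self_eq)
  finally show ?thesis by (simp add: u_def R_def v_def w_def)
qed

text \<open>The main term is the one in \<open>spectral_resolvent_local\<close>, so the two sides of
  the resolvent formula can be compared cell by cell.\<close>

lemma stieltjes_local:
  assumes \<Delta>: "\<Delta> \<in> sets borel" and b: "\<Delta> \<subseteq> {a..<a + h}" and h: "h > 0" and z: "z \<notin> \<real>"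
  shows "cmod ((LINT l:\<Delta>|specm E x. inverse (complex_of_real l - z))
    - inverse (complex_of_real a - z) * (norm (blinfun_apply (E \<Delta>) x))\<^sup>2) \<le> h / (Im z)\<^sup>2 * (norm (blinfun_apply (E \<Delta>) x))\<^sup>2"
proof -
  interpret finite_measure "specm E x" by (rule finite_specm[OF sf_pvm])
  have \<Delta>': "\<Delta> \<in> sets (specm E x)" using \<Delta> by (simp add: sets_specm[OF sf_pvm])
  define f where "f = (\<lambda>l. inverse (complex_of_real l - z) - inverse (complex_of_real a - z))"
  have i: "integrable (specm E x) (\<lambda>l. inverse (complex_of_real l - z))"
    by (rule integrable_inverse_minus[OF finite_specm[OF sf_pvm] sets_specm[OF sf_pvm] z])
  have i1: "set_integrable (specm E x) \<Delta> (\<lambda>l. inverse (complex_of_real l - z))"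
    unfolding set_integrable_def by (intro integrable_mult_indicator \<Delta>' i)
  have i2: "set_integrable (specm E x) \<Delta> (\<lambda>l. inverse (complex_of_real a - z))"
    unfolding set_integrable_def by (intro integrable_mult_indicator \<Delta>') simp
  have le: "cmod (f l) \<le> h / (Im z)\<^sup>2" if "l \<in> \<Delta>" for l
  proof -
    have "f l = (complex_of_real a - complex_of_real l) * (inverse (complex_of_real l - z) * inverse (complex_of_real a - z))"
      using of_real_minus_nonreal[OF z, of l] of_real_minus_nonreal[OF z, of a] by (simp add: f_def field_simps)
    then have "cmod (f l) = \<bar>a - l\<bar> * (cmod (inverse (complex_of_real l - z)) * cmod (inverse (complex_of_real a - z)))"
      unfolding norm_mult by (metis norm_mult norm_of_real of_real_diff)
    also have "\<dots> \<le> h * ((1 / \<bar>Im z\<bar>) * (1 / \<bar>Im z\<bar>))"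
      using that b h by (intro mult_mono cmod_inverse_le[OF z]) auto
    also have "\<dots> = h / (Im z)\<^sup>2" by (simp add: power2_eq_square)
    finally show ?thesis .
  qed
  have m: "(LINT l:\<Delta>|specm E x. c) = c * (norm (blinfun_apply (E \<Delta>) x))\<^sup>2" for c :: complex
    unfolding set_lebesgue_integral_def using \<Delta>' by (simp add: measure_specm[OF sf_pvm \<Delta>] scaleR_conv_of_real)
  have "(LINT l:\<Delta>|specm E x. inverse (complex_of_real l - z)) - inverse (complex_of_real a - z) * (norm (blinfun_apply (E \<Delta>) x))\<^sup>2
    = (LINT l:\<Delta>|specm E x. f l)"
    unfolding m[symmetric] f_def by (rule set_integral_diff(2)[OF i1 i2, symmetric])
  also have "cmod (LINT l:\<Delta>|specm E x. f l) \<le> (\<integral>l. indicator \<Delta> l * (h / (Im z)\<^sup>2) \<partial>specm E x)"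
    unfolding set_lebesgue_integral_def
  proof (rule Bochner_Integration.integral_norm_bound_integral)
    show "integrable (specm E x) (\<lambda>l. indicator \<Delta> l *\<^sub>R f l)"
      using set_integral_diff(1)[OF i1 i2] by (simp add: f_def set_integrable_def)
    show "integrable (specm E x) (\<lambda>l. indicator \<Delta> l * (h / (Im z)\<^sup>2))"
      using \<Delta>' by (intro integrable_mult_left integrable_real_indicator) (auto simp: emeasure_eq_measure)
    show "norm (indicator \<Delta> l *\<^sub>R f l) \<le> indicator \<Delta> l * (h / (Im z)\<^sup>2)" for l
      using le[of l] by (simp add: indicator_def)
  qed
  also have "\<dots> = h / (Im z)\<^sup>2 * (norm (blinfun_apply (E \<Delta>) x))\<^sup>2"
    using \<Delta>' by (simp add: measure_specm[OF sf_pvm \<Delta>])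
  finally show ?thesis .
qed

text \<open>Both sides are countably additive in \<open>\<Delta>\<close>, and on a set of diameter \<open>h\<close> they differ by
  \<open>O(h)\<close> times its spectral measure.\<close>

theorem cinner_resolvent_eq_stieltjes:
  assumes z: "z \<notin> \<real>"
  shows "cinner x (blinfun_apply (resolvent D H z) x) = stieltjes (specm E x) z"
proof -
  interpret finite_measure "specm E x" by (rule finite_specm[OF sf_pvm])
  have iz: "(Im z)\<^sup>2 > 0" using z by (simp add: complex_is_Real_iff)
  define d where "d = cinner x (blinfun_apply (resolvent D H z) x) - stieltjes (specm E x) z"
  have "cmod d \<le> 2 * h / (Im z)\<^sup>2 * (norm x)\<^sup>2" if h: "h > 0" for h :: real
  proof -
    have "infinite (UNIV :: int set)" by simp
    from bij_betw_from_nat_into[OF countableI_type this]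
    have bij: "bij (from_nat_into (UNIV :: int set))" .
    \<comment> \<open>Countable additivity is indexed by naturals, so the integers that number the
      cells of length h are enumerated.\<close>
    define k where "k = from_nat_into (UNIV :: int set)"
    define F where "F = (\<lambda>n. {l. \<lfloor>l / h\<rfloor> = k n})"
    have Fm: "F n \<in> sets borel" for n unfolding F_def by measurable
    have Fsub: "F n \<subseteq> {real_of_int (k n) * h..<real_of_int (k n) * h + h}" for n
    proof
      fix l assume "l \<in> F n"
      then have "\<lfloor>l / h\<rfloor> = k n" by (simp add: F_def)
      then have "real_of_int (k n) \<le> l / h" "l / h < real_of_int (k n) + 1" by (simp_all add: floor_eq_iff)
      then show "l \<in> {real_of_int (k n) * h..<real_of_int (k n) * h + h}"
        using h by (auto simp: field_simps)
    qed
    have dis: "disjoint_family F"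
      using bij by (auto simp: F_def disjoint_family_on_def k_def bij_def inj_def)
    have UF: "(\<Union>n. F n) = UNIV"
    proof -
      have "\<exists>n. \<lfloor>l / h\<rfloor> = k n" for l
        using bij unfolding k_def bij_def by (metis surjD)
      then show ?thesis by (auto simp: F_def)
    qed
    define \<mu> where "\<mu> = (\<lambda>n. (norm (blinfun_apply (E (F n)) x))\<^sup>2)"
    define \<phi> where "\<phi> = (\<lambda>l. inverse (complex_of_real l - z))"
    have "(\<lambda>n. measure (specm E x) (F n)) sums measure (specm E x) (\<Union>n. F n)"
      by (rule finite_measure_UNION) (use Fm dis in \<open>auto simp: sets_specm[OF sf_pvm]\<close>)
    then have \<mu>: "\<mu> sums (norm x)\<^sup>2"
      by (simp add: \<mu>_def measure_specm[OF sf_pvm Fm] UF measure_specm_UNIV[OF sf_pvm])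
    have s1: "(\<lambda>n. cinner x (blinfun_apply (E (F n)) (blinfun_apply (resolvent D H z) x)))
      sums cinner x (blinfun_apply (resolvent D H z) x)"
      using bounded_linear.sums[OF bounded_linear_cinner_right pvm_sums[OF sf_pvm _ dis], of x "blinfun_apply (resolvent D H z) x"] Fm
      by (auto simp: UF pvm_UNIV[OF sf_pvm])
    have i: "integrable (specm E x) \<phi>"
      unfolding \<phi>_def by (rule integrable_inverse_minus[OF finite_specm[OF sf_pvm] sets_specm[OF sf_pvm] z])
    have bd: "cmod (LINT l:F n|specm E x. \<phi> l) \<le> (1 / \<bar>Im z\<bar>) * \<mu> n" for n
    proof -
      have "cmod (LINT l:F n|specm E x. \<phi> l) \<le> (\<integral>l. indicator (F n) l * (1 / \<bar>Im z\<bar>) \<partial>specm E x)"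
        unfolding set_lebesgue_integral_def
      proof (rule Bochner_Integration.integral_norm_bound_integral)
        show "integrable (specm E x) (\<lambda>l. indicator (F n) l *\<^sub>R \<phi> l)"
          using Fm by (intro integrable_mult_indicator i) (simp add: sets_specm[OF sf_pvm])
        show "integrable (specm E x) (\<lambda>l. indicator (F n) l * (1 / \<bar>Im z\<bar>))"
          using Fm by (intro integrable_mult_left integrable_real_indicator) (auto simp: emeasure_eq_measure sets_specm[OF sf_pvm])
        show "norm (indicator (F n) l *\<^sub>R \<phi> l) \<le> indicator (F n) l * (1 / \<bar>Im z\<bar>)" for l
          using cmod_inverse_le[OF z, of l] by (simp add: indicator_def \<phi>_def)
      qed
      also have "\<dots> = (1 / \<bar>Im z\<bar>) * \<mu> n"
        using Fm[of n] by (simp add: measure_specm[OF sf_pvm Fm] \<mu>_def sets_specm[OF sf_pvm])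
      finally show ?thesis .
    qed
    have "summable (\<lambda>n. LINT l:F n|specm E x. \<phi> l)"
      by (rule summable_comparison_test'[OF summable_mult[OF sums_summable[OF \<mu>]] bd])
    moreover have "(\<Sum>n. LINT l:F n|specm E x. \<phi> l) = stieltjes (specm E x) z"
    proof -
      have "(LINT l:(\<Union>n. F n)|specm E x. \<phi> l) = (\<Sum>n. LINT l:F n|specm E x. \<phi> l)"
        by (rule lebesgue_integral_countable_add)
           (use Fm dis i in \<open>auto simp: sets_specm[OF sf_pvm] disjoint_family_on_def UF set_integrable_def\<close>)
      then show ?thesis by (simp add: UF \<phi>_def stieltjes_def set_lebesgue_integral_def)
    qed
    ultimately have s2: "(\<lambda>n. LINT l:F n|specm E x. \<phi> l) sums stieltjes (specm E x) z"
      by (metis summable_sums)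
    define \<delta> where "\<delta> = (\<lambda>n. cinner x (blinfun_apply (E (F n)) (blinfun_apply (resolvent D H z) x)) - (LINT l:F n|specm E x. \<phi> l))"
    have s: "\<delta> sums d" unfolding \<delta>_def d_def by (rule sums_diff[OF s1 s2])
    have tri: "cmod (p - q) \<le> cmod (p - w) + cmod (q - w)" for p q w
      using norm_triangle_ineq4[of "p - w" "q - w"] by simp
    have le: "cmod (\<delta> n) \<le> 2 * h / (Im z)\<^sup>2 * \<mu> n" for n
    proof -
      have "cmod (\<delta> n) \<le> h / (Im z)\<^sup>2 * \<mu> n + h / (Im z)\<^sup>2 * \<mu> n"
        unfolding \<delta>_def \<mu>_def \<phi>_def
        by (rule order_trans[OF tri add_mono[OF spectral_resolvent_local[OF Fm Fsub h z] stieltjes_local[OF Fm Fsub h z]]])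
      then show ?thesis by simp
    qed
    have "cmod (suminf \<delta>) \<le> (\<Sum>n. 2 * h / (Im z)\<^sup>2 * \<mu> n)"
      by (rule norm_suminf_le[OF le summable_mult[OF sums_summable[OF \<mu>]]])
    then show ?thesis
      by (simp only: sums_unique[OF s, symmetric] sums_unique[OF \<mu>, symmetric] suminf_mult[OF sums_summable[OF \<mu>]])
  qed
  note le = this
  have "cmod d \<le> e" if e: "e > 0" for e :: real
  proof -
    \<comment> \<open>The added 1 keeps p positive for x = 0; with h as below the error becomes e
      ||x||^2 / p.\<close>
    define p where "p = (norm x)\<^sup>2 + 1"
    define h where "h = e * (Im z)\<^sup>2 / (2 * p)"
    have p: "p > 0" by (simp add: add_nonneg_pos p_def)
    have h: "h > 0" using e iz p by (simp add: h_def)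
    have "2 * h / (Im z)\<^sup>2 * (norm x)\<^sup>2 = e * ((norm x)\<^sup>2 / p)"
      using iz p by (simp add: h_def)
    also have "\<dots> \<le> e * 1" using e p by (intro mult_left_mono) (auto simp: p_def)
    finally show ?thesis using le[OF h] by simp
  qed
  then have "cmod d \<le> 0" using field_le_epsilon[of "cmod d" 0] by simp
  then show ?thesis by (simp add: d_def)
qed

end

section \<open>The operator logarithm\<close>

lemma bounded_linear_compose_left: "bounded_linear (\<lambda>T. S o\<^sub>L T)"
  by (rule bounded_bilinear.bounded_linear_right[OF bounded_bilinear_blinfun_compose])

lemmas continuous_on_compose_op = bounded_bilinear.continuous_on[OF bounded_bilinear_blinfun_compose]

text \<open>The derivative is the value of a continuous slope function. Resolvent identities deliver
  such slopes exactly, so no remainder has to be estimated.\<close>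

lemma has_vector_derivative_if_slope:
  fixes f :: "real \<Rightarrow> 'b::real_normed_vector"
  assumes eq: "\<And>y. y \<in> S \<Longrightarrow> f y - f x = (y - x) *\<^sub>R g y" and x: "x \<in> S"
    and cont: "continuous_on S g"
  shows "(f has_vector_derivative g x) (at x within S)"
  unfolding has_vector_derivative_def has_derivative_iff_norm
proof (intro conjI)
  show "bounded_linear (\<lambda>y. y *\<^sub>R g x)" by (rule bounded_linear_scaleR_left)
  have "(g \<longlongrightarrow> g x) (at x within S)" using cont x by (simp add: continuous_on_def)
  then have "((\<lambda>y. norm (g y - g x)) \<longlongrightarrow> 0) (at x within S)"
    using tendsto_norm[OF tendsto_diff[OF _ tendsto_const[of "g x"]]] by fastforce
  then show "((\<lambda>y. norm (f y - f x - (y - x) *\<^sub>R g x) / norm (y - x)) \<longlongrightarrow> 0) (at x within S)"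
  proof (rule Lim_transform_eventually)
    show "\<forall>\<^sub>F y in at x within S. norm (g y - g x) = norm (f y - f x - (y - x) *\<^sub>R g x) / norm (y - x)"
      unfolding eventually_at_filter
    proof (intro always_eventually allI impI)
      fix y assume "y \<noteq> x" "y \<in> S"
      then show "norm (g y - g x) = norm (f y - f x - (y - x) *\<^sub>R g x) / norm (y - x)"
        by (simp add: eq scaleR_diff_right[symmetric])
    qed
  qed
qed

text \<open>Hake's theorem for the half line: for the gauge integral, convergence of the truncations
  is enough.\<close>

lemma has_integral_halfline:
  fixes f :: "real \<Rightarrow> 'b::banach"
  assumes int: "\<And>N. N \<ge> 0 \<Longrightarrow> f integrable_on {0..N}"
    and lim: "((\<lambda>N. integral {0..N} f) \<longlongrightarrow> L) at_top"
  shows "(f has_integral L) {0..}"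
proof -
  have restrict: "((\<lambda>x. if x \<in> {0..} then f x else 0) has_integral integral {0..b} f) (cbox a b)" if "b \<ge> 0" "a \<le> 0" for a b
  proof -
    have "(f has_integral integral {0..b} f) {0..b}" using int[OF that(1)] by (rule integrable_integral)
    then have "((\<lambda>x. if x \<in> {0..b} then f x else 0) has_integral integral {0..b} f) {a..b}"
      by (subst has_integral_restrict) (use that in auto)
    then show ?thesis
      unfolding box_real by (rule has_integral_eq[rotated]) auto
  qed
  show ?thesis
    unfolding has_integral_alt'
  proof (intro conjI allI impI)
    fix a b :: real
    show "(\<lambda>x. if x \<in> {0..} then f x else 0) integrable_on cbox a b"
      by (rule integrable_on_subcbox[OF has_integral_integrable[OF restrict[of "max b 0" "min a 0"]]]) auto
  next
    fix e :: real assume "e > 0"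
    from tendstoD[OF lim this] obtain N where N: "\<And>n. n \<ge> N \<Longrightarrow> dist (integral {0..n} f) L < e"
      by (auto simp: eventually_at_top_linorder)
    define B where "B = max N 0 + 1"
    show "\<exists>B>0. \<forall>a b. ball 0 B \<subseteq> cbox a b \<longrightarrow>
      norm (integral (cbox a b) (\<lambda>x. if x \<in> {0..} then f x else 0) - L) < e"
    proof (intro exI[of _ B] conjI allI impI)
      show "B > 0" by (simp add: B_def)
      fix a b :: real assume sub: "ball 0 B \<subseteq> cbox a b"
      have "0 \<in> ball 0 B" "max N 0 \<in> ball 0 B" by (auto simp: B_def)
      then have "0 \<in> cbox a b" "max N 0 \<in> cbox a b" using sub by blast+
      then have "a \<le> 0" "b \<ge> N" "b \<ge> 0" by auto
      then show "norm (integral (cbox a b) (\<lambda>x. if x \<in> {0..} then f x else 0) - L) < e"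
        using integral_unique[OF restrict[of b a]] N[of b] by (simp add: dist_norm)
    qed
  qed
qed

lemma cinner_im_op:
  assumes "clinear_op T"
  shows "cinner x (blinfun_apply (im_op T) x) = complex_of_real (Im (cinner x (blinfun_apply T x)))"
proof -
  have "cinner x (blinfun_apply (adj T) x) = cnj (cinner x (blinfun_apply T x))"
    by (metis cinner_adj_right[OF assms] cinner_commute)
  then show ?thesis
    by (simp add: im_op_def blinfun.diff_left cinner_simps complex_diff_cnj complex_eq_iff)
qed

lemma op_nonneg_im_op:
  assumes "clinear_op T"
  shows "op_nonneg (im_op T) \<longleftrightarrow> (\<forall>x. 0 \<le> Im (cinner x (blinfun_apply T x)))"
  using cinner_im_op[OF assms] clinear_adj[OF assms] assms
  unfolding op_nonneg_def by (auto simp: im_op_def complex_nonneg_Reals_iff)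

section \<open>The logarithm as an integral over the coupling\<close>

context perturbation
begin

text \<open>A path from the identity at s = 0 to the operator whose logarithm is wanted at s =
  1.\<close>

definition T :: "real \<Rightarrow> complex \<Rightarrow> 'h \<Rightarrow>\<^sub>L 'h" where
  "T s z = id_blinfun + s *\<^sub>R M 0 z"

lemma clinear_T: "z \<notin> \<real> \<Longrightarrow> clinear_op (T s z)"
  unfolding T_def by (intro clinear_op_intros clinear_M)

lemma M_comp:
  assumes z: "z \<notin> \<real>"
  shows "blinfun_apply (M 0 z) x - blinfun_apply (M s z) x = s *\<^sub>R blinfun_apply (M 0 z) (blinfun_apply (M s z) x)"
    "blinfun_apply (M 0 z) x - blinfun_apply (M s z) x = s *\<^sub>R blinfun_apply (M s z) (blinfun_apply (M 0 z) x)"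
proof -
  show "blinfun_apply (M 0 z) x - blinfun_apply (M s z) x = s *\<^sub>R blinfun_apply (M 0 z) (blinfun_apply (M s z) x)"
    using arg_cong[OF M_diff_s[OF z, of 0 s], of "\<lambda>S. blinfun_apply S x"] by (simp add: blinfun.diff_left blinfun.scaleR_left)
  show "blinfun_apply (M 0 z) x - blinfun_apply (M s z) x = s *\<^sub>R blinfun_apply (M s z) (blinfun_apply (M 0 z) x)"
    using arg_cong[OF M_diff_s[OF z, of s 0], of "\<lambda>S. - blinfun_apply S x"]
    by (simp add: blinfun.diff_left blinfun.minus_left blinfun.scaleR_left)
qed

text \<open>Besides the identity, the product leaves s M_0 - s M_s - s^2 M_0 M_s, or the same with
  the last two factors exchanged. The resolvent identity between the couplings 0 and s annihilates
  it.\<close>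

lemma T_inverse:
  assumes z: "z \<notin> \<real>"
  shows "(id_blinfun - s *\<^sub>R M s z) o\<^sub>L T s z = id_blinfun" "T s z o\<^sub>L (id_blinfun - s *\<^sub>R M s z) = id_blinfun"
proof -
  show "(id_blinfun - s *\<^sub>R M s z) o\<^sub>L T s z = id_blinfun"
    by (rule blinfun_eqI)
       (simp add: T_def blinfun.diff_left blinfun.add_left blinfun.scaleR_left blinfun.add_right blinfun.scaleR_right
         M_comp(2)[OF z, symmetric] algebra_simps)
  show "T s z o\<^sub>L (id_blinfun - s *\<^sub>R M s z) = id_blinfun"
    by (rule blinfun_eqI)
       (simp add: T_def blinfun.diff_left blinfun.add_left blinfun.scaleR_left blinfun.diff_right blinfun.scaleR_right
         M_comp(1)[OF z, symmetric] algebra_simps)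
qed

context
  fixes z :: complex
  assumes z_pos: "Im z > 0"
begin

lemma z_nonreal: "z \<notin> \<real>"
  using z_pos by (simp add: complex_is_Real_iff)

abbreviation "A \<equiv> M 0 z"

text \<open>For s = 1 this is the operator part of the integrand that defines the logarithm.\<close>

definition Q :: "real \<Rightarrow> real \<Rightarrow> 'h \<Rightarrow>\<^sub>L 'h" where
  "Q s l = op_inv (T s z + scalar_op (\<i> * complex_of_real l))"

text \<open>Bounds the norm of \<open>id_blinfun - s *\<^sub>R M s z\<close>, the inverse of
  \<open>T s z\<close>, for s between 0 and 1.\<close>

definition C :: real where
  "C = 1 + (norm K)\<^sup>2 / Im z"

lemma C_pos: "C \<ge> 1"
  using z_pos by (simp add: C_def)

text \<open>For l > 0 the imaginary part of the form is at least l ||x||^2, which gives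
  invertibility and the bound 1 / l. At l = 0 the inverse is explicit. The bound 2 C, uniform down
  to l = 0, follows from 1 / l when l >= 1 / (2 C) and by absorption otherwise.\<close>

lemma Q_props:
  assumes s: "s \<in> {0..1}" and l: "l \<ge> 0"
  shows Q_left: "Q s l o\<^sub>L (T s z + scalar_op (\<i> * complex_of_real l)) = id_blinfun"
    and Q_right: "(T s z + scalar_op (\<i> * complex_of_real l)) o\<^sub>L Q s l = id_blinfun"
    and clinear_Q: "clinear_op (Q s l)"
    and norm_Q: "l > 0 \<Longrightarrow> norm (Q s l) \<le> 1 / l" "norm (Q s l) \<le> 2 * C"
proof -
  define S where "S = T s z + scalar_op (\<i> * complex_of_real l)"
  define J where "J = id_blinfun - s *\<^sub>R M s z"
  have S: "clinear_op S" unfolding S_def by (intro clinear_op_intros clinear_T[OF z_nonreal] clinear_scalar_op)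
  have J: "J o\<^sub>L T s z = id_blinfun" "T s z o\<^sub>L J = id_blinfun" using T_inverse[OF z_nonreal, of s] by (simp_all add: J_def)
  have "norm J \<le> norm (id_blinfun :: 'h \<Rightarrow>\<^sub>L 'h) + norm (s *\<^sub>R M s z)"
    unfolding J_def by (rule norm_triangle_ineq4)
  also have "norm (s *\<^sub>R M s z) \<le> 1 * norm (M s z)" using s by (simp add: mult_left_le_one_le)
  also have "norm (M s z) \<le> (norm K)\<^sup>2 / Im z" using norm_M[OF z_nonreal, of s] z_pos by simp
  also have "norm (id_blinfun :: 'h \<Rightarrow>\<^sub>L 'h) \<le> 1" by (rule norm_blinfun_bound) auto
  finally have nJ: "norm J \<le> C" by (simp add: C_def)
  have co: "op_inv S o\<^sub>L S = id_blinfun" "S o\<^sub>L op_inv S = id_blinfun" "clinear_op (op_inv S)" "norm (op_inv S) \<le> 1 / l"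
    if "l > 0"
  proof -
    have "l * (norm x)\<^sup>2 \<le> cmod (cinner x (blinfun_apply S x))" for x
    proof -
      have "Im (cinner x (blinfun_apply S x)) = s * Im (cinner x (blinfun_apply A x)) + l * (norm x)\<^sup>2"
        by (simp add: S_def T_def blinfun.add_left blinfun.scaleR_left cinner_simps cinner_self flip: of_real_power)
      moreover have "0 \<le> s * Im (cinner x (blinfun_apply A x))"
        using s z_pos by (simp add: Im_cinner_M[OF z_nonreal])
      ultimately show ?thesis using abs_Im_le_cmod[of "cinner x (blinfun_apply S x)"] by linarith
    qed
    from coercive_op_inv[OF S that this] show "op_inv S o\<^sub>L S = id_blinfun" "S o\<^sub>L op_inv S = id_blinfun"
      "clinear_op (op_inv S)" "norm (op_inv S) \<le> 1 / l" by auto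
  qed
  have zero: "op_inv S = J" if "l = 0"
  proof -
    have "S = T s z" by (rule blinfun_eqI) (simp add: S_def that blinfun.add_left)
    then show ?thesis using op_inv_eqI[OF J] by simp
  qed
  have S0: "S = T s z" if "l = 0" by (rule blinfun_eqI) (simp add: S_def that blinfun.add_left)
  show 1: "Q s l o\<^sub>L (T s z + scalar_op (\<i> * complex_of_real l)) = id_blinfun"
    and 2: "(T s z + scalar_op (\<i> * complex_of_real l)) o\<^sub>L Q s l = id_blinfun"
    and 3: "clinear_op (Q s l)"
    using co(1,2,3) zero S0 J l clinear_M[OF z_nonreal, of s]
    unfolding Q_def S_def[symmetric] by (cases "l = 0"; auto simp: J_def)+
  show 4: "norm (Q s l) \<le> 1 / l" if "l > 0"
    using co(4)[OF that] by (simp add: Q_def S_def)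
  show "norm (Q s l) \<le> 2 * C"
  proof (cases "l \<ge> 1 / (2 * C)")
    case True
    have p: "0 < 1 / (2 * C)" using C_pos by simp
    have lp: "l > 0" using p True by linarith
    have "norm (Q s l) \<le> 1 / l" by (rule 4[OF lp])
    also have "\<dots> \<le> 1 / (1 / (2 * C))" using p lp True by (intro divide_left_mono mult_pos_pos) auto
    finally show ?thesis by simp
  next
    case False
    \<comment> \<open>In y = J (x - i l y) the term with l then costs at most half of ||y|| and can
      be absorbed.\<close>
    then have lC: "l * C \<le> 1 / 2" using C_pos by (simp add: field_simps)
    show ?thesis
    proof (rule norm_blinfun_bound)
      fix x
      define y where "y = blinfun_apply (Q s l) x"
      have "blinfun_apply S y = x"
        using arg_cong[OF 2, of "\<lambda>S. blinfun_apply S x"] by (simp add: y_def S_def)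
      then have Ty: "blinfun_apply (T s z) y = x - (\<i> * complex_of_real l) *\<^sub>C y" by (simp add: S_def blinfun.add_left algebra_simps)
      have "y = blinfun_apply J (blinfun_apply (T s z) y)"
        using arg_cong[OF J(1), of "\<lambda>S. blinfun_apply S y"] by simp
      then have "norm y \<le> norm J * norm (x - (\<i> * complex_of_real l) *\<^sub>C y)"
        unfolding Ty by (metis norm_blinfun)
      also have "\<dots> \<le> C * (norm x + l * norm y)"
        using norm_triangle_ineq4[of x "(\<i> * complex_of_real l) *\<^sub>C y"] nJ C_pos l
        by (intro mult_mono) (auto simp: norm_scaleC norm_mult)
      also have "\<dots> = C * norm x + (l * C) * norm y" by (simp add: algebra_simps)
      also have "\<dots> \<le> C * norm x + 1 / 2 * norm y" using lC by (intro add_left_mono mult_right_mono) auto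
      finally show "norm (blinfun_apply (Q s l) x) \<le> 2 * C * norm x" by (simp add: y_def)
    qed (use C_pos in simp)
  qed
qed

lemma Q_identity:
  assumes "s \<in> {0..1}" "l \<ge> 0" "t \<in> {0..1}" "m \<ge> 0"
  shows "Q s l - Q t m = Q s l o\<^sub>L ((t - s) *\<^sub>R A + scalar_op (\<i> * complex_of_real (m - l))) o\<^sub>L Q t m"
proof -
  have "(t - s) *\<^sub>R A + scalar_op (\<i> * complex_of_real (m - l)) =
    (T t z + scalar_op (\<i> * complex_of_real m)) - (T s z + scalar_op (\<i> * complex_of_real l))"
    by (rule blinfun_eqI) (simp add: T_def blinfun.add_left blinfun.diff_left blinfun.scaleR_left algebra_simps scaleC_diff_left)
  then have "Q s l o\<^sub>L ((t - s) *\<^sub>R A + scalar_op (\<i> * complex_of_real (m - l))) o\<^sub>L Q t m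
    = (Q s l o\<^sub>L ((T t z + scalar_op (\<i> * complex_of_real m)) o\<^sub>L Q t m)) - ((Q s l o\<^sub>L (T s z + scalar_op (\<i> * complex_of_real l))) o\<^sub>L Q t m)"
    by (intro blinfun_eqI) (simp add: blinfun.diff_left blinfun.diff_right)
  also have "\<dots> = Q s l - Q t m"
    unfolding Q_right[OF assms(3,4)] Q_left[OF assms(1,2)] by (intro blinfun_eqI) (simp add: blinfun.diff_left)
  finally show ?thesis by simp
qed

lemma norm_scalar_op_le: "norm (scalar_op c :: 'h \<Rightarrow>\<^sub>L 'h) \<le> cmod c"
  by (rule norm_blinfun_bound) (auto simp: norm_scaleC)

lemma norm_Q_diff:
  assumes "s \<in> {0..1}" "l \<ge> 0" "t \<in> {0..1}" "m \<ge> 0"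
  shows "norm (Q s l - Q t m) \<le> (2 * C) * (\<bar>t - s\<bar> * norm A + \<bar>m - l\<bar>) * (2 * C)"
proof -
  have "norm (scalar_op (\<i> * complex_of_real (m - l)) :: 'h \<Rightarrow>\<^sub>L 'h) \<le> \<bar>m - l\<bar>"
    using norm_scalar_op_le[of "\<i> * complex_of_real (m - l)"] by (simp add: norm_mult del: of_real_diff)
  then have "norm ((t - s) *\<^sub>R A + scalar_op (\<i> * complex_of_real (m - l))) \<le> \<bar>t - s\<bar> * norm A + \<bar>m - l\<bar>"
    using norm_triangle_ineq[of "(t - s) *\<^sub>R A" "scalar_op (\<i> * complex_of_real (m - l))"]
    by (simp del: of_real_diff)
  then show ?thesis
    unfolding Q_identity[OF assms]
    by (intro order_trans[OF norm_blinfun_compose] mult_mono norm_Q assms) (use C_pos in auto)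
qed

lemma continuous_on_Q: "continuous_on ({0..1} \<times> {0..}) (\<lambda>p. Q (fst p) (snd p))"
  unfolding continuous_on_sequentially comp_def
proof (intro ballI allI impI, elim conjE)
  fix p :: "nat \<Rightarrow> real \<times> real" and a
  assume a: "a \<in> {0..1} \<times> {0..}" and p: "\<forall>n. p n \<in> {0..1} \<times> {0..}" and lim: "p \<longlonglongrightarrow> a"
  have ls: "(\<lambda>n. fst (p n)) \<longlonglongrightarrow> fst a" and lz: "(\<lambda>n. snd (p n)) \<longlonglongrightarrow> snd a"
    using lim by (auto intro: tendsto_fst tendsto_snd)
  have bd: "norm (Q (fst (p n)) (snd (p n)) - Q (fst a) (snd a)) \<le>
    (2 * C) * (\<bar>fst a - fst (p n)\<bar> * norm A + \<bar>snd a - snd (p n)\<bar>) * (2 * C)" for n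
    using norm_Q_diff[of "fst (p n)" "snd (p n)" "fst a" "snd a"] a p by (simp add: mem_Times_iff)
  have "(\<lambda>n. (2 * C) * (\<bar>fst a - fst (p n)\<bar> * norm A + \<bar>snd a - snd (p n)\<bar>) * (2 * C)) \<longlonglongrightarrow>
    (2 * C) * (\<bar>fst a - fst a\<bar> * norm A + \<bar>snd a - snd a\<bar>) * (2 * C)"
    by (intro tendsto_intros ls lz)
  then have "(\<lambda>n. (2 * C) * (\<bar>fst a - fst (p n)\<bar> * norm A + \<bar>snd a - snd (p n)\<bar>) * (2 * C)) \<longlonglongrightarrow> 0" by simp
  from Lim_null_comparison[OF always_eventually[OF allI[OF bd]] this]
  show "(\<lambda>n. Q (fst (p n)) (snd (p n))) \<longlonglongrightarrow> Q (fst a) (snd a)" by (rule LIM_zero_cancel)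
qed

lemma continuous_on_Q_compose:
  assumes "continuous_on S f" "continuous_on S g" "\<And>x. x \<in> S \<Longrightarrow> f x \<in> {0..1} \<and> g x \<ge> 0"
  shows "continuous_on S (\<lambda>x. Q (f x) (g x))"
proof -
  have "(\<lambda>x. (f x, g x)) ` S \<subseteq> {0..1} \<times> {0..}" using assms(3) by auto
  from continuous_on_compose2[OF continuous_on_Q continuous_on_Pair[OF assms(1,2)] this] show ?thesis by simp
qed

lemma A_Q_commute:
  assumes "s \<in> {0..1}" "l \<ge> 0"
  shows "A o\<^sub>L Q s l = Q s l o\<^sub>L A"
proof -
  define S where "S = T s z + scalar_op (\<i> * complex_of_real l)"
  have S: "Q s l o\<^sub>L S = id_blinfun" "S o\<^sub>L Q s l = id_blinfun"
    using Q_left[OF assms] Q_right[OF assms] by (simp_all add: S_def)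
  have c: "S o\<^sub>L A = A o\<^sub>L S"
    by (rule blinfun_eqI) (simp add: S_def T_def blinfun.add_left blinfun.scaleR_left blinfun.add_right blinfun.scaleR_right
        clinear_opD[OF clinear_M[OF z_nonreal]])
  have "A o\<^sub>L Q s l = (Q s l o\<^sub>L S) o\<^sub>L (A o\<^sub>L Q s l)" unfolding S by (rule blinfun_eqI) simp
  also have "\<dots> = Q s l o\<^sub>L (S o\<^sub>L A) o\<^sub>L Q s l" by (rule blinfun_eqI) simp
  also have "\<dots> = (Q s l o\<^sub>L A) o\<^sub>L (S o\<^sub>L Q s l)" unfolding c by (rule blinfun_eqI) simp
  also have "\<dots> = Q s l o\<^sub>L A" unfolding S by (rule blinfun_eqI) simp
  finally show ?thesis .
qed

lemma Q_0:
  assumes "l \<ge> 0"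
  shows "Q 0 l = scalar_op (inverse (1 + \<i> * complex_of_real l))"
proof -
  have nz: "1 + \<i> * complex_of_real l \<noteq> 0" by (simp add: complex_eq_iff)
  have T0: "T 0 z + scalar_op (\<i> * complex_of_real l) = scalar_op (1 + \<i> * complex_of_real l)"
    by (rule blinfun_eqI) (simp add: T_def blinfun.add_left scaleC_add_left)
  show ?thesis unfolding Q_def T0
    by (rule op_inv_eqI) (rule blinfun_eqI, simp add: scaleC_scaleC nz)+
qed

lemma Q_s_0: "s \<in> {0..1} \<Longrightarrow> Q s 0 = id_blinfun - s *\<^sub>R M s z"
proof -
  have "T s z + scalar_op (\<i> * complex_of_real 0) = T s z"
    by (rule blinfun_eqI) (simp add: blinfun.add_left)
  then show ?thesis unfolding Q_def by (simp add: op_inv_eqI[OF T_inverse[OF z_nonreal]])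
qed

text \<open>The s-derivative of Q is - Q A Q. As \<open>Q 0 l\<close> is the scalar (1 + i l)^{-1},
  the increment over the unit interval is exactly the integrand of the logarithm.\<close>

lemma Q_integral_s:
  assumes l: "l \<ge> 0"
  shows "((\<lambda>s. - (Q s l o\<^sub>L A o\<^sub>L Q s l)) has_integral Q 1 l - Q 0 l) {0..1}"
proof (rule fundamental_theorem_of_calculus)
  fix s :: real assume s: "s \<in> {0..1}"
  show "((\<lambda>s. Q s l) has_vector_derivative - (Q s l o\<^sub>L A o\<^sub>L Q s l)) (at s within {0..1})"
  proof (rule has_vector_derivative_if_slope[OF _ s, where g = "\<lambda>y. - (Q y l o\<^sub>L A o\<^sub>L Q s l)"])
    show "Q y l - Q s l = (y - s) *\<^sub>R - (Q y l o\<^sub>L A o\<^sub>L Q s l)" if "y \<in> {0..1}" for y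
    proof -
      have neg: "(s - y) *\<^sub>R v = - ((y - s) *\<^sub>R v)" for v :: 'h by (simp add: scaleR_diff_left)
      show ?thesis
        unfolding Q_identity[OF that l s l]
        by (rule blinfun_eqI) (simp add: blinfun.add_left blinfun.scaleR_left blinfun.scaleR_right
            blinfun.minus_left blinfun.minus_right neg)
    qed
    show "continuous_on {0..1} (\<lambda>y. - (Q y l o\<^sub>L A o\<^sub>L Q s l))"
      using l by (intro continuous_on_minus continuous_on_compose_op continuous_on_const continuous_on_Q_compose continuous_on_id) auto
  qed
qed simp

text \<open>The l-derivative of Q is - i Q^2; since A commutes with Q, the integrand is the
  derivative of i A Q.\<close>

lemma Q_integral_l:
  assumes s: "s \<in> {0..1}" and N: "N \<ge> 0"
  shows "((\<lambda>l. Q s l o\<^sub>L A o\<^sub>L Q s l) has_integral scalar_op \<i> o\<^sub>L A o\<^sub>L (Q s N - Q s 0)) {0..N}"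
proof -
  have "((\<lambda>l. - (Q s l o\<^sub>L scalar_op \<i> o\<^sub>L Q s l)) has_integral Q s N - Q s 0) {0..N}"
  proof (rule fundamental_theorem_of_calculus[OF N])
    fix l :: real assume l: "l \<in> {0..N}"
    show "((\<lambda>l. Q s l) has_vector_derivative - (Q s l o\<^sub>L scalar_op \<i> o\<^sub>L Q s l)) (at l within {0..N})"
    proof (rule has_vector_derivative_if_slope[OF _ l, where g = "\<lambda>y. - (Q s y o\<^sub>L scalar_op \<i> o\<^sub>L Q s l)"])
      show "Q s y - Q s l = (y - l) *\<^sub>R - (Q s y o\<^sub>L scalar_op \<i> o\<^sub>L Q s l)" if "y \<in> {0..N}" for y
      proof -
        have yl: "y \<ge> 0" "l \<ge> 0" using that l by auto
        have sc: "(\<i> * complex_of_real (l - y)) *\<^sub>C v = - ((y - l) *\<^sub>R (\<i> *\<^sub>C v))" for v :: 'h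
          by (rule cinner_ext) (simp add: cinner_simps algebra_simps)
        show ?thesis
          unfolding Q_identity[OF s yl(1) s yl(2)]
          by (rule blinfun_eqI) (simp add: blinfun.add_left blinfun.scaleR_left blinfun.scaleR_right
              blinfun.minus_left blinfun.minus_right sc del: of_real_diff)
      qed
      show "continuous_on {0..N} (\<lambda>y. - (Q s y o\<^sub>L scalar_op \<i> o\<^sub>L Q s l))"
        using s by (intro continuous_on_minus continuous_on_compose_op continuous_on_const continuous_on_Q_compose continuous_on_id) auto
    qed
  qed
  from has_integral_linear[OF this bounded_linear_compose_left[of "scalar_op \<i> o\<^sub>L A"]]
  show ?thesis unfolding comp_def
  proof (rule has_integral_eq[rotated])
    fix l :: real assume "l \<in> {0..N}"
    then have l: "l \<ge> 0" by simp
    have "blinfun_apply A (blinfun_apply (Q s l) x) = blinfun_apply (Q s l) (blinfun_apply A x)" for x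
      using arg_cong[OF A_Q_commute[OF s l], of "\<lambda>S. blinfun_apply S x"] by simp
    then show "(scalar_op \<i> o\<^sub>L A) o\<^sub>L - (Q s l o\<^sub>L scalar_op \<i> o\<^sub>L Q s l) = Q s l o\<^sub>L A o\<^sub>L Q s l"
      by (intro blinfun_eqI)
         (simp add: blinfun.minus_left blinfun.minus_right clinear_opD[OF clinear_Q[OF s l]] clinear_opD[OF clinear_M[OF z_nonreal]]
           scaleC_scaleC scaleC_minus_left)
  qed
qed

text \<open>Exchanging the integrations and using the primitive in l leaves boundary terms at l = 0,
  where A Q = A (1 - s M_s) = M_s, and at N, kept as a remainder.\<close>

lemma log_truncated:
  assumes N: "N \<ge> 0"
  shows "(\<lambda>l. Q 1 l - scalar_op (inverse (1 + \<i> * complex_of_real l))) integrable_on {0..N}"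
    "integral {0..N} (\<lambda>l. Q 1 l - scalar_op (inverse (1 + \<i> * complex_of_real l))) =
      (scalar_op \<i> o\<^sub>L integral {0..1} (\<lambda>s. M s z)) - (scalar_op \<i> o\<^sub>L integral {0..1} (\<lambda>s. A o\<^sub>L Q s N))"
proof -
  have "continuous_on {0..N} (\<lambda>l. Q 1 l - Q 0 l)"
    by (intro continuous_on_diff continuous_on_Q_compose continuous_on_const continuous_on_id) auto
  then have c: "continuous_on {0..N} (\<lambda>l. Q 1 l - scalar_op (inverse (1 + \<i> * complex_of_real l)))"
    by (rule continuous_on_eq) (simp add: Q_0)
  then show "(\<lambda>l. Q 1 l - scalar_op (inverse (1 + \<i> * complex_of_real l))) integrable_on {0..N}"
    by (rule integrable_continuous_real)
  have "integral {0..N} (\<lambda>l. Q 1 l - scalar_op (inverse (1 + \<i> * complex_of_real l)))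
    = integral {0..N} (\<lambda>l. integral {0..1} (\<lambda>s. - (Q s l o\<^sub>L A o\<^sub>L Q s l)))"
  proof (rule Henstock_Kurzweil_Integration.integral_cong)
    fix l :: real assume "l \<in> {0..N}"
    then have l: "l \<ge> 0" by simp
    show "Q 1 l - scalar_op (inverse (1 + \<i> * complex_of_real l)) = integral {0..1} (\<lambda>s. - (Q s l o\<^sub>L A o\<^sub>L Q s l))"
      unfolding integral_unique[OF Q_integral_s[OF l]] Q_0[OF l] by (rule refl)
  qed
  also have "\<dots> = integral {0..1} (\<lambda>s. integral {0..N} (\<lambda>l. - (Q s l o\<^sub>L A o\<^sub>L Q s l)))"
  proof -
    have "continuous_on ({0..N} \<times> {0..1}) (\<lambda>(l, s). - (Q s l o\<^sub>L A o\<^sub>L Q s l))"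
      unfolding case_prod_beta
      by (intro continuous_on_minus continuous_on_compose_op continuous_on_const continuous_on_Q_compose
          continuous_on_fst continuous_on_snd continuous_on_id) auto
    from integral_swap_continuous[of 0 0 N 1 "\<lambda>l s. - (Q s l o\<^sub>L A o\<^sub>L Q s l)", folded cbox_Pair_eq]
    show ?thesis using \<open>continuous_on ({0..N} \<times> {0..1}) _\<close> by (simp add: cbox_Pair_eq)
  qed
  also have "\<dots> = integral {0..1} (\<lambda>s. (scalar_op \<i> o\<^sub>L M s z) - (scalar_op \<i> o\<^sub>L (A o\<^sub>L Q s N)))"
  proof (rule Henstock_Kurzweil_Integration.integral_cong)
    fix s :: real assume s: "s \<in> {0..1}"
    have "blinfun_apply A (blinfun_apply (Q s 0) x) = blinfun_apply (M s z) x" for x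
      by (simp add: Q_s_0[OF s] blinfun.diff_left blinfun.diff_right blinfun.scaleR_left blinfun.scaleR_right
          M_comp(1)[OF z_nonreal, symmetric])
    then show "integral {0..N} (\<lambda>l. - (Q s l o\<^sub>L A o\<^sub>L Q s l)) = (scalar_op \<i> o\<^sub>L M s z) - (scalar_op \<i> o\<^sub>L (A o\<^sub>L Q s N))"
      unfolding integral_unique[OF has_integral_neg[OF Q_integral_l[OF s N]]]
      by (intro blinfun_eqI) (simp add: blinfun.minus_left blinfun.diff_left blinfun.diff_right scaleC_diff_right)
  qed
  also have "\<dots> = integral {0..1} (\<lambda>s. scalar_op \<i> o\<^sub>L M s z) - integral {0..1} (\<lambda>s. scalar_op \<i> o\<^sub>L (A o\<^sub>L Q s N))"
    using N by (intro Henstock_Kurzweil_Integration.integral_diff integrable_continuous_real continuous_on_compose_op continuous_on_const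
        continuous_on_M_s[OF z_nonreal] continuous_on_Q_compose continuous_on_id) auto
  also have "integral {0..1} (\<lambda>s. scalar_op \<i> o\<^sub>L M s z) = scalar_op \<i> o\<^sub>L integral {0..1} (\<lambda>s. M s z)"
    using integral_linear[OF integrable_continuous_real[OF continuous_on_M_s[OF z_nonreal]] bounded_linear_compose_left, of 0 1 "scalar_op \<i>"]
    by (simp add: comp_def)
  also have "integral {0..1} (\<lambda>s. scalar_op \<i> o\<^sub>L (A o\<^sub>L Q s N)) = scalar_op \<i> o\<^sub>L integral {0..1} (\<lambda>s. A o\<^sub>L Q s N)"
  proof -
    have "(\<lambda>s. A o\<^sub>L Q s N) integrable_on {0..1}"
      using N by (intro integrable_continuous_real continuous_on_compose_op continuous_on_const continuous_on_Q_compose continuous_on_id) auto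
    from integral_linear[OF this bounded_linear_compose_left[of "scalar_op \<i>"]] show ?thesis by (simp add: comp_def)
  qed
  finally show "integral {0..N} (\<lambda>l. Q 1 l - scalar_op (inverse (1 + \<i> * complex_of_real l))) =
      (scalar_op \<i> o\<^sub>L integral {0..1} (\<lambda>s. M s z)) - (scalar_op \<i> o\<^sub>L integral {0..1} (\<lambda>s. A o\<^sub>L Q s N))" .
qed

text \<open>\<open>Q s N\<close> has norm at most 1 / N, uniformly in s.\<close>

lemma remainder_tendsto: "((\<lambda>N. scalar_op \<i> o\<^sub>L integral {0..1} (\<lambda>s. A o\<^sub>L Q s N)) \<longlongrightarrow> 0) at_top"
proof (rule Lim_null_comparison)
  show "((\<lambda>N. norm A * (1 / N)) \<longlongrightarrow> 0) at_top"
    using tendsto_mult[OF tendsto_const[of "norm A"] tendsto_inverse_0_at_top[OF filterlim_ident]] by (simp add: inverse_eq_divide)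
  show "\<forall>\<^sub>F N in at_top. norm (scalar_op \<i> o\<^sub>L integral {0..1} (\<lambda>s. A o\<^sub>L Q s N)) \<le> norm A * (1 / N)"
    using eventually_gt_at_top[of 0]
  proof eventually_elim
    case (elim N)
    have c: "continuous_on {0..1} (\<lambda>s. A o\<^sub>L Q s N)"
      using elim by (intro continuous_on_compose_op continuous_on_const continuous_on_Q_compose continuous_on_id) auto
    have "norm (integral {0..1} (\<lambda>s. A o\<^sub>L Q s N)) \<le> (norm A * (1 / N)) * (1 - 0)"
    proof (rule integral_bound[OF _ c])
      show "norm (A o\<^sub>L Q s N) \<le> norm A * (1 / N)" if "s \<in> {0..1}" for s
        using elim norm_Q(1)[OF that, of N] by (intro order_trans[OF norm_blinfun_compose] mult_left_mono) auto
    qed simp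
    then show ?case
      using norm_blinfun_compose[of "scalar_op \<i>" "integral {0..1} (\<lambda>s. A o\<^sub>L Q s N)"]
        mult_right_mono[OF norm_scalar_op_le[of \<i>], of "norm (integral {0..1} (\<lambda>s. A o\<^sub>L Q s N))"] by simp
  qed
qed

theorem log_upper_eq_integral: "log_upper (id_blinfun + M 0 z) = integral {0..1} (\<lambda>s. M s z)"
proof -
  have "((\<lambda>l. Q 1 l - scalar_op (inverse (1 + \<i> * complex_of_real l))) has_integral scalar_op \<i> o\<^sub>L integral {0..1} (\<lambda>s. M s z)) {0..}"
  proof (rule has_integral_halfline[OF log_truncated(1)])
    have "((\<lambda>N. (scalar_op \<i> o\<^sub>L integral {0..1} (\<lambda>s. M s z)) - (scalar_op \<i> o\<^sub>L integral {0..1} (\<lambda>s. A o\<^sub>L Q s N)))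
      \<longlongrightarrow> (scalar_op \<i> o\<^sub>L integral {0..1} (\<lambda>s. M s z)) - 0) at_top"
      by (intro tendsto_diff tendsto_const remainder_tendsto)
    then have "((\<lambda>N. (scalar_op \<i> o\<^sub>L integral {0..1} (\<lambda>s. M s z)) - (scalar_op \<i> o\<^sub>L integral {0..1} (\<lambda>s. A o\<^sub>L Q s N)))
      \<longlongrightarrow> (scalar_op \<i> o\<^sub>L integral {0..1} (\<lambda>s. M s z))) at_top" by simp
    then show "((\<lambda>N. integral {0..N} (\<lambda>l. Q 1 l - scalar_op (inverse (1 + \<i> * complex_of_real l))))
      \<longlongrightarrow> scalar_op \<i> o\<^sub>L integral {0..1} (\<lambda>s. M s z)) at_top"
    proof (rule Lim_transform_eventually)
      show "\<forall>\<^sub>F N in at_top. (scalar_op \<i> o\<^sub>L integral {0..1} (\<lambda>s. M s z)) - (scalar_op \<i> o\<^sub>L integral {0..1} (\<lambda>s. A o\<^sub>L Q s N))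
        = integral {0..N} (\<lambda>l. Q 1 l - scalar_op (inverse (1 + \<i> * complex_of_real l)))"
        using eventually_ge_at_top[of 0] by eventually_elim (simp add: log_truncated(2))
    qed
  qed
  from integral_unique[OF this] show ?thesis
    unfolding log_upper_def Q_def T_def
    by (intro blinfun_eqI) (simp add: scaleC_scaleC)
qed

end

text \<open>Below the real axis the logarithm is defined through the adjoint, and the adjoint of
  \<open>M s z\<close> is \<open>M s (cnj z)\<close>; the formula is then the conjugate of the one
  in the upper half plane.\<close>

theorem cinner_op_log:
  assumes z: "z \<notin> \<real>"
  shows "cinner f (blinfun_apply (op_log (id_blinfun + M 0 z)) g) = integral {0..1} (\<lambda>s. cinner f (blinfun_apply (M s z) g))"
proof -
  have lin: "cinner f (blinfun_apply (integral {0..1} (\<lambda>s. M s w)) g) = integral {0..1} (\<lambda>s. cinner f (blinfun_apply (M s w) g))"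
    if w: "w \<notin> \<real>" for w f g
  proof -
    have "bounded_linear (\<lambda>S. cinner f (blinfun_apply S g))"
      by (rule bounded_linear_compose[OF bounded_linear_cinner_right blinfun.bounded_linear_left])
    from integral_linear[OF integrable_continuous_real[OF continuous_on_M_s[OF w]] this, of 0 1]
    show ?thesis by (simp add: comp_def)
  qed
  have cl: "clinear_op (id_blinfun + M 0 z)" by (intro clinear_op_intros clinear_M z)
  have im: "Im (cinner x (blinfun_apply (id_blinfun + M 0 z) x)) = Im z * (norm (blinfun_apply (R 0 z) (blinfun_apply K x)))\<^sup>2" for x
    by (simp add: blinfun.add_left cinner_add_right cinner_self Im_cinner_M[OF z] flip: of_real_power)
  have z': "cnj z \<notin> \<real>" using z by (simp add: complex_is_Real_iff)
  consider "Im z > 0" | "Im z < 0" using z by (fastforce simp: complex_is_Real_iff)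
  then show ?thesis
  proof cases
    case 1
    then have "op_nonneg (im_op (id_blinfun + M 0 z))" unfolding op_nonneg_im_op[OF cl] im by simp
    then show ?thesis using lin[OF z] log_upper_eq_integral[OF 1] by (simp add: op_log_def)
  next
    case 2
    have adjz: "adj (id_blinfun + M 0 z) = id_blinfun + M 0 (cnj z)"
      by (rule adj_eqI[OF cl]) (simp add: blinfun.add_left cinner_simps cinner_M_left[OF z])
    have up: "log_upper (id_blinfun + M 0 (cnj z)) = integral {0..1} (\<lambda>s. M s (cnj z))"
      by (rule log_upper_eq_integral) (use 2 in simp)
    show ?thesis
    proof (cases "op_nonneg (im_op (id_blinfun + M 0 z))")
      case False
      have cl': "clinear_op (integral {0..1} (\<lambda>s. M s (cnj z)))"
      proof -
        have "blinfun_apply (integral {0..1} (\<lambda>s. M s (cnj z))) (c *\<^sub>C x) = c *\<^sub>C blinfun_apply (integral {0..1} (\<lambda>s. M s (cnj z))) x" for c x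
          by (rule cinner_ext)
             (simp add: lin[OF z'] cinner_scaleC_right clinear_opD[OF clinear_M[OF z']] integral_mult_right)
        then show ?thesis by (simp add: clinear_op_def)
      qed
      have "cinner f (blinfun_apply (op_log (id_blinfun + M 0 z)) g) = cinner (blinfun_apply (integral {0..1} (\<lambda>s. M s (cnj z))) f) g"
        using False by (simp add: op_log_def adjz up cinner_adj_right[OF cl'])
      also have "\<dots> = cnj (integral {0..1} (\<lambda>s. cinner g (blinfun_apply (M s (cnj z)) f)))"
        by (metis lin[OF z'] cinner_commute)
      also have "\<dots> = integral {0..1} (\<lambda>s. cnj (cinner g (blinfun_apply (M s (cnj z)) f)))"
        by (rule integral_cnj)
      also have "\<dots> = integral {0..1} (\<lambda>s. cinner f (blinfun_apply (M s z) g))"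
        by (metis (no_types) cinner_M_left[OF z'] complex_cnj_cnj cinner_commute)
      finally show ?thesis .
    next
      \<comment> \<open>Here \<open>op_log\<close> takes its upper branch although Im z < 0. The
        form Im z ||R K x||^2 is then both nonnegative and nonpositive, which forces K = 0.\<close>
      case True
      have "blinfun_apply K x = 0" for x
      proof -
        have "0 \<le> Im z * (norm (blinfun_apply (R 0 z) (blinfun_apply K x)))\<^sup>2"
          using True unfolding op_nonneg_im_op[OF cl] im by simp
        then have "blinfun_apply (R 0 z) (blinfun_apply K x) = 0" using 2 by (simp add: zero_le_mult_iff)
        moreover have "H 0 = 0"
          using selfadjoint_scaleC(2)[OF sa, where x = 0 and c = 0] selfadjoint_csubspace[OF sa] by (simp add: csubspace_def)
        ultimately show ?thesis
          using resolvent_right[OF selfadjoint_Hs z, where s1 = 0 and x = "blinfun_apply K x"]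
          by (simp add: R_def Hs_def blinfun.zero_right)
      qed
      then have M0: "M s w = 0" for s w by (intro blinfun_eqI) (simp add: M_apply blinfun.zero_right)
      have "op_log (id_blinfun + M 0 z) = log_upper (id_blinfun + M 0 (cnj z))"
        using True by (simp add: op_log_def M0)
      then show ?thesis using up by (simp add: M0)
    qed
  qed
qed

end

section \<open>The imaginary part of the logarithm\<close>

context
  fixes A :: "'a::complex_hilbert \<Rightarrow>\<^sub>L 'a"
  assumes A: "clinear_op A" and diss: "\<And>x. 0 \<le> Im (cinner x (blinfun_apply A x))"
begin

text \<open>The resolvent of - A at w. With this sign Im w > 0 guarantees invertibility, and the
  form of G has nonpositive imaginary part there.\<close>

definition G :: "complex \<Rightarrow> 'a \<Rightarrow>\<^sub>L 'a" where
  "G w = op_inv (A + scalar_op w)"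

lemma G_props:
  assumes w: "Im w > 0"
  shows G_left: "blinfun_apply (G w) (blinfun_apply A x + w *\<^sub>C x) = x"
    and G_right: "blinfun_apply A (blinfun_apply (G w) x) + w *\<^sub>C blinfun_apply (G w) x = x"
    and clinear_G: "clinear_op (G w)"
    and norm_G: "norm (G w) \<le> 1 / Im w"
proof -
  define S where "S = A + scalar_op w"
  have S: "clinear_op S" unfolding S_def by (intro clinear_op_intros A clinear_scalar_op)
  have "Im w * (norm x)\<^sup>2 \<le> cmod (cinner x (blinfun_apply S x))" for x
  proof -
    have "Im (cinner x (blinfun_apply S x)) = Im (cinner x (blinfun_apply A x)) + Im w * (norm x)\<^sup>2"
      by (simp add: S_def blinfun.add_left cinner_simps cinner_self flip: of_real_power)
    then show ?thesis using abs_Im_le_cmod[of "cinner x (blinfun_apply S x)"] diss[of x] by linarith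
  qed
  note * = coercive_op_inv[OF S w this]
  show "blinfun_apply (G w) (blinfun_apply A x + w *\<^sub>C x) = x"
    using arg_cong[OF *(1), of "\<lambda>S. blinfun_apply S x"] by (simp add: G_def S_def blinfun.add_left)
  show "blinfun_apply A (blinfun_apply (G w) x) + w *\<^sub>C blinfun_apply (G w) x = x"
    using arg_cong[OF *(2), of "\<lambda>S. blinfun_apply S x"] by (simp add: G_def S_def blinfun.add_left)
  show "clinear_op (G w)" "norm (G w) \<le> 1 / Im w" using *(3,4) by (simp_all add: G_def S_def)
qed

lemma G_identity:
  assumes w: "Im w > 0" and v: "Im v > 0"
  shows "blinfun_apply (G w) x - blinfun_apply (G v) x = (v - w) *\<^sub>C blinfun_apply (G w) (blinfun_apply (G v) x)"
proof -
  define y where "y = blinfun_apply (G v) x"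
  have "x - (blinfun_apply A y + w *\<^sub>C y) = (v - w) *\<^sub>C y"
    using G_right[OF v, of x] by (simp add: y_def scaleC_diff_left algebra_simps)
  then have "blinfun_apply (G w) (x - (blinfun_apply A y + w *\<^sub>C y)) = (v - w) *\<^sub>C blinfun_apply (G w) y"
    by (simp add: clinear_opD[OF clinear_G[OF w]])
  then show ?thesis using G_left[OF w, of y] by (simp add: blinfun.diff_right y_def)
qed

lemma continuous_on_G: "continuous_on {w. Im w > 0} (\<lambda>w. blinfun_apply (G w) x)"
  unfolding continuous_on_def
proof
  fix v :: complex assume "v \<in> {w. Im w > 0}"
  then have v: "Im v > 0" by simp
  have "((\<lambda>w. cmod (v - w) * (1 / Im w) * norm (blinfun_apply (G v) x)) \<longlongrightarrow> cmod (v - v) * (1 / Im v) * norm (blinfun_apply (G v) x)) (at v within {w. Im w > 0})"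
    using v by (intro tendsto_intros) auto
  then have lim: "((\<lambda>w. cmod (v - w) * (1 / Im w) * norm (blinfun_apply (G v) x)) \<longlongrightarrow> 0) (at v within {w. Im w > 0})"
    by simp
  have "((\<lambda>w. blinfun_apply (G w) x - blinfun_apply (G v) x) \<longlongrightarrow> 0) (at v within {w. Im w > 0})"
  proof (rule Lim_null_comparison[OF _ lim])
    show "\<forall>\<^sub>F w in at v within {w. Im w > 0}. norm (blinfun_apply (G w) x - blinfun_apply (G v) x)
      \<le> cmod (v - w) * (1 / Im w) * norm (blinfun_apply (G v) x)"
      unfolding eventually_at_filter
    proof (intro always_eventually allI impI)
      fix w assume "w \<in> {w. Im w > 0}"
      then have w: "Im w > 0" by simp
      have "norm (blinfun_apply (G w) (blinfun_apply (G v) x)) \<le> (1 / Im w) * norm (blinfun_apply (G v) x)"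
        by (rule order_trans[OF norm_blinfun mult_right_mono[OF norm_G[OF w] norm_ge_zero]])
      from mult_left_mono[OF this norm_ge_zero[of "v - w"]]
      show "norm (blinfun_apply (G w) x - blinfun_apply (G v) x) \<le> cmod (v - w) * (1 / Im w) * norm (blinfun_apply (G v) x)"
        unfolding G_identity[OF w v] norm_scaleC by (simp only: mult.assoc)
    qed
  qed
  then show "((\<lambda>w. blinfun_apply (G w) x) \<longlongrightarrow> blinfun_apply (G v) x) (at v within {w. Im w > 0})"
    by (rule LIM_zero_cancel)
qed

text \<open>By the resolvent identity the difference quotient at v is - <f, G(w) G(v) f>, which is
  continuous in w.\<close>

lemma holomorphic_G: "(\<lambda>w. cinner f (blinfun_apply (G w) f)) holomorphic_on {w. Im w > 0}"
  unfolding holomorphic_on_def field_differentiable_def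
proof (intro ballI exI)
  fix v :: complex assume v: "v \<in> {w. Im w > 0}"
  have "continuous_on {w. Im w > 0} (\<lambda>w. - cinner f (blinfun_apply (G w) (blinfun_apply (G v) f)))"
    by (intro continuous_intros continuous_on_G)
  then have "((\<lambda>w. - cinner f (blinfun_apply (G w) (blinfun_apply (G v) f))) \<longlongrightarrow> - cinner f (blinfun_apply (G v) (blinfun_apply (G v) f))) (at v within {w. Im w > 0})"
    using v by (simp add: continuous_on_def)
  then show "((\<lambda>w. cinner f (blinfun_apply (G w) f)) has_field_derivative - cinner f (blinfun_apply (G v) (blinfun_apply (G v) f))) (at v within {w. Im w > 0})"
    unfolding has_field_derivative_iff
  proof (rule Lim_transform_eventually)
    show "\<forall>\<^sub>F w in at v within {w. Im w > 0}. - cinner f (blinfun_apply (G w) (blinfun_apply (G v) f))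
      = (cinner f (blinfun_apply (G w) f) - cinner f (blinfun_apply (G v) f)) / (w - v)"
      unfolding eventually_at_filter
    proof (intro always_eventually allI impI)
      fix w assume "w \<noteq> v" "w \<in> {w. Im w > 0}"
      then show "- cinner f (blinfun_apply (G w) (blinfun_apply (G v) f))
        = (cinner f (blinfun_apply (G w) f) - cinner f (blinfun_apply (G v) f)) / (w - v)"
        using G_identity[of w v f] v by (simp add: cinner_diff_right[symmetric] cinner_scaleC_right field_simps)
    qed
  qed
qed

text \<open>Writing f = A y + w y turns the form of G at f into the conjugate of the form of A + w
  at y.\<close>

lemma Im_G_le:
  assumes w: "Im w > 0"
  shows "Im (cinner f (blinfun_apply (G w) f)) \<le> 0"
proof -
  define y where "y = blinfun_apply (G w) f"
  have f: "f = blinfun_apply A y + w *\<^sub>C y" using G_right[OF w, of f] by (simp add: y_def)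
  have "cinner f y = cnj (cinner y f)" by (rule cinner_commute)
  also have "cinner y f = cinner y (blinfun_apply A y) + w * (norm y)\<^sup>2"
    by (subst f) (simp add: cinner_simps cinner_self)
  finally have "Im (cinner f y) = - (Im (cinner y (blinfun_apply A y)) + Im w * (norm y)\<^sup>2)"
    by (simp flip: of_real_power)
  moreover have "0 \<le> Im w * (norm y)\<^sup>2" using w by simp
  ultimately have "Im (cinner f y) \<le> 0" using diss[of y] by linarith
  then show ?thesis by (simp add: y_def)
qed

text \<open>The difference is - <f, A y> / w with y = G(w) f, and |w| >= 2 ||A|| gives ||y|| <= 2
  ||f|| / |w|.\<close>

lemma G_asymptotics:
  fixes w :: complex
  assumes w: "Im w > 0" and big: "2 * norm A \<le> cmod w"
  shows "cmod (cinner f (blinfun_apply (G w) f) - (norm f)\<^sup>2 * inverse w) \<le> 2 * norm A * (norm f)\<^sup>2 / (cmod w)\<^sup>2"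
proof -
  define y where "y = blinfun_apply (G w) f"
  have w0: "cmod w > 0" using w by (auto simp: complex_eq_iff)
  have eq: "blinfun_apply A y + w *\<^sub>C y = f" using G_right[OF w, of f] by (simp add: y_def)
  have "w *\<^sub>C y = f - blinfun_apply A y" using eq by (simp add: algebra_simps)
  then have "cmod w * norm y = norm (f - blinfun_apply A y)" by (metis norm_scaleC)
  also have "\<dots> \<le> norm f + norm A * norm y"
    using norm_triangle_ineq4[of f "blinfun_apply A y"] norm_blinfun[of A y] by linarith
  also have "norm A * norm y \<le> cmod w / 2 * norm y" using big by (intro mult_right_mono) auto
  finally have ny: "norm y \<le> 2 * norm f / cmod w" using w0 by (simp add: field_simps)
  have "w * cinner f y + cinner f (blinfun_apply A y) = (norm f)\<^sup>2"
    using arg_cong[OF eq, of "cinner f"] by (simp add: cinner_simps cinner_self add.commute)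
  then have "complex_of_real ((norm f)\<^sup>2) * inverse w = (w * cinner f y + cinner f (blinfun_apply A y)) * inverse w"
    by (simp only:)
  also have "\<dots> = cinner f y * (w * inverse w) + cinner f (blinfun_apply A y) * inverse w"
    by (simp only: distrib_left distrib_right mult_ac)
  also have "w * inverse w = 1" using w0 by simp
  finally have "complex_of_real ((norm f)\<^sup>2) * inverse w = cinner f y + cinner f (blinfun_apply A y) * inverse w"
    by (simp only: mult_1_right)
  then have "cinner f y - (norm f)\<^sup>2 * inverse w = - cinner f (blinfun_apply A y) * inverse w"
    by simp
  then have "cmod (cinner f y - (norm f)\<^sup>2 * inverse w) = cmod (cinner f (blinfun_apply A y)) / cmod w"
    by (simp add: norm_mult norm_divide divide_inverse norm_inverse)
  also have "\<dots> \<le> norm f * (norm A * (2 * norm f / cmod w)) / cmod w"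
  proof (intro divide_right_mono)
    have "cmod (cinner f (blinfun_apply A y)) \<le> norm f * norm (blinfun_apply A y)" by (rule cinner_Cauchy_Schwarz)
    also have "\<dots> \<le> norm f * (norm A * norm y)" by (intro mult_left_mono norm_blinfun) auto
    also have "\<dots> \<le> norm f * (norm A * (2 * norm f / cmod w))" using ny by (intro mult_left_mono) auto
    finally show "cmod (cinner f (blinfun_apply A y)) \<le> norm f * (norm A * (2 * norm f / cmod w))" .
  qed simp
  also have "\<dots> = 2 * norm A * (norm f)\<^sup>2 / (cmod w)\<^sup>2" by (simp add: power2_eq_square)
  finally show ?thesis by (simp add: y_def)
qed

text \<open>Closing the horizontal line by a path of length \<open>O(N)\<close> through \<open>iN\<close>, on which the integrand is
  \<open>\<parallel>f\<parallel>\<^sup>2 / w + O(N\<^sup>-\<^sup>2)\<close>, bounds the integral over the line by the increment of the argument.\<close>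

lemma primitive_G:
  obtains q where "\<And>w. Im w > 0 \<Longrightarrow> (q has_field_derivative cinner f (blinfun_apply (G w) f)) (at w)"
    and "\<And>d a b. d > 0 \<Longrightarrow> a \<le> b \<Longrightarrow> Im (q (Complex a d)) - Im (q (Complex b d)) \<le> pi * (norm f)\<^sup>2"
proof -
  define U where "U = {w. Im w > 0}"
  have oU: "open U" unfolding U_def by (rule open_halfspace_Im_gt)
  have cU: "convex U" unfolding U_def by (rule convex_halfspace_Im_gt)
  define r where "r = (\<lambda>w. cinner f (blinfun_apply (G w) f))"
  obtain q where "\<And>w. w \<in> U \<Longrightarrow> (q has_field_derivative r w) (at w within U)"
    using holomorphic_convex_primitive'[OF cU oU, of r] holomorphic_G[of f] by (auto simp: U_def r_def)
  then have q: "(q has_field_derivative r w) (at w)" if "w \<in> U" for w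
    using that at_within_open[OF that oU] by metis
  \<comment> \<open>The derivative of q along a horizontal line has nonpositive imaginary part.
    Hence replacing a, b by -N, N can only enlarge the increment to be bounded.\<close>
  have mono: "Im (q (Complex b d)) \<le> Im (q (Complex a d))" if d: "d > 0" and ab: "a \<le> b" for a b d
  proof -
    have "((\<lambda>x. Im (q (Complex x d))) has_real_derivative Im (r (Complex x d))) (at x)" for x
    proof -
      have "((\<lambda>x. q (of_real x + \<i> * of_real d)) has_vector_derivative 1 * r (of_real x + \<i> * of_real d)) (at x)"
      proof -
        have "((\<lambda>x. of_real x + \<i> * of_real d) has_vector_derivative of_real 1 + 0) (at x)"
          by (intro has_vector_derivative_add has_vector_derivative_of_real has_vector_derivative_const DERIV_ident)
        from field_vector_diff_chain_at[OF this q] show ?thesis using d by (simp add: U_def comp_def)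
      qed
      from bounded_linear.has_vector_derivative[OF bounded_linear_Im this]
      show ?thesis by (simp add: Complex_eq has_real_derivative_iff_has_vector_derivative)
    qed
    moreover have "Im (r (Complex x d)) \<le> 0" for x
      unfolding r_def by (rule Im_G_le) (use d in simp)
    ultimately have "\<exists>y. ((\<lambda>x. Im (q (Complex x d))) has_real_derivative y) (at x) \<and> y \<le> 0" for x
      by blast
    from DERIV_nonpos_imp_nonincreasing[OF ab this] show ?thesis by simp
  qed
  \<comment> \<open>Subtracting a primitive of ||f||^2 / w leaves a function whose derivative is
    O(|w|^{-2}).\<close>
  define h where "h = (\<lambda>w. q w - (norm f)\<^sup>2 * Ln w)"
  have h: "(h has_field_derivative r w - (norm f)\<^sup>2 * inverse w) (at w)" if w: "w \<in> U" for w :: complex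
  proof -
    have "w \<notin> \<real>\<^sub>\<le>\<^sub>0" using w by (auto simp: U_def complex_nonpos_Reals_iff)
    then show ?thesis unfolding h_def
      by (intro DERIV_diff DERIV_cmult q[OF w] has_field_derivative_Ln)
  qed
  \<comment> \<open>The 8 is the 2 of \<open>G_asymptotics\<close> times 4, from |w| >= N /
    2.\<close>
  define c where "c = 8 * norm A * (norm f)\<^sup>2"
  have seg: "cmod (h u - h v) \<le> c / N\<^sup>2 * cmod (u - v)"
    if N: "N > 0" "4 * norm A \<le> N" and sub: "closed_segment u v \<subseteq> U" and far: "\<And>w. w \<in> closed_segment u v \<Longrightarrow> N / 2 \<le> cmod w" for u v N
  proof (rule field_differentiable_bound[OF convex_closed_segment])
    fix w :: complex assume w: "w \<in> closed_segment u v"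
    then have wU: "w \<in> U" using sub by auto
    show "(h has_field_derivative r w - (norm f)\<^sup>2 * inverse w) (at w within closed_segment u v)"
      by (rule DERIV_subset[OF h[OF wU]]) simp
    have "cmod (r w - (norm f)\<^sup>2 * inverse w) \<le> 2 * norm A * (norm f)\<^sup>2 / (cmod w)\<^sup>2"
      unfolding r_def by (rule G_asymptotics) (use wU far[OF w] N in \<open>auto simp: U_def\<close>)
    also have "\<dots> \<le> 2 * norm A * (norm f)\<^sup>2 / (N / 2)\<^sup>2"
      using far[OF w] N by (intro divide_left_mono power_mono mult_pos_pos) auto
    also have "\<dots> = c / N\<^sup>2" using N by (simp add: c_def power2_eq_square field_simps)
    finally show "cmod (r w - (norm f)\<^sup>2 * inverse w) \<le> c / N\<^sup>2" .
  qed auto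
  \<comment> \<open>The segment stays at distance at least N / 2 from 0, in its first half because
    of the real part and in its second because of the imaginary part. Its length is at most 2
    N.\<close>
  have half: "cmod (h (Complex (s * N) d) - h (Complex 0 N)) \<le> 2 * c / N"
    if N: "N > 0" "4 * norm A \<le> N" and d: "0 < d" "d \<le> N" and s: "s = 1 \<or> s = -1" for N d s
  proof -
    have pt: "w \<in> U \<and> N / 2 \<le> cmod w" if w: "w \<in> closed_segment (Complex (s * N) d) (Complex 0 N)" for w
    proof -
      obtain t where t: "0 \<le> t" "t \<le> 1" "w = (1 - t) *\<^sub>R Complex (s * N) d + t *\<^sub>R Complex 0 N"
        using w unfolding in_segment by blast
      have re: "Re w = (1 - t) * (s * N)" and im: "Im w = (1 - t) * d + t * N" unfolding t(3) by simp_all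
      note t = t(1,2)
      have "(1 - t) * d + t * d \<le> (1 - t) * d + t * N" using t d by (intro add_left_mono mult_left_mono)
      then have "Im w > 0" using d by (simp add: im algebra_simps)
      moreover have "N / 2 \<le> cmod w"
      proof (cases "t \<le> 1 / 2")
        case True
        have "N / 2 \<le> (1 - t) * N" using True N by (simp add: field_simps)
        also have "\<dots> = \<bar>Re w\<bar>" unfolding re using s t N by (auto simp: abs_mult)
        also have "\<dots> \<le> cmod w" by (rule abs_Re_le_cmod)
        finally show ?thesis .
      next
        case False
        have "N / 2 \<le> t * N" using False N by (simp add: field_simps)
        also have "\<dots> \<le> Im w" unfolding im using t d by simp
        also have "\<dots> \<le> cmod w" using abs_Im_le_cmod[of w] by linarith
        finally show ?thesis .
      qed
      ultimately show ?thesis by (simp add: U_def)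
    qed
    have "cmod (h (Complex (s * N) d) - h (Complex 0 N)) \<le> c / N\<^sup>2 * cmod (Complex (s * N) d - Complex 0 N)"
      by (rule seg[OF N]) (use pt in auto)
    also have "\<dots> \<le> c / N\<^sup>2 * (2 * N)"
    proof (rule mult_left_mono)
      show "cmod (Complex (s * N) d - Complex 0 N) \<le> 2 * N"
        using cmod_le[of "Complex (s * N) d - Complex 0 N"] s d N by (auto simp: abs_mult)
      show "0 \<le> c / N\<^sup>2" by (simp add: c_def)
    qed
    finally show ?thesis using N by (simp add: power2_eq_square mult.commute)
  qed
  have bound: "Im (q (Complex a d)) - Im (q (Complex b d)) \<le> pi * (norm f)\<^sup>2 + 4 * c / N"
    if d: "d > 0" and N: "N > 0" "4 * norm A \<le> N" "d \<le> N" "\<bar>a\<bar> \<le> N" "\<bar>b\<bar> \<le> N" for a b d N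
  proof -
    define u v where "u = Complex (- N) d" and "v = Complex N d"
    have "Im (q (Complex a d)) - Im (q (Complex b d)) \<le> Im (q u) - Im (q v)"
    proof -
      have "- N \<le> a" "b \<le> N" using N by auto
      from mono[OF d this(1)] mono[OF d this(2)] show ?thesis by (simp add: u_def v_def)
    qed
    also have "\<dots> = Im (h u - h v) + (norm f)\<^sup>2 * (Im (Ln u) - Im (Ln v))"
      by (simp add: h_def algebra_simps flip: of_real_power)
    finally have 1: "Im (q (Complex a d)) - Im (q (Complex b d)) \<le> Im (h u - h v) + (norm f)\<^sup>2 * (Im (Ln u) - Im (Ln v))" .
    have "Im (h u - h v) \<le> cmod (h u - h v)" using abs_Im_le_cmod[of "h u - h v"] by linarith
    also have "\<dots> \<le> cmod (h u - h (Complex 0 N)) + cmod (h v - h (Complex 0 N))"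
      using norm_triangle_ineq4[of "h u - h (Complex 0 N)" "h v - h (Complex 0 N)"] by simp
    also have "\<dots> \<le> 2 * c / N + 2 * c / N"
      using half[OF N(1,2) d N(3), of "-1"] half[OF N(1,2) d N(3), of 1] by (intro add_mono) (simp_all add: u_def v_def)
    finally have 2: "Im (h u - h v) \<le> 4 * c / N" by simp
    \<comment> \<open>Both points lie in the upper half plane, so their arguments are between 0 and
      pi.\<close>
    have "(norm f)\<^sup>2 * (Im (Ln u) - Im (Ln v)) \<le> (norm f)\<^sup>2 * pi"
      using Im_Ln_pos_lt_imp[of u] Im_Ln_pos_lt_imp[of v] d by (intro mult_left_mono) (simp_all add: u_def v_def)
    with 1 2 show ?thesis by (simp add: mult.commute)
  qed
  show ?thesis
  proof (rule that[of q])
    show "(q has_field_derivative cinner f (blinfun_apply (G w) f)) (at w)" if "Im w > 0" for w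
      using q[of w] that by (simp add: r_def U_def)
    fix d a b :: real assume d: "d > 0"
    have "((\<lambda>N. pi * (norm f)\<^sup>2 + 4 * c * inverse N) \<longlongrightarrow> pi * (norm f)\<^sup>2 + 4 * c * 0) at_top"
      by (intro tendsto_intros tendsto_inverse_0_at_top filterlim_ident)
    then have "((\<lambda>N. pi * (norm f)\<^sup>2 + 4 * c / N) \<longlongrightarrow> pi * (norm f)\<^sup>2) at_top" by (simp add: divide_inverse)
    then show "Im (q (Complex a d)) - Im (q (Complex b d)) \<le> pi * (norm f)\<^sup>2"
    proof (rule tendsto_lowerbound)
      show "\<forall>\<^sub>F N in at_top. Im (q (Complex a d)) - Im (q (Complex b d)) \<le> pi * (norm f)\<^sup>2 + 4 * c / N"
        using eventually_ge_at_top[of "max (max 1 (4 * norm A)) (max d (max \<bar>a\<bar> \<bar>b\<bar>))"]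
        by eventually_elim (rule bound[OF d], auto)
    qed simp
  qed
qed

end

section \<open>The bound by pi for the integral over the coupling\<close>

context perturbation
begin

context
  fixes z :: complex
  assumes z_pos: "Im z > 0"
begin

lemma norm_J:
  assumes "s \<in> {0..1}"
  shows "norm (id_blinfun - s *\<^sub>R M s z) \<le> 1 + (norm K)\<^sup>2 / Im z"
proof -
  have z: "z \<notin> \<real>" using z_pos by (simp add: complex_is_Real_iff)
  have "norm (id_blinfun - s *\<^sub>R M s z) \<le> norm (id_blinfun :: 'h \<Rightarrow>\<^sub>L 'h) + norm (s *\<^sub>R M s z)"
    by (rule norm_triangle_ineq4)
  also have "norm (s *\<^sub>R M s z) \<le> 1 * norm (M s z)" using assms by (simp add: mult_left_le_one_le)
  also have "norm (M s z) \<le> (norm K)\<^sup>2 / Im z" using norm_M[OF z, of s] z_pos by simp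
  also have "norm (id_blinfun :: 'h \<Rightarrow>\<^sub>L 'h) \<le> 1" by (rule norm_blinfun_bound) auto
  finally show ?thesis by simp
qed

text \<open>For d = 0 this would be the equality given by (A + 1/s)^{-1} = s (1 - s M_s). The shift
  by d moves into the half plane where G is controlled; the resolvent identity gives its cost, and
  the smallness of d keeps G bounded independently of d.\<close>

lemma Im_cinner_M_le_G:
  assumes s: "0 < s" "s \<le> 1" and d: "0 < d" "d * (1 + (norm K)\<^sup>2 / Im z) \<le> 1 / 2"
  shows "s\<^sup>2 * Im (cinner f (blinfun_apply (M s z) f)) \<le>
    - Im (cinner f (blinfun_apply (G (M 0 z) (Complex (1 / s) d)) f)) + 2 * (1 + (norm K)\<^sup>2 / Im z)\<^sup>2 * d * (norm f)\<^sup>2"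
proof -
  have z: "z \<notin> \<real>" using z_pos by (simp add: complex_is_Real_iff)
  define C where "C = 1 + (norm K)\<^sup>2 / Im z"
  have C: "C \<ge> 1" using z_pos by (simp add: C_def)
  define A where "A = M 0 z"
  have A: "clinear_op A" unfolding A_def by (rule clinear_M[OF z])
  have diss: "0 \<le> Im (cinner x (blinfun_apply A x))" for x
    unfolding A_def using z_pos by (simp add: Im_cinner_M[OF z])
  \<comment> \<open>The inverse of A + 1 / s, that is, the boundary value of G at 1 / s.\<close>
  define J where "J = s *\<^sub>R (id_blinfun - s *\<^sub>R M s z)"
  define w where "w = Complex (1 / s) d"
  have w: "Im w > 0" using d by (simp add: w_def)
  define y where "y = blinfun_apply (G A w) f"
  define x where "x = blinfun_apply J f"
  have nJ: "norm x \<le> C * norm f"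
  proof -
    have "norm J = s * norm (id_blinfun - s *\<^sub>R M s z)" using s by (simp add: J_def)
    also have "\<dots> \<le> 1 * C" using s norm_J[of s] by (intro mult_mono) (auto simp: C_def)
    finally show ?thesis using norm_blinfun[of J f] mult_right_mono[of "norm J" C "norm f"] by (simp add: x_def)
  qed
  have Ax: "blinfun_apply A x + (1 / s) *\<^sub>R x = f"
  proof -
    have "blinfun_apply (T s z) ((1 / s) *\<^sub>R x) = f"
      using arg_cong[OF T_inverse(2)[OF z, of s], of "\<lambda>S. blinfun_apply S f"] s
      by (simp add: x_def J_def blinfun.scaleR_left)
    then show ?thesis using s by (simp add: T_def A_def blinfun.add_left blinfun.scaleR_left blinfun.scaleR_right algebra_simps)
  qed
  have wx: "w *\<^sub>C x = (1 / s) *\<^sub>R x + (\<i> * complex_of_real d) *\<^sub>C x"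
    by (simp add: w_def Complex_eq scaleC_add_left scaleC_of_real[symmetric])
  have "blinfun_apply A x + w *\<^sub>C x = f + (\<i> * complex_of_real d) *\<^sub>C x"
    using Ax by (simp add: wx add.assoc[symmetric])
  from arg_cong[OF this, of "blinfun_apply (G A w)"]
  have x_eq: "x = y + (\<i> * complex_of_real d) *\<^sub>C blinfun_apply (G A w) x"
    unfolding G_left[OF A diss w] by (simp add: y_def blinfun.add_right clinear_opD[OF clinear_G[OF A diss w]])
  define g where "g = blinfun_apply (G A w) x"
  have g: "norm g \<le> 2 * C * norm x"
  proof -
    have "blinfun_apply A g + w *\<^sub>C g = x" unfolding g_def by (rule G_right[OF A diss w])
    moreover have "w *\<^sub>C g = (1 / s) *\<^sub>R g + (\<i> * complex_of_real d) *\<^sub>C g"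
      by (simp add: w_def Complex_eq scaleC_add_left scaleC_of_real[symmetric])
    ultimately have "blinfun_apply A g = x - (1 / s) *\<^sub>R g - (\<i> * complex_of_real d) *\<^sub>C g"
      by (simp add: algebra_simps)
    then have Tg: "blinfun_apply (T s z) g = s *\<^sub>R (x - (\<i> * complex_of_real d) *\<^sub>C g)"
      using s by (simp add: T_def A_def blinfun.add_left blinfun.scaleR_left scaleR_diff_right)
    have "g = blinfun_apply (id_blinfun - s *\<^sub>R M s z) (blinfun_apply (T s z) g)"
      using arg_cong[OF T_inverse(1)[OF z, of s], of "\<lambda>S. blinfun_apply S g"] by simp
    also have "\<dots> = blinfun_apply J (x - (\<i> * complex_of_real d) *\<^sub>C g)"
      unfolding Tg by (simp add: J_def blinfun.scaleR_left blinfun.scaleR_right)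
    finally have "norm g \<le> norm J * norm (x - (\<i> * complex_of_real d) *\<^sub>C g)" by (metis norm_blinfun)
    also have "\<dots> \<le> C * (norm x + d * norm g)"
    proof (rule mult_mono)
      have "norm J = s * norm (id_blinfun - s *\<^sub>R M s z)" using s by (simp add: J_def)
      also have "\<dots> \<le> 1 * C" using s norm_J[of s] by (intro mult_mono) (auto simp: C_def)
      finally show "norm J \<le> C" by simp
      show "norm (x - (\<i> * complex_of_real d) *\<^sub>C g) \<le> norm x + d * norm g"
        using norm_triangle_ineq4[of x "(\<i> * complex_of_real d) *\<^sub>C g"] d by (simp add: norm_scaleC norm_mult)
    qed (use C in auto)
    also have "\<dots> = C * norm x + (d * C) * norm g" by (simp add: algebra_simps)
    also have "\<dots> \<le> C * norm x + 1 / 2 * norm g" using d by (intro add_left_mono mult_right_mono) (auto simp: C_def)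
    finally show ?thesis by simp
  qed
  have "cinner f x = complex_of_real s * (norm f)\<^sup>2 - complex_of_real (s\<^sup>2) * cinner f (blinfun_apply (M s z) f)"
    by (simp add: x_def J_def blinfun.scaleR_left blinfun.diff_left cinner_simps cinner_self power2_eq_square algebra_simps)
  then have "s\<^sup>2 * Im (cinner f (blinfun_apply (M s z) f)) = - Im (cinner f x)" by (simp flip: of_real_power)
  also have "\<dots> = - Im (cinner f y) - Im (\<i> * complex_of_real d * cinner f g)"
    by (subst x_eq) (simp add: cinner_add_right cinner_scaleC_right g_def)
  also have "\<dots> \<le> - Im (cinner f y) + cmod (\<i> * complex_of_real d * cinner f g)"
    using abs_Im_le_cmod[of "\<i> * complex_of_real d * cinner f g"] by linarith
  also have "cmod (\<i> * complex_of_real d * cinner f g) = d * cmod (cinner f g)" using d by (simp add: norm_mult)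
  also have "\<dots> \<le> d * (norm f * (2 * C * (C * norm f)))"
  proof (rule mult_left_mono)
    have "cmod (cinner f g) \<le> norm f * norm g" by (rule cinner_Cauchy_Schwarz)
    also have "norm g \<le> 2 * C * (C * norm f)" using g nJ C by (meson order_trans mult_left_mono mult_nonneg_nonneg zero_le_numeral zero_le_one)
    finally show "cmod (cinner f g) \<le> norm f * (2 * C * (C * norm f))" by (simp add: mult_left_mono)
  qed (use d in simp)
  also have "\<dots> = 2 * C\<^sup>2 * d * (norm f)\<^sup>2" by (simp add: power2_eq_square)
  finally show ?thesis by (simp add: y_def w_def A_def C_def)
qed

lemma continuous_on_Im_M: "continuous_on S (\<lambda>s. Im (cinner f (blinfun_apply (M s z) f)))"
  using z_pos by (intro continuous_intros continuous_on_M_s bounded_linear.continuous_on[OF blinfun.bounded_linear_left])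
    (simp add: complex_is_Real_iff)

text \<open>Along w = 1 / s + i d one has dw = - ds / s^2, so the integrated estimate of
  \<open>Im_cinner_M_le_G\<close> is an increment of a primitive of the form of G on a horizontal
  line. The lower limit e > 0 keeps 1 / s bounded; d tends to 0 first, then e.\<close>

theorem integral_Im_M_le:
  "integral {0..1} (\<lambda>s. Im (cinner f (blinfun_apply (M s z) f))) \<le> pi * (norm f)\<^sup>2"
proof -
  have z: "z \<notin> \<real>" using z_pos by (simp add: complex_is_Real_iff)
  define C where "C = 1 + (norm K)\<^sup>2 / Im z"
  have C: "C \<ge> 1" using z_pos by (simp add: C_def)
  define m where "m = (\<lambda>s. Im (cinner f (blinfun_apply (M s z) f)))"
  have A: "clinear_op (M 0 z)" by (rule clinear_M[OF z])
  have diss: "0 \<le> Im (cinner x (blinfun_apply (M 0 z) x))" for x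
    using z_pos by (simp add: Im_cinner_M[OF z])
  have int: "m integrable_on {a..b}" for a b
    unfolding m_def by (intro integrable_continuous_real continuous_on_Im_M)
  obtain q where q: "\<And>w. Im w > 0 \<Longrightarrow> (q has_field_derivative cinner f (blinfun_apply (G (M 0 z) w) f)) (at w)"
    and qb: "\<And>d a b. d > 0 \<Longrightarrow> a \<le> b \<Longrightarrow> Im (q (Complex a d)) - Im (q (Complex b d)) \<le> pi * (norm f)\<^sup>2"
    using primitive_G[OF A diss] by metis
  have tail: "integral {e..1} m \<le> pi * (norm f)\<^sup>2" if e: "0 < e" "e \<le> 1" for e
  proof -
    \<comment> \<open>Since s >= e, the error 2 C^2 d ||f||^2 / s^2 is at most k d.\<close>
    define k where "k = 2 * C\<^sup>2 * (norm f)\<^sup>2 / e\<^sup>2"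
    have "integral {e..1} m \<le> pi * (norm f)\<^sup>2 + k * d" if d: "0 < d" "d * C \<le> 1 / 2" for d
    proof -
      define g where "g = (\<lambda>s. - Im (cinner f (blinfun_apply (G (M 0 z) (Complex (1 / s) d)) f)) / s\<^sup>2)"
      have "(g has_integral Im (q (Complex (1 / 1) d)) - Im (q (Complex (1 / e) d))) {e..1}"
      proof (rule fundamental_theorem_of_calculus[OF e(2)])
        fix s assume s: "s \<in> {e..1}"
        then have s0: "s > 0" using e by simp
        define p where "p = of_real (1 / s) + \<i> * of_real d"
        have "((\<lambda>x. of_real (1 / x) + \<i> * of_real d) has_vector_derivative of_real (- (1 / s\<^sup>2)) + 0) (at s)"
          using s0 by (intro has_vector_derivative_add has_vector_derivative_of_real has_vector_derivative_const)
             (auto intro!: derivative_eq_intros simp: has_real_derivative_iff_has_vector_derivative[symmetric] power2_eq_square)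
        moreover have "(q has_field_derivative cinner f (blinfun_apply (G (M 0 z) p) f)) (at p)"
          by (rule q) (use d in \<open>simp add: p_def\<close>)
        ultimately have "((\<lambda>x. q (of_real (1 / x) + \<i> * of_real d)) has_vector_derivative
            (of_real (- (1 / s\<^sup>2)) + 0) * cinner f (blinfun_apply (G (M 0 z) p) f)) (at s)"
          using field_vector_diff_chain_at[of "\<lambda>x. of_real (1 / x) + \<i> * of_real d" "of_real (- (1 / s\<^sup>2)) + 0" s q]
          by (simp add: p_def comp_def)
        from bounded_linear.has_vector_derivative[OF bounded_linear_Im this]
        have "((\<lambda>x. Im (q (Complex (1 / x) d))) has_vector_derivative g s) (at s)"
          by (simp add: Complex_eq g_def p_def flip: of_real_power)
        then show "((\<lambda>x. Im (q (Complex (1 / x) d))) has_vector_derivative g s) (at s within {e..1})"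
          by (rule has_vector_derivative_at_within)
      qed
      then have gi: "g integrable_on {e..1}" "integral {e..1} g \<le> pi * (norm f)\<^sup>2"
        using qb[OF d(1), of 1 "1 / e"] e by (auto simp: has_integral_integrable integral_unique)
      have "integral {e..1} m \<le> integral {e..1} (\<lambda>s. g s + k * d)"
      proof (rule integral_le[OF int])
        show "(\<lambda>s. g s + k * d) integrable_on {e..1}" by (intro integrable_add gi integrable_const_ivl)
        fix s assume s: "s \<in> {e..1}"
        then have s0: "0 < s" "s \<le> 1" "e \<le> s" using e by auto
        have "s\<^sup>2 * m s \<le> - Im (cinner f (blinfun_apply (G (M 0 z) (Complex (1 / s) d)) f)) + 2 * C\<^sup>2 * d * (norm f)\<^sup>2"
          unfolding m_def C_def by (rule Im_cinner_M_le_G[OF s0(1,2) d(1)]) (use d in \<open>simp add: C_def\<close>)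
        then have "m s \<le> g s + 2 * C\<^sup>2 * d * (norm f)\<^sup>2 / s\<^sup>2"
          using s0 by (simp add: g_def field_simps)
        also have "2 * C\<^sup>2 * d * (norm f)\<^sup>2 / s\<^sup>2 \<le> 2 * C\<^sup>2 * d * (norm f)\<^sup>2 / e\<^sup>2"
          using s0 e d by (intro divide_left_mono power_mono mult_pos_pos) auto
        finally show "m s \<le> g s + k * d" by (simp add: k_def mult_ac)
      qed
      also have "\<dots> = integral {e..1} g + k * d * (1 - e)"
        using e by (subst Henstock_Kurzweil_Integration.integral_add) (auto intro: gi)
      also have "\<dots> \<le> pi * (norm f)\<^sup>2 + k * d * 1"
        using gi e d by (intro add_mono mult_left_mono) (auto simp: k_def)
      finally show ?thesis by simp
    qed
    note * = this
    have "((\<lambda>d. pi * (norm f)\<^sup>2 + k * d) \<longlongrightarrow> pi * (norm f)\<^sup>2 + k * 0) (at_right 0)"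
      by (intro tendsto_intros)
    then have "((\<lambda>d. pi * (norm f)\<^sup>2 + k * d) \<longlongrightarrow> pi * (norm f)\<^sup>2) (at_right 0)" by simp
    then show ?thesis
    proof (rule tendsto_lowerbound)
      have "\<forall>\<^sub>F d in at_right 0. d < 1 / (2 * C)" using C by (intro order_tendstoD(2)[OF tendsto_ident_at]) simp
      then show "\<forall>\<^sub>F d in at_right 0. integral {e..1} m \<le> pi * (norm f)\<^sup>2 + k * d"
        using eventually_at_right_less[of 0]
      proof eventually_elim
        case (elim d)
        then show ?case using C by (intro *) (auto simp: field_simps)
      qed
    qed simp_all
  qed
  have "continuous_on {0..1} (\<lambda>e. integral {e..1} m)"
    by (rule indefinite_integral_continuous_1'[OF int])
  then have "((\<lambda>e. integral {e..1} m) \<longlongrightarrow> integral {0..1} m) (at 0 within {0..1})"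
    by (simp add: continuous_on_def)
  then have "integral {0..1} m \<le> pi * (norm f)\<^sup>2"
  proof (rule tendsto_upperbound)
    show "\<forall>\<^sub>F e in at 0 within {0..1}. integral {e..1} m \<le> pi * (norm f)\<^sup>2"
      unfolding eventually_at_filter by (intro always_eventually allI impI tail) auto
    show "at 0 within {0..1} \<noteq> (bot :: real filter)" by (simp add: trivial_limit_within islimpt_Icc)
  qed
  then show ?thesis by (simp add: m_def)
qed

end

end

section \<open>Differentiation along dyadic intervals\<close>

text \<open>The ceiling makes the cells open on the left and closed on the right, like the intervals
  on which measures are compared.\<close>

definition dyadic_index :: "nat \<Rightarrow> real \<Rightarrow> int" where
  "dyadic_index n t = \<lceil>2 ^ n * t\<rceil>"

definition dyadic_interval :: "nat \<Rightarrow> int \<Rightarrow> real set" where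
  "dyadic_interval n k = {(real_of_int k - 1) / 2 ^ n<..real_of_int k / 2 ^ n}"

text \<open>The density of M relative to Lebesgue measure on the dyadic cells of level n; over n
  these functions form a martingale.\<close>

definition slope :: "real measure \<Rightarrow> nat \<Rightarrow> real \<Rightarrow> real" where
  "slope M n t = 2 ^ n * measure M (dyadic_interval n (dyadic_index n t))"

lemma dyadic_index_eq_iff: "dyadic_index n t = k \<longleftrightarrow> t \<in> dyadic_interval n k"
  by (auto simp: dyadic_index_def dyadic_interval_def ceiling_eq_iff field_simps)

lemma measurable_dyadic_index [measurable]: "dyadic_index n \<in> measurable borel (count_space UNIV)"
  unfolding dyadic_index_def by measurable

lemma dyadic_interval_borel [measurable]: "dyadic_interval n k \<in> sets borel"
  by (simp add: dyadic_interval_def)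

lemma measurable_slope [measurable]: "slope M n \<in> borel_measurable borel"
  unfolding slope_def
  by (rule measurable_compose[OF measurable_dyadic_index[of n], of "\<lambda>k. 2 ^ n * measure M (dyadic_interval n k)"]) simp

lemma slope_nonneg: "0 \<le> slope M n t"
  by (simp add: slope_def)

text \<open>Expresses the nesting of the cells. Integrals of functions of a coarse cell can thereby
  be evaluated at any finer level.\<close>

lemma dyadic_index_coarsen:
  assumes "n \<le> m"
  shows "dyadic_index n t = \<lceil>real_of_int (dyadic_index m t) / 2 ^ (m - n)\<rceil>"
proof -
  have pow: "(2::real) ^ m = 2 ^ n * 2 ^ (m - n)" using assms by (simp flip: power_add)
  have "\<lceil>real_of_int (dyadic_index m t) / 2 ^ (m - n)\<rceil> \<le> k \<longleftrightarrow> dyadic_index n t \<le> k" for k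
  proof -
    have "\<lceil>real_of_int (dyadic_index m t) / 2 ^ (m - n)\<rceil> \<le> k \<longleftrightarrow> real_of_int (dyadic_index m t) \<le> real_of_int (k * 2 ^ (m - n))"
      by (simp add: ceiling_le_iff field_simps)
    also have "\<dots> \<longleftrightarrow> dyadic_index m t \<le> k * 2 ^ (m - n)" by (rule of_int_le_iff)
    also have "\<dots> \<longleftrightarrow> 2 ^ m * t \<le> real_of_int k * 2 ^ (m - n)"
      by (simp add: dyadic_index_def ceiling_le_iff)
    also have "\<dots> \<longleftrightarrow> 2 ^ n * t \<le> real_of_int k" by (simp add: pow mult.assoc mult.left_commute)
    also have "\<dots> \<longleftrightarrow> dyadic_index n t \<le> k" by (simp add: dyadic_index_def ceiling_le_iff)
    finally show ?thesis .
  qed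
  then show ?thesis by (metis order.refl order_antisym)
qed

context
  fixes M :: "real measure" and C :: real
  assumes fin: "finite_measure M" and sets_M [measurable_cong]: "sets M = sets borel"
    and lip: "\<And>a b. a \<le> b \<Longrightarrow> measure M {a<..b} \<le> C * (b - a)"
begin

interpretation finite_measure M by (rule fin)

lemma slope_le: "slope M n t \<le> C"
proof -
  have "measure M (dyadic_interval n k) \<le> C * (real_of_int k / 2 ^ n - (real_of_int k - 1) / 2 ^ n)" for k
    unfolding dyadic_interval_def by (rule lip) (simp add: field_simps)
  also have "real_of_int k / 2 ^ n - (real_of_int k - 1) / 2 ^ n = 1 / 2 ^ n" for k
    by (simp add: diff_divide_distrib)
  finally have "measure M (dyadic_interval n k) \<le> C * (1 / 2 ^ n)" for k .
  then show ?thesis by (simp add: slope_def field_simps)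
qed

lemma C_nonneg: "0 \<le> C"
  using order_trans[OF slope_nonneg slope_le] .

lemma distr_dyadic:
  "distr (density lborel (\<lambda>t. ennreal (slope M m t))) (count_space UNIV) (dyadic_index m) = distr M (count_space UNIV) (dyadic_index m)"
proof (rule measure_eqI_countable[of _ UNIV])
  fix k :: int
  have pre: "dyadic_index m -` {k} = dyadic_interval m k" by (simp add: vimage_def dyadic_index_eq_iff)
  have "emeasure (distr (density lborel (\<lambda>t. ennreal (slope M m t))) (count_space UNIV) (dyadic_index m)) {k}
    = (\<integral>\<^sup>+t. ennreal (slope M m t) * indicator (dyadic_interval m k) t \<partial>lborel)"
    by (subst emeasure_distr) (auto simp: pre emeasure_density)
  also have "\<dots> = (\<integral>\<^sup>+t. ennreal (2 ^ m * measure M (dyadic_interval m k)) * indicator (dyadic_interval m k) t \<partial>lborel)"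
    by (intro nn_integral_cong) (auto simp: indicator_def slope_def dyadic_index_eq_iff[symmetric])
  also have "\<dots> = ennreal (2 ^ m * measure M (dyadic_interval m k)) * emeasure lborel (dyadic_interval m k)"
    by (subst nn_integral_cmult_indicator) auto
  also have "emeasure lborel (dyadic_interval m k) = ennreal (1 / 2 ^ m)"
  proof -
    have "(real_of_int k - 1) / 2 ^ m \<le> real_of_int k / 2 ^ m" by (simp add: field_simps)
    then show ?thesis by (simp add: dyadic_interval_def diff_divide_distrib)
  qed
  also have "ennreal (2 ^ m * measure M (dyadic_interval m k)) * ennreal (1 / 2 ^ m) = emeasure M (dyadic_interval m k)"
    by (simp add: ennreal_mult[symmetric] emeasure_eq_measure)
  also have "\<dots> = emeasure (distr M (count_space UNIV) (dyadic_index m)) {k}"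
    by (subst emeasure_distr) (auto simp: pre sets_eq_imp_space_eq[OF sets_M])
  finally show "emeasure (distr (density lborel (\<lambda>t. ennreal (slope M m t))) (count_space UNIV) (dyadic_index m)) {k}
    = emeasure (distr M (count_space UNIV) (dyadic_index m)) {k}" .
qed auto

text \<open>The martingale property: at each level m >= n the slope acts as the density of M against
  functions of the level n cell.\<close>

lemma nn_integral_slope:
  assumes "n \<le> m"
  shows "(\<integral>\<^sup>+t. ennreal (slope M m t) * F (dyadic_index n t) \<partial>lborel) = (\<integral>\<^sup>+t. F (dyadic_index n t) \<partial>M)"
proof -
  define g where "g = (\<lambda>k::int. F \<lceil>real_of_int k / 2 ^ (m - n)\<rceil>)"
  have g: "F (dyadic_index n t) = g (dyadic_index m t)" for t
    by (simp add: g_def dyadic_index_coarsen[OF assms])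
  have mg: "(\<lambda>t. g (dyadic_index m t)) \<in> borel_measurable borel"
    by (rule measurable_compose[OF measurable_dyadic_index]) simp
  have "(\<integral>\<^sup>+t. ennreal (slope M m t) * g (dyadic_index m t) \<partial>lborel)
    = (\<integral>\<^sup>+t. g (dyadic_index m t) \<partial>density lborel (\<lambda>t. ennreal (slope M m t)))"
    using mg by (subst nn_integral_density) auto
  also have "\<dots> = (\<integral>\<^sup>+k. g k \<partial>distr (density lborel (\<lambda>t. ennreal (slope M m t))) (count_space UNIV) (dyadic_index m))"
    by (subst nn_integral_distr) auto
  also have "\<dots> = (\<integral>\<^sup>+t. g (dyadic_index m t) \<partial>M)"
    unfolding distr_dyadic by (subst nn_integral_distr) auto
  finally show ?thesis by (simp add: g)
qed

text \<open>The squared L^2 norm of the slope for Lebesgue measure, written as an integral against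
  M, where the Lipschitz bound shows it finite.\<close>

definition energy :: "nat \<Rightarrow> real" where
  "energy n = (\<integral>t. slope M n t \<partial>M)"

lemma integrable_slope: "integrable M (slope M n)"
  by (rule integrable_const_bound[where B = C]) (auto simp: slope_nonneg slope_le)

lemma energy_le: "energy n \<le> C * measure M UNIV"
  using integral_mono[OF integrable_slope, of "\<lambda>_. C" n] slope_le
  by (simp add: energy_def sets_eq_imp_space_eq[OF sets_M] mult.commute)

lemma energy_nonneg: "0 \<le> energy n"
  by (simp add: energy_def slope_nonneg)

lemma has_integral_slope_mult:
  assumes "n \<le> m"
  shows "has_bochner_integral lborel (\<lambda>t. slope M m t * slope M n t) (energy n)"
proof (rule has_bochner_integral_nn_integral)
  have "(\<integral>\<^sup>+t. ennreal (slope M m t * slope M n t) \<partial>lborel) = (\<integral>\<^sup>+t. ennreal (slope M m t) * ennreal (slope M n t) \<partial>lborel)"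
    by (simp add: ennreal_mult slope_nonneg)
  also have "\<dots> = (\<integral>\<^sup>+t. ennreal (slope M n t) \<partial>M)"
    using nn_integral_slope[OF assms, of "\<lambda>k. ennreal (2 ^ n * measure M (dyadic_interval n k))"] by (simp add: slope_def)
  also have "\<dots> = ennreal (energy n)"
    unfolding energy_def by (rule nn_integral_eq_integral[OF integrable_slope]) (auto simp: slope_nonneg)
  finally show "(\<integral>\<^sup>+t. ennreal (slope M m t * slope M n t) \<partial>lborel) = ennreal (energy n)" .
qed (auto simp: slope_nonneg energy_nonneg)

text \<open>Orthogonality of martingale increments: the mixed term equals \<open>energy n\<close>,
  so squared L^2 distances are differences of an increasing bounded sequence.\<close>

lemma nn_integral_slope_diff:
  assumes "n \<le> m"
  shows "(\<integral>\<^sup>+t. ennreal ((slope M m t - slope M n t)\<^sup>2) \<partial>lborel) = ennreal (energy m - energy n)" "energy n \<le> energy m"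
proof -
  have "has_bochner_integral lborel (\<lambda>t. slope M m t * slope M m t - 2 * (slope M m t * slope M n t) + slope M n t * slope M n t)
    (energy m - 2 * energy n + energy n)"
    by (intro has_bochner_integral_add has_bochner_integral_diff has_bochner_integral_mult_right has_integral_slope_mult assms) auto
  then have *: "has_bochner_integral lborel (\<lambda>t. (slope M m t - slope M n t)\<^sup>2) (energy m - energy n)"
    by (simp add: power2_eq_square algebra_simps)
  show "(\<integral>\<^sup>+t. ennreal ((slope M m t - slope M n t)\<^sup>2) \<partial>lborel) = ennreal (energy m - energy n)"
    using * by (subst nn_integral_eq_integral) (auto simp: has_bochner_integral_iff)
  have "0 \<le> (\<integral>t. (slope M m t - slope M n t)\<^sup>2 \<partial>lborel)" by simp
  then have "0 \<le> energy m - energy n" unfolding has_bochner_integral_integral_eq[OF *] .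
  then show "energy n \<le> energy m" by simp
qed

text \<open>On an interval with endpoints in the grid of level n the slopes of finer levels
  integrate to the mass of M, and the bound C permits passage to the limit. Other endpoints are
  approximated from the right by grid points.\<close>

lemma density_slope_limit:
  assumes r: "strict_mono r" and b [measurable]: "b \<in> borel_measurable lborel"
    and lim: "AE t in lborel. (\<lambda>k. slope M (r k) t) \<longlonglongrightarrow> b t"
  shows "M = density lborel (\<lambda>t. ennreal (b t))"
proof (rule measure_eqI_Ioc[OF fin sets_M])
  define N where "N = density lborel (\<lambda>t. ennreal (b t))"
  have ae: "AE t in lborel. 0 \<le> b t \<and> b t \<le> C"
    using lim
  proof eventually_elim
    case (elim t)
    show ?case using LIMSEQ_le_const[OF elim] LIMSEQ_le_const2[OF elim] slope_nonneg slope_le by auto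
  qed
  have [measurable_cong]: "sets N = sets borel" by (simp add: N_def)
  have "emeasure N UNIV = (\<integral>\<^sup>+t. ennreal (b t) \<partial>lborel)"
    by (simp add: N_def emeasure_density)
  \<comment> \<open>Fatou: every slope has total mass that of M, so the limit density is
    integrable.\<close>
  also have "\<dots> = (\<integral>\<^sup>+t. liminf (\<lambda>k. ennreal (slope M (r k) t)) \<partial>lborel)"
    using lim
  proof (intro nn_integral_cong_AE, eventually_elim)
    case (elim t)
    from elim(2) have "(\<lambda>k. ennreal (slope M (r k) t)) \<longlonglongrightarrow> ennreal (b t)" by (rule tendsto_ennrealI)
    then show ?case by (simp add: lim_imp_Liminf)
  qed
  also have "\<dots> \<le> liminf (\<lambda>k. \<integral>\<^sup>+t. ennreal (slope M (r k) t) \<partial>lborel)"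
    by (rule nn_integral_liminf) simp
  also have "(\<lambda>k. \<integral>\<^sup>+t. ennreal (slope M (r k) t) \<partial>lborel) = (\<lambda>k. emeasure M UNIV)"
    using nn_integral_slope[OF order_refl, of _ "\<lambda>_. 1"] sets_eq_imp_space_eq[OF sets_M] by simp
  finally have "emeasure N UNIV \<le> emeasure M UNIV" by (simp add: Liminf_const)
  then have finN: "finite_measure N"
    by (intro finite_measureI) (auto simp: N_def emeasure_eq_measure top_unique)
  then show "finite_measure (density lborel (\<lambda>t. ennreal (b t)))" by (simp add: N_def)
  show "sets (density lborel (\<lambda>t. ennreal (b t))) = sets borel" by simp
  fix a c :: real assume ac: "a \<le> c"
  \<comment> \<open>x rounded up to the grid of level n.\<close>
  define p where "p = (\<lambda>x n. real_of_int (dyadic_index n x) / 2 ^ n)"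
  have p: "x \<le> p x n" "p x n < x + 1 / 2 ^ n" for x n
    using dyadic_index_eq_iff[of n x "dyadic_index n x"] by (auto simp: dyadic_interval_def p_def diff_divide_distrib)
  have p_lim: "(\<lambda>n. p x n) \<longlonglongrightarrow> x" for x
  proof (rule tendsto_sandwich[where f = "\<lambda>_. x" and h = "\<lambda>n. x + 1 / 2 ^ n"])
    have "(\<lambda>n. x + (1 / 2) ^ n) \<longlonglongrightarrow> x + 0" by (intro tendsto_intros LIMSEQ_power_zero) simp
    then show "(\<lambda>n. x + 1 / 2 ^ n) \<longlonglongrightarrow> x" by (simp add: power_one_over)
    show "\<forall>\<^sub>F n in sequentially. x \<le> p x n" using p(1) by simp
    show "\<forall>\<^sub>F n in sequentially. p x n \<le> x + 1 / 2 ^ n"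
      using p(2) by (simp add: less_imp_le)
  qed simp
  have ind: "(\<lambda>n. indicator {p a n<..p c n} t :: real) \<longlonglongrightarrow> indicator {a<..c} t" for t
  proof -
    consider "t \<le> a" | "a < t" "t \<le> c" | "c < t" by linarith
    then show ?thesis
    proof cases
      case 1
      then have "indicator {p a n<..p c n} t = (0::real)" for n using p(1)[of a n] by (simp add: indicator_def)
      then show ?thesis using 1 by simp
    next
      case 2
      have "\<forall>\<^sub>F n in sequentially. p a n < t" using order_tendstoD(2)[OF p_lim] 2 by simp
      then have "\<forall>\<^sub>F n in sequentially. indicator {p a n<..p c n} t = (1::real)"
        by eventually_elim (use p(1)[of c] 2 in \<open>auto simp: indicator_def intro: order_trans\<close>)
      then show ?thesis using 2 by (simp add: tendsto_eventually)
    next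
      case 3
      have "\<forall>\<^sub>F n in sequentially. p c n < t" using order_tendstoD(2)[OF p_lim] 3 by simp
      then have "\<forall>\<^sub>F n in sequentially. indicator {p a n<..p c n} t = (0::real)"
        by eventually_elim (auto simp: indicator_def)
      then show ?thesis using 3 by (simp add: tendsto_eventually)
    qed
  qed
  have approx: "(\<lambda>n. measure P {p a n<..p c n}) \<longlonglongrightarrow> measure P {a<..c}" if P: "finite_measure P" "sets P = sets borel" for P
  proof -
    interpret P: finite_measure P by (rule P)
    note [measurable_cong] = P(2)
    have "(\<lambda>n. \<integral>t. (indicator {p a n<..p c n} t :: real) \<partial>P) \<longlonglongrightarrow> (\<integral>t. indicator {a<..c} t \<partial>P)"
      by (rule integral_dominated_convergence[where w = "\<lambda>_. 1"]) (auto simp: ind)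
    then show ?thesis using sets_eq_imp_space_eq[OF P(2)] by simp
  qed
  have eq: "measure M {p a n<..p c n} = measure N {p a n<..p c n}" for n
  proof -
    define F where "F = (\<lambda>k. if dyadic_index n a < k \<and> k \<le> dyadic_index n c then 1 else 0 :: real)"
    have F: "indicator {p a n<..p c n} t = F (dyadic_index n t)" for t
    proof -
      have "i < dyadic_index n t \<longleftrightarrow> real_of_int i / 2 ^ n < t" for i
        by (simp add: dyadic_index_def less_ceiling_iff field_simps)
      moreover have "dyadic_index n t \<le> i \<longleftrightarrow> t \<le> real_of_int i / 2 ^ n" for i
        by (simp add: dyadic_index_def ceiling_le_iff field_simps)
      ultimately show ?thesis by (simp add: F_def p_def indicator_def)
    qed
    have const: "(\<integral>t. slope M m t * indicator {p a n<..p c n} t \<partial>lborel) = measure M {p a n<..p c n}" if "n \<le> m" for m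
    proof -
      have "(\<integral>\<^sup>+t. ennreal (slope M m t * indicator {p a n<..p c n} t) \<partial>lborel)
        = (\<integral>\<^sup>+t. ennreal (slope M m t) * ennreal (F (dyadic_index n t)) \<partial>lborel)"
        by (intro nn_integral_cong) (simp add: F[symmetric] ennreal_mult slope_nonneg)
      also have "\<dots> = (\<integral>\<^sup>+t. ennreal (F (dyadic_index n t)) \<partial>M)"
        by (rule nn_integral_slope[OF that])
      also have "\<dots> = (\<integral>\<^sup>+t. indicator {p a n<..p c n} t \<partial>M)"
        by (simp add: F[symmetric] ennreal_indicator)
      also have "\<dots> = ennreal (measure M {p a n<..p c n})" by (simp add: emeasure_eq_measure)
      finally have "has_bochner_integral lborel (\<lambda>t. slope M m t * indicator {p a n<..p c n} t) (measure M {p a n<..p c n})"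
        by (intro has_bochner_integral_nn_integral) (auto simp: slope_nonneg)
      then show ?thesis by (simp add: has_bochner_integral_iff)
    qed
    have "(\<lambda>k. \<integral>t. slope M (r k) t * indicator {p a n<..p c n} t \<partial>lborel) \<longlonglongrightarrow> (\<integral>t. b t * indicator {p a n<..p c n} t \<partial>lborel)"
    proof (rule integral_dominated_convergence[where w = "\<lambda>t. C * indicator {p a n<..p c n} t"])
      show "integrable lborel (\<lambda>t. C * indicator {p a n<..p c n} t)"
        by (cases "p a n \<le> p c n") (auto intro!: integrable_mult_right integrable_real_indicator)
      show "AE t in lborel. (\<lambda>k. slope M (r k) t * indicator {p a n<..p c n} t) \<longlonglongrightarrow> b t * indicator {p a n<..p c n} t"
        using lim by eventually_elim (intro tendsto_intros)
      show "AE t in lborel. norm (slope M (r k) t * indicator {p a n<..p c n} t) \<le> C * indicator {p a n<..p c n} t" for k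
        using slope_le slope_nonneg by (auto simp: indicator_def)
    qed auto
    moreover have "(\<lambda>k. \<integral>t. slope M (r k) t * indicator {p a n<..p c n} t \<partial>lborel) \<longlonglongrightarrow> measure M {p a n<..p c n}"
    proof (rule tendsto_eventually)
      show "\<forall>\<^sub>F k in sequentially. (\<integral>t. slope M (r k) t * indicator {p a n<..p c n} t \<partial>lborel) = measure M {p a n<..p c n}"
        using eventually_ge_at_top[of n]
        by eventually_elim (use seq_suble[OF r] in \<open>auto intro!: const intro: order_trans\<close>)
    qed
    ultimately have 1: "measure M {p a n<..p c n} = (\<integral>t. b t * indicator {p a n<..p c n} t \<partial>lborel)"
      using LIMSEQ_unique by blast
    have "measure N {p a n<..p c n} = (\<integral>t. indicator {p a n<..p c n} t \<partial>N)" by (simp add: N_def)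
    also have "\<dots> = (\<integral>t. b t * indicator {p a n<..p c n} t \<partial>lborel)"
      unfolding N_def using ae by (subst integral_density) auto
    finally show ?thesis using 1 by simp
  qed
  show "measure M {a<..c} = measure (density lborel (\<lambda>t. ennreal (b t))) {a<..c}"
    using LIMSEQ_unique[OF approx[OF fin sets_M, unfolded eq] approx[OF finN]] by (simp add: N_def)
qed

end

text \<open>The weight 2^k bounds the k-th increment by a multiple of 2^{-k/2}, so the increments
  are absolutely summable.\<close>

lemma convergent_if_geometric_squares:
  fixes d :: "nat \<Rightarrow> real"
  assumes "(\<Sum>k. ennreal (2 ^ k * (d (Suc k) - d k)\<^sup>2)) < \<infinity>"
  shows "convergent d"
proof -
  have s: "summable (\<lambda>k. 2 ^ k * (d (Suc k) - d k)\<^sup>2)"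
    by (rule summable_suminf_not_top) (use assms in \<open>auto simp: less_top\<close>)
  define S where "S = (\<Sum>k. 2 ^ k * (d (Suc k) - d k)\<^sup>2)"
  have bd: "norm (d (Suc k) - d k) \<le> sqrt S * (sqrt (1 / 2)) ^ k" for k
  proof -
    have "2 ^ k * (d (Suc k) - d k)\<^sup>2 \<le> S"
      unfolding S_def using sum_le_suminf[OF s, of "{k}"] by simp
    then have "(d (Suc k) - d k)\<^sup>2 \<le> S * (1 / 2) ^ k" by (simp add: field_simps power_one_over)
    then have "sqrt ((d (Suc k) - d k)\<^sup>2) \<le> sqrt (S * (1 / 2) ^ k)" by (rule real_sqrt_le_mono)
    then have "\<bar>d (Suc k) - d k\<bar> \<le> sqrt (S * (1 / 2) ^ k)" by (simp only: real_sqrt_abs)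
    then show ?thesis by (simp only: real_norm_def real_sqrt_mult real_sqrt_power)
  qed
  have "summable (\<lambda>k. sqrt S * (sqrt (1 / 2)) ^ k)"
    by (intro summable_mult summable_geometric) simp
  from summable_comparison_test'[OF this bd] have "summable (\<lambda>k. d (Suc k) - d k)" .
  then have "(\<lambda>n. \<Sum>k<n. d (Suc k) - d k) \<longlonglongrightarrow> (\<Sum>k. d (Suc k) - d k)" by (rule summable_LIMSEQ)
  then have "(\<lambda>n. d n - d 0) \<longlonglongrightarrow> (\<Sum>k. d (Suc k) - d k)" by (simp add: sum_lessThan_telescope)
  from tendsto_add[OF this tendsto_const[of "d 0"]] show ?thesis by (auto simp: convergent_def)
qed

text \<open>One subsequence serves countably many measures: it makes the weighted sum of the increasing
  bounded sequences \<open>energy\<close> converge geometrically.\<close>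

lemma slopes_converge_AE:
  fixes M :: "nat \<Rightarrow> real measure" and C :: "nat \<Rightarrow> real"
  assumes M: "\<And>j. finite_measure (M j)" "\<And>j. sets (M j) = sets borel"
    and lip: "\<And>j a b. a \<le> b \<Longrightarrow> measure (M j) {a<..b} \<le> C j * (b - a)"
  obtains r :: "nat \<Rightarrow> nat" where "strict_mono r" "AE t in lborel. \<forall>j. convergent (\<lambda>k. slope (M j) (r k) t)"
proof -
  define B where "B = (\<lambda>j. 1 + C j * measure (M j) UNIV)"
  define e where "e = (\<lambda>j n. energy (M j) n)"
  have C0: "0 \<le> C j" for j by (rule C_nonneg[OF M lip])
  have B: "B j \<ge> 1" for j using C0 by (simp add: B_def)
  have e0: "0 \<le> e j n" and e1: "e j n \<le> B j" and emono: "n \<le> m \<Longrightarrow> e j n \<le> e j m" for j n m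
    using energy_nonneg[OF M lip] energy_le[OF M lip] nn_integral_slope_diff(2)[OF M lip]
    by (auto simp: e_def B_def intro: order_trans[OF energy_le[OF M lip]])
  \<comment> \<open>Since \<open>e j n\<close> is at most \<open>B j\<close>, these weights dominate
    the series of energies by a geometric one, uniformly in n.\<close>
  define w where "w = (\<lambda>j. (1 / 2) ^ j / B j)"
  have w0: "w j > 0" for j using B[of j] by (simp add: w_def)
  have we: "w j * e j n \<le> (1 / 2) ^ j" for j n
  proof -
    have "w j * e j n \<le> w j * B j" using e1 w0[of j] by (intro mult_left_mono) auto
    then show ?thesis using B[of j] by (simp add: w_def)
  qed
  have geo: "summable (\<lambda>j. (1 / 2 :: real) ^ j)" by (rule summable_geometric) simp
  have sum: "summable (\<lambda>j. w j * e j n)" for n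
    by (rule summable_comparison_test'[OF geo]) (use we w0 e0 in \<open>auto simp: abs_mult less_imp_le\<close>)
  define V where "V = (\<lambda>n. \<Sum>j. w j * e j n)"
  have "incseq V" unfolding V_def incseq_def
    by (intro allI impI suminf_le sum mult_left_mono emono) (auto simp: w0 less_imp_le)
  moreover have "V n \<le> (\<Sum>j. (1 / 2) ^ j)" for n
    unfolding V_def by (intro suminf_le we sum geo)
  ultimately obtain L where "V \<longlonglongrightarrow> L" using incseq_convergent by blast
  then have "Cauchy V" by (rule LIMSEQ_imp_Cauchy)
  \<comment> \<open>The rate 4^{-k} leaves 2^{-k} after multiplication by the weight 2^k that
    pointwise convergence requires.\<close>
  then have ex: "\<exists>n. \<forall>m\<ge>n. V m - V n \<le> (1 / 4) ^ k" for k :: nat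
  proof -
    have "(1 / 4 :: real) ^ k > 0" by simp
    from CauchyD[OF \<open>Cauchy V\<close> this] obtain n where "\<And>m m'. m \<ge> n \<Longrightarrow> m' \<ge> n \<Longrightarrow> norm (V m - V m') < (1 / 4) ^ k" by blast
    then show ?thesis by (intro exI[of _ n]) (force simp: abs_less_iff)
  qed
  then obtain n where n: "\<And>k m. m \<ge> n k \<Longrightarrow> V m - V (n k) \<le> (1 / 4) ^ k" by metis
  \<comment> \<open>The maximum with \<open>Suc i\<close> makes the chosen levels strictly
    increasing.\<close>
  define r where "r = rec_nat (n 0) (\<lambda>k i. max (n (Suc k)) (Suc i))"
  have r_Suc: "r (Suc k) = max (n (Suc k)) (Suc (r k))" for k by (simp add: r_def)
  have r: "strict_mono r" unfolding strict_mono_Suc_iff by (simp add: r_Suc less_max_iff_disj)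
  have rn: "n k \<le> r k" for k by (cases k) (simp_all add: r_Suc r_def)
  have V: "V (r (Suc k)) - V (r k) \<le> (1 / 4) ^ k" for k
  proof -
    have "V (n k) \<le> V (r k)" using \<open>incseq V\<close> rn by (simp add: incseq_def)
    moreover have "n k \<le> r (Suc k)" using rn[of k] by (simp add: r_Suc)
    ultimately show ?thesis using n[of k "r (Suc k)"] by linarith
  qed
  have "AE t in lborel. convergent (\<lambda>k. slope (M j) (r k) t)" for j
  proof -
    define g where "g = (\<lambda>k t. 2 ^ k * (slope (M j) (r (Suc k)) t - slope (M j) (r k) t)\<^sup>2)"
    have gi: "(\<integral>\<^sup>+t. ennreal (g k t) \<partial>lborel) \<le> ennreal ((1 / w j) * (1 / 2) ^ k)" for k
    proof -
      have le: "r k \<le> r (Suc k)" by (simp add: r_Suc)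
      have inc: "w j * (e j (r (Suc k)) - e j (r k)) \<le> V (r (Suc k)) - V (r k)"
      proof -
        have "V (r (Suc k)) - V (r k) = (\<Sum>j. w j * e j (r (Suc k)) - w j * e j (r k))"
          unfolding V_def by (rule suminf_diff[OF sum sum])
        moreover have "w j * e j (r (Suc k)) - w j * e j (r k) \<le> (\<Sum>j. w j * e j (r (Suc k)) - w j * e j (r k))"
          using sum_le_suminf[OF summable_diff[OF sum sum], of "{j}" "r (Suc k)" "r k"] emono[OF le] w0
          by (simp add: mult_left_mono less_imp_le)
        ultimately show ?thesis by (simp add: algebra_simps)
      qed
      have "(\<integral>\<^sup>+t. ennreal (g k t) \<partial>lborel) = (\<integral>\<^sup>+t. ennreal (2 ^ k) * ennreal ((slope (M j) (r (Suc k)) t - slope (M j) (r k) t)\<^sup>2) \<partial>lborel)"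
        by (simp add: g_def ennreal_mult)
      also have "\<dots> = ennreal (2 ^ k) * ennreal (e j (r (Suc k)) - e j (r k))"
        unfolding e_def by (subst nn_integral_slope_diff(1)[OF M lip le, symmetric], assumption) (rule nn_integral_cmult, simp)
      also have "\<dots> = ennreal (2 ^ k * (e j (r (Suc k)) - e j (r k)))"
        using emono[OF le, of j] by (subst ennreal_mult) auto
      also have "\<dots> \<le> ennreal ((1 / w j) * (1 / 2) ^ k)"
      proof (rule ennreal_leI)
        have "e j (r (Suc k)) - e j (r k) \<le> (1 / w j) * (1 / 4) ^ k"
          using order_trans[OF inc V] w0[of j] by (simp add: field_simps)
        then have "2 ^ k * (e j (r (Suc k)) - e j (r k)) \<le> 2 ^ k * ((1 / w j) * (1 / 4) ^ k)"
          by (rule mult_left_mono) simp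
        also have "\<dots> = (1 / w j) * (2 ^ k * (1 / 4) ^ k)" by simp
        also have "2 ^ k * (1 / 4) ^ k = (1 / 2 :: real) ^ k" by (simp flip: power_mult_distrib)
        finally show "2 ^ k * (e j (r (Suc k)) - e j (r k)) \<le> (1 / w j) * (1 / 2) ^ k" .
      qed
      finally show ?thesis .
    qed
    have "(\<integral>\<^sup>+t. (\<Sum>k. ennreal (g k t)) \<partial>lborel) = (\<Sum>k. \<integral>\<^sup>+t. ennreal (g k t) \<partial>lborel)"
      unfolding g_def by (rule nn_integral_suminf) measurable
    also have "\<dots> \<le> (\<Sum>k. ennreal ((1 / w j) * (1 / 2) ^ k))" by (intro suminf_le gi) auto
    also have "\<dots> = ennreal (\<Sum>k. (1 / w j) * (1 / 2) ^ k)"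
      using w0[of j] by (intro suminf_ennreal2 summable_mult geo) (simp add: less_imp_le)
    also have "\<dots> < \<infinity>" by simp
    finally have "(\<integral>\<^sup>+t. (\<Sum>k. ennreal (g k t)) \<partial>lborel) \<noteq> \<infinity>" by simp
    then have "AE t in lborel. (\<Sum>k. ennreal (g k t)) \<noteq> \<infinity>"
      by (rule nn_integral_PInf_AE[rotated]) (simp add: g_def)
    then show ?thesis
      by eventually_elim (rule convergent_if_geometric_squares, simp add: g_def less_top)
  qed
  then have "AE t in lborel. \<forall>j. convergent (\<lambda>k. slope (M j) (r k) t)" by (simp add: AE_all_countable)
  with r show ?thesis by (rule that)
qed

section \<open>Orthonormal bases and positive operators\<close>

lemma onb_norm:
  assumes "is_onb B" "e \<in> B"
  shows "norm e = 1"
proof -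
  have "complex_of_real ((norm e)\<^sup>2) = cinner e e" by (simp only: cinner_self)
  also have "\<dots> = 1" using assms by (auto simp: is_onb_def)
  finally have "complex_of_real ((norm e)\<^sup>2) = 1" .
  then have "(norm e)\<^sup>2 = 1" by (metis of_real_eq_1_iff)
  then show ?thesis by (simp add: power2_eq_1_iff) (metis norm_ge_zero neg_0_le_iff_le not_one_le_zero)
qed

lemma onb_finite_expansion:
  assumes B: "is_onb B" and F: "finite F" "F \<subseteq> B"
  shows "(norm (x - (\<Sum>e\<in>F. cinner e x *\<^sub>C e)))\<^sup>2 = (norm x)\<^sup>2 - (\<Sum>e\<in>F. (cmod (cinner e x))\<^sup>2)"
proof -
  define p where "p = (\<Sum>e\<in>F. cinner e x *\<^sub>C e)"
  have coef: "cinner e p = cinner e x" if "e \<in> F" for e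
  proof -
    have "cinner e p = (\<Sum>e'\<in>F. cinner e' x * cinner e e')"
      by (simp add: p_def cinner_sum_right cinner_scaleC_right)
    also have "\<dots> = (\<Sum>e'\<in>F. if e' = e then cinner e x else 0)"
      using B F that by (intro sum.cong) (auto simp: is_onb_def subset_iff)
    finally show ?thesis using F that by (simp add: sum.delta)
  qed
  have sq: "cnj c * c = complex_of_real ((cmod c)\<^sup>2)" for c
    unfolding complex_norm_square by (rule mult.commute)
  have "cinner p p = (\<Sum>e\<in>F. cnj (cinner e x) * cinner e p)"
    by (subst (1) p_def) (simp add: cinner_sum_left cinner_scaleC_left)
  also have "\<dots> = (\<Sum>e\<in>F. complex_of_real ((cmod (cinner e x))\<^sup>2))"
    by (intro sum.cong refl) (simp only: coef sq)
  finally have pp: "(norm p)\<^sup>2 = (\<Sum>e\<in>F. (cmod (cinner e x))\<^sup>2)"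
    by (simp only: cinner_self of_real_sum[symmetric] of_real_eq_iff)
  have "cinner p x = (\<Sum>e\<in>F. cnj (cinner e x) * cinner e x)"
    by (simp add: p_def cinner_sum_left cinner_scaleC_left)
  then have "cinner p x = complex_of_real ((norm p)\<^sup>2)"
    unfolding pp of_real_sum by (simp only: sq)
  then have "Re (cinner x p) = (norm p)\<^sup>2"
    by (metis cinner_commute complex_cnj_complex_of_real Re_complex_of_real)
  then show ?thesis unfolding p_def[symmetric] norm_diff_sq pp[symmetric] by simp
qed

text \<open>The vectors with such approximations form a closed subspace containing B, and maximality
  of B leaves no nonzero vector orthogonal to it. Enlarging F never increases the error, which
  closes the set under sums.\<close>

lemma onb_finite_approx:
  assumes B: "is_onb B" and d: "d > 0"
  shows "\<exists>F. finite F \<and> F \<subseteq> B \<and> norm (x - (\<Sum>e\<in>F. cinner e x *\<^sub>C e)) < d"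
proof -
  define S where "S = (\<lambda>F (x::'a). \<Sum>e\<in>F. cinner e x *\<^sub>C e)"
  have S_add: "S F (x + y) = S F x + S F y" for F x y
    by (simp add: S_def cinner_add_right scaleC_add_left sum.distrib)
  have S_scale: "S F (c *\<^sub>C x) = c *\<^sub>C S F x" for F x c
    by (rule cinner_ext) (simp add: S_def cinner_sum_right cinner_scaleC_right sum_distrib_left mult_ac)
  have S_diff: "S F (x - y) = S F x - S F y" for F x y
    by (simp add: S_def cinner_diff_right scaleC_diff_left sum_subtractf)
  have le: "norm (x - S F x) \<le> norm x" if "finite F" "F \<subseteq> B" for F x
  proof (rule power2_le_imp_le)
    show "(norm (x - S F x))\<^sup>2 \<le> (norm x)\<^sup>2"
      unfolding S_def onb_finite_expansion[OF B that] by (simp add: sum_nonneg)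
  qed simp
  have mono: "norm (x - S F' x) \<le> norm (x - S F x)" if "finite F'" "F' \<subseteq> B" "F \<subseteq> F'" for F F' x
  proof (rule power2_le_imp_le)
    have "finite F" "F \<subseteq> B" using that finite_subset by auto
    then show "(norm (x - S F' x))\<^sup>2 \<le> (norm (x - S F x))\<^sup>2"
      unfolding S_def onb_finite_expansion[OF B that(1,2)] onb_finite_expansion[OF B \<open>finite F\<close> \<open>F \<subseteq> B\<close>]
      using sum_mono2[OF that(1,3), of "\<lambda>e. (cmod (cinner e x))\<^sup>2"] by simp
  qed simp
  define M where "M = {x. \<forall>d>0. \<exists>F. finite F \<and> F \<subseteq> B \<and> norm (x - S F x) < d}"
  have "M = UNIV"
  proof (rule closed_csubspace_eq_UNIV)
    show "csubspace M" unfolding csubspace_def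
    proof (intro conjI ballI allI)
      show "0 \<in> M" unfolding M_def by (auto simp: S_def intro!: exI[of _ "{}"])
    next
      fix x y assume x: "x \<in> M" and y: "y \<in> M"
      show "x + y \<in> M" unfolding M_def
      proof (intro CollectI allI impI)
        fix d :: real assume "d > 0"
        then have "d / 2 > 0" by simp
        then obtain F F' where F: "finite F" "F \<subseteq> B" "norm (x - S F x) < d / 2" "finite F'" "F' \<subseteq> B" "norm (y - S F' y) < d / 2"
          using x y unfolding M_def by blast
        have "norm ((x - S (F \<union> F') x) + (y - S (F \<union> F') y)) < d"
          using norm_triangle_ineq[of "x - S (F \<union> F') x" "y - S (F \<union> F') y"] mono[of "F \<union> F'" F x] mono[of "F \<union> F'" F' y] F by auto
        then show "\<exists>F. finite F \<and> F \<subseteq> B \<and> norm (x + y - S F (x + y)) < d"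
          using F by (intro exI[of _ "F \<union> F'"]) (simp add: S_add add_diff_add)
      qed
    next
      fix c x assume x: "x \<in> M"
      show "c *\<^sub>C x \<in> M" unfolding M_def
      proof (intro CollectI allI impI)
        fix d :: real assume d: "d > 0"
        have "d / (cmod c + 1) > 0" using d by (intro divide_pos_pos add_nonneg_pos) auto
        then obtain F where F: "finite F" "F \<subseteq> B" "norm (x - S F x) < d / (cmod c + 1)"
          using x unfolding M_def by blast
        have p: "cmod c + 1 > 0" by (simp add: add_nonneg_pos)
        have "norm (c *\<^sub>C x - S F (c *\<^sub>C x)) = cmod c * norm (x - S F x)"
          by (simp add: S_scale norm_scaleC flip: scaleC_diff_right)
        also have "\<dots> \<le> (cmod c + 1) * norm (x - S F x)" by (intro mult_right_mono) auto
        also have "\<dots> < d" using F(3) p by (simp add: field_simps)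
        finally show "\<exists>F. finite F \<and> F \<subseteq> B \<and> norm (c *\<^sub>C x - S F (c *\<^sub>C x)) < d" using F by blast
      qed
    qed
    show "closed M" unfolding closed_sequential_limits
    proof (intro allI impI, elim conjE)
      fix u x assume u: "\<forall>n. u n \<in> M" "u \<longlonglongrightarrow> x"
      show "x \<in> M" unfolding M_def
      proof (intro CollectI allI impI)
        fix d :: real assume "d > 0"
        then have d: "d / 2 > 0" by simp
        obtain n where n: "norm (u n - x) < d / 2" using LIMSEQ_D[OF u(2) d] by blast
        obtain F where F: "finite F" "F \<subseteq> B" "norm (u n - S F (u n)) < d / 2" using u(1) d unfolding M_def by blast
        have "x - S F x = ((x - u n) - S F (x - u n)) + (u n - S F (u n))" by (simp add: S_diff)
        then have "norm (x - S F x) \<le> norm ((x - u n) - S F (x - u n)) + norm (u n - S F (u n))"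
          by (simp only: norm_triangle_ineq)
        also have "\<dots> \<le> norm (x - u n) + norm (u n - S F (u n))"
          by (rule add_right_mono[OF le[OF F(1,2)]])
        also have "\<dots> < d" using n F(3) by (simp add: norm_minus_commute)
        finally show "\<exists>F. finite F \<and> F \<subseteq> B \<and> norm (x - S F x) < d" using F by blast
      qed
    qed
    show "y = 0" if y: "\<And>u. u \<in> M \<Longrightarrow> cinner y u = 0" for y
    proof -
      have "e \<in> M" if e: "e \<in> B" for e
        unfolding M_def S_def using B e
        by (auto simp: is_onb_def intro!: exI[of _ "{e}"])
      then have "cinner e y = 0" if "e \<in> B" for e using y that by (metis cinner_commute complex_cnj_zero)
      then show ?thesis using B unfolding is_onb_def by blast
    qed
  qed
  then show ?thesis using d unfolding M_def S_def by blast
qed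

lemma onb_Parseval:
  assumes B: "is_onb B"
  shows "((\<lambda>e. (cmod (cinner e x))\<^sup>2) has_sum (norm x)\<^sup>2) B"
  unfolding has_sum_def
proof (rule tendstoI)
  fix d :: real assume "d > 0"
  then have "sqrt d > 0" by simp
  then obtain F where F: "finite F" "F \<subseteq> B" "norm (x - (\<Sum>e\<in>F. cinner e x *\<^sub>C e)) < sqrt d"
    using onb_finite_approx[OF B] by blast
  have "(norm (x - (\<Sum>e\<in>F. cinner e x *\<^sub>C e)))\<^sup>2 < (sqrt d)\<^sup>2" using F(3) by (intro power_strict_mono) auto
  then have "(norm x)\<^sup>2 - (\<Sum>e\<in>F. (cmod (cinner e x))\<^sup>2) < d"
    using onb_finite_expansion[OF B F(1,2), of x] \<open>d > 0\<close> by simp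
  note low = this
  have close: "dist (\<Sum>e\<in>F'. (cmod (cinner e x))\<^sup>2) ((norm x)\<^sup>2) < d" if "finite F'" "F \<subseteq> F'" "F' \<subseteq> B" for F'
  proof -
    have "(\<Sum>e\<in>F. (cmod (cinner e x))\<^sup>2) \<le> (\<Sum>e\<in>F'. (cmod (cinner e x))\<^sup>2)"
      by (rule sum_mono2[OF that(1,2)]) simp
    moreover have "0 \<le> (norm (x - (\<Sum>e\<in>F'. cinner e x *\<^sub>C e)))\<^sup>2" by simp
    ultimately show ?thesis
      using low unfolding onb_finite_expansion[OF B that(1,3)] dist_real_def by linarith
  qed
  show "\<forall>\<^sub>F F in finite_subsets_at_top B. dist (\<Sum>e\<in>F. (cmod (cinner e x))\<^sup>2) ((norm x)\<^sup>2) < d"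
    unfolding eventually_finite_subsets_at_top
    by (rule exI[of _ F]) (use F(1,2) close in blast)
qed

text \<open>The double sum of squared matrix coefficients can be read by rows or by columns, which
  moves summability for T on one basis to \<open>adj T\<close> on any other. Doing this twice
  returns to K on the given basis.\<close>

lemma hilbert_schmidt_onb:
  assumes K: "hilbert_schmidt K" and B: "is_onb B"
  shows "(\<lambda>e. (norm (blinfun_apply K e))\<^sup>2) summable_on B"
proof -
  have transfer: "(\<lambda>e. (norm (blinfun_apply (adj T) e))\<^sup>2) summable_on B2"
    if T: "clinear_op T" and B1: "is_onb B1" and B2: "is_onb B2" and s: "(\<lambda>e. (norm (blinfun_apply T e))\<^sup>2) summable_on B1" for T :: "'a \<Rightarrow>\<^sub>L 'a" and B1 B2
  proof -
    define f where "f = (\<lambda>(e, e'). (cmod (cinner e' (blinfun_apply T e)))\<^sup>2)"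
    have "f summable_on Sigma B1 (\<lambda>_. B2)"
    proof (rule summable_on_SigmaI)
      show "((\<lambda>e'. f (e, e')) has_sum (norm (blinfun_apply T e))\<^sup>2) B2" for e
        using onb_Parseval[OF B2, of "blinfun_apply T e"] by (simp add: f_def)
    qed (use s in \<open>auto simp: f_def\<close>)
    then have "(\<lambda>(e', e). f (e, e')) summable_on (B2 \<times> B1)"
      by (subst summable_on_swap) (simp add: case_prod_beta f_def)
    then have "(\<lambda>e'. infsum (\<lambda>e. f (e, e')) B1) summable_on B2"
      by (rule summable_on_Sigma_banach)
    moreover have "infsum (\<lambda>e. f (e, e')) B1 = (norm (blinfun_apply (adj T) e'))\<^sup>2" for e'
    proof -
      have "f (e, e') = (cmod (cinner e (blinfun_apply (adj T) e')))\<^sup>2" for e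
        by (simp add: f_def cinner_adj_right[OF T]) (metis cinner_commute complex_mod_cnj)
      then show ?thesis using infsumI[OF onb_Parseval[OF B1, of "blinfun_apply (adj T) e'"]] by simp
    qed
    ultimately show ?thesis by simp
  qed
  obtain B1 where B1: "is_onb B1" "(\<lambda>e. (norm (blinfun_apply K e))\<^sup>2) summable_on B1" and cl: "clinear_op K"
    using K by (auto simp: hilbert_schmidt_def)
  have "adj (adj K) = K" by (rule adj_eqI[OF clinear_adj[OF cl] cinner_adj_left[OF cl]])
  then show ?thesis
    using transfer[OF clinear_adj[OF cl] B B transfer[OF cl B1(1) B B1(2)]] by simp
qed

text \<open>Distinct basis vectors are at distance sqrt 2, so picking a point of a countable dense
  set within 1/2 of each is injective.\<close>

lemma onb_countable:
  fixes B :: "'a::{complex_hilbert, second_countable_topology} set"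
  assumes B: "is_onb B"
  shows "countable B"
proof -
  obtain S :: "'a set" where S: "countable S" "\<And>U. open U \<Longrightarrow> U \<noteq> {} \<Longrightarrow> \<exists>s\<in>S. s \<in> U"
    using countable_dense_setE by metis
  have "\<exists>s\<in>S. dist e s < 1 / 2" for e
  proof -
    have "ball e (1 / 2) \<noteq> {}" by simp
    from S(2)[OF open_ball this] show ?thesis by simp
  qed
  then obtain g where g: "\<And>e. g e \<in> S" "\<And>e. dist e (g e) < 1 / 2" by metis
  have "inj_on g B"
  proof (rule inj_onI, rule ccontr)
    fix e e' assume e: "e \<in> B" "e' \<in> B" "g e = g e'" "e \<noteq> e'"
    have "(norm (e - e'))\<^sup>2 = 2"
      using B e onb_norm[OF B e(1)] onb_norm[OF B e(2)] by (simp add: norm_diff_sq is_onb_def)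
    moreover have "norm (e - e') < 1"
      using g(2)[of e] g(2)[of e'] dist_triangle_less_add[of e "g e" "1 / 2" e' "1 / 2"] e(3) by (simp add: dist_norm norm_minus_commute)
    then have "(norm (e - e'))\<^sup>2 < 1\<^sup>2" by (intro power_strict_mono) auto
    ultimately show False by simp
  qed
  moreover have "countable (g ` B)" using countable_subset[OF _ S(1)] g(1) by blast
  ultimately show ?thesis using countable_image_inj_on by blast
qed

section \<open>Nonnegative operators and uniqueness of their square roots\<close>

lemma op_nonneg_symmetric:
  assumes "op_nonneg P"
  shows "cinner (blinfun_apply P x) y = cinner x (blinfun_apply P y)"
proof -
  have P: "clinear_op P" using assms by (simp add: op_nonneg_def)
  have "cinner x (blinfun_apply P x) \<in> \<real>" for x using assms nonneg_Reals_subset_Reals by (auto simp: op_nonneg_def)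
  from sesquilinear_hermitian[OF sesquilinear_op[OF P] this]
  show ?thesis by (metis cinner_commute complex_cnj_cnj)
qed

lemma op_nonneg_Re: "op_nonneg P \<Longrightarrow> cinner x (blinfun_apply P x) = complex_of_real (Re (cinner x (blinfun_apply P x)))"
  and op_nonneg_Re_ge: "op_nonneg P \<Longrightarrow> 0 \<le> Re (cinner x (blinfun_apply P x))"
  by (auto simp: op_nonneg_def complex_nonneg_Reals_iff complex_eq_iff)

text \<open>The form bound at x + u and x - u, with u parallel to T x and as long as x, controls <u,
  T x>.\<close>

lemma norm_symmetric_le:
  assumes sym: "\<And>x y. cinner (blinfun_apply T x) y = cinner x (blinfun_apply T y)"
    and c: "0 \<le> c" "\<And>x. \<bar>Re (cinner x (blinfun_apply T x))\<bar> \<le> c * (norm x)\<^sup>2"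
  shows "norm T \<le> c"
proof (rule norm_blinfun_bound[OF c(1)])
  fix x
  define y where "y = blinfun_apply T x"
  show "norm (blinfun_apply T x) \<le> c * norm x"
  proof (cases "x = 0 \<or> y = 0")
    case False
    define t where "t = norm x / norm y"
    define u where "u = t *\<^sub>R y"
    have nu: "norm u = norm x" using False by (simp add: u_def t_def)
    have "4 * Re (cinner u (blinfun_apply T x)) =
      Re (cinner (x + u) (blinfun_apply T (x + u))) - Re (cinner (x - u) (blinfun_apply T (x - u)))"
    proof -
      have "Re (cinner x (blinfun_apply T u)) = Re (cinner u (blinfun_apply T x))"
        by (metis sym cinner_commute cnj.simps(1))
      then show ?thesis by (simp add: blinfun.add_right blinfun.diff_right cinner_simps)
    qed
    also have "\<dots> \<le> c * (norm (x + u))\<^sup>2 + c * (norm (x - u))\<^sup>2"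
      using c(2)[of "x + u"] c(2)[of "x - u"] by linarith
    also have "\<dots> = 4 * c * (norm x)\<^sup>2"
      unfolding norm_add_sq norm_diff_sq nu by (simp add: algebra_simps)
    finally have "Re (cinner u y) \<le> c * (norm x)\<^sup>2" by (simp add: y_def)
    moreover have "Re (cinner u y) = norm x * norm y"
      using False by (simp add: u_def cinner_scaleR_left Re_cinner_self t_def power2_eq_square)
    ultimately show ?thesis using False by (simp add: power2_eq_square y_def mult.left_commute)
  qed (use c(1) in \<open>auto simp: y_def blinfun.zero_right\<close>)
qed

text \<open>With \<open>D = P - Q\<close> and \<open>S = P + Q\<close> one has \<open>D S + S D = 0\<close>. On an approximate eigenvector of \<open>D\<close> for an
  eigenvalue \<open>d\<close> of modulus \<open>\<parallel>D\<parallel>\<close> the form of \<open>S\<close> is therefore small, but it dominates \<open>\<bar>d\<bar>\<close>.\<close>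

lemma positive_sqrt_unique:
  assumes P: "op_nonneg P" and Q: "op_nonneg Q" and eq: "P o\<^sub>L P = Q o\<^sub>L Q"
  shows "P = Q"
proof (rule ccontr)
  assume "P \<noteq> Q"
  define D where "D = P - Q"
  define S where "S = P + Q"
  define m where "m = norm D"
  define \<sigma> where "\<sigma> = (norm S)\<^sup>2"
  have m: "m > 0" using \<open>P \<noteq> Q\<close> by (simp add: m_def D_def)
  have \<sigma>: "\<sigma> \<ge> 0" by (simp add: \<sigma>_def)
  note symP = op_nonneg_symmetric[OF P] and symQ = op_nonneg_symmetric[OF Q]
  have symD: "cinner (blinfun_apply D x) y = cinner x (blinfun_apply D y)" for x y
    by (simp add: D_def blinfun.diff_left cinner_simps symP symQ)
  have eq': "blinfun_apply P (blinfun_apply P x) = blinfun_apply Q (blinfun_apply Q x)" for x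
    using arg_cong[OF eq, of "\<lambda>T. blinfun_apply T x"] by simp
  have DS: "Re (cinner (blinfun_apply D x) (blinfun_apply S x)) = 0" for x
  proof -
    have sPQ: "Re (cinner (blinfun_apply Q x) (blinfun_apply P x)) = Re (cinner (blinfun_apply P x) (blinfun_apply Q x))"
      by (metis cinner_commute cnj.simps(1))
    have "cinner (blinfun_apply P x) (blinfun_apply P x) = cinner (blinfun_apply Q x) (blinfun_apply Q x)"
      by (simp add: symP symQ eq')
    then show ?thesis using sPQ by (simp add: D_def S_def blinfun.diff_left blinfun.add_left cinner_simps)
  qed
  \<comment> \<open>A bound for d^2 strictly below m^2. The second entry is what d^2 (d^2 +
    \<sigma>) <= m^2 \<sigma> yields once d^2 > m^2 / 2; the first covers the remaining
    case.\<close>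
  define c where "c = m\<^sup>2 * max (1 / 2) (\<sigma> / (\<sigma> + m\<^sup>2 / 2))"
  have m2: "m\<^sup>2 > 0" using m by simp
  have c: "0 \<le> c" "c < m\<^sup>2"
  proof -
    have p: "\<sigma> + m\<^sup>2 / 2 > 0" using \<sigma> m2 by linarith
    have "\<sigma> / (\<sigma> + m\<^sup>2 / 2) < 1" unfolding divide_less_eq_1_pos[OF p] using m2 by simp
    then have "max (1 / 2) (\<sigma> / (\<sigma> + m\<^sup>2 / 2)) < 1" by simp
    from mult_strict_left_mono[OF this m2] show "c < m\<^sup>2" by (simp add: c_def)
    show "0 \<le> c" by (simp add: c_def)
  qed
  have unit: "(Re (cinner x (blinfun_apply D x)))\<^sup>2 \<le> c" if x: "norm x = 1" for x
  proof -
    define d where "d = Re (cinner x (blinfun_apply D x))"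
    have "cinner (blinfun_apply D x) x = cnj (cinner x (blinfun_apply D x))" by (rule cinner_commute)
    then have Im: "Im (cinner x (blinfun_apply D x)) = 0" using symD[of x x] by (simp add: complex_eq_iff)
    \<comment> \<open>The defect of x from being an eigenvector; it is small when |d| is close to
      m.\<close>
    define v where "v = blinfun_apply D x - d *\<^sub>R x"
    have "(norm v)\<^sup>2 = (norm (blinfun_apply D x))\<^sup>2 - 2 * d * d + d\<^sup>2"
      unfolding v_def norm_diff_sq using symD[of x x] by (simp add: cinner_scaleR_right d_def x power2_eq_square)
    also have "\<dots> \<le> m\<^sup>2 - d\<^sup>2"
      using power_mono[OF norm_blinfun[of D x], of 2] x by (simp add: m_def power2_eq_square)
    finally have v: "(norm v)\<^sup>2 \<le> m\<^sup>2 - d\<^sup>2" .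
    define q where "q = Re (cinner x (blinfun_apply S x))"
    have dq: "\<bar>d\<bar> \<le> q"
      using op_nonneg_Re_ge[OF P, of x] op_nonneg_Re_ge[OF Q, of x]
      by (simp add: d_def q_def D_def S_def blinfun.diff_left blinfun.add_left cinner_simps)
    have "0 = Re (cinner (v + d *\<^sub>R x) (blinfun_apply S x))" using DS[of x] by (simp add: v_def)
    then have "\<bar>d * q\<bar> = \<bar>Re (cinner v (blinfun_apply S x))\<bar>"
      by (simp add: cinner_simps q_def abs_eq_iff)
    also have "\<dots> \<le> norm v * norm (blinfun_apply S x)"
      using abs_Re_le_cmod cinner_Cauchy_Schwarz order_trans by blast
    also have "\<dots> \<le> norm v * norm S" using norm_blinfun[of S x] x by (intro mult_left_mono) auto
    finally have "\<bar>d * q\<bar> \<le> norm v * norm S" .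
    moreover have "d\<^sup>2 \<le> \<bar>d * q\<bar>"
      using mult_left_mono[OF dq, of "\<bar>d\<bar>"] dq by (simp add: abs_mult power2_eq_square)
    ultimately have "d\<^sup>2 \<le> norm v * norm S" by linarith
    then have "(d\<^sup>2)\<^sup>2 \<le> (norm v * norm S)\<^sup>2" by (intro power_mono) auto
    also have "\<dots> = (norm v)\<^sup>2 * \<sigma>" by (simp add: power_mult_distrib \<sigma>_def)
    also have "\<dots> \<le> (m\<^sup>2 - d\<^sup>2) * \<sigma>" using v \<sigma> by (rule mult_right_mono)
    finally have main: "d\<^sup>2 * (d\<^sup>2 + \<sigma>) \<le> m\<^sup>2 * \<sigma>" by (simp add: algebra_simps power2_eq_square)
    have "d\<^sup>2 \<le> c"
    proof (cases "d\<^sup>2 \<le> m\<^sup>2 / 2")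
      case True
      have "m\<^sup>2 * (1 / 2) \<le> c" unfolding c_def by (intro mult_left_mono) auto
      then show ?thesis using True by simp
    next
      case False
      have p: "\<sigma> + m\<^sup>2 / 2 > 0" using \<sigma> m2 by linarith
      have "d\<^sup>2 * (\<sigma> + m\<^sup>2 / 2) \<le> d\<^sup>2 * (d\<^sup>2 + \<sigma>)" using False by (intro mult_left_mono) auto
      then have "d\<^sup>2 \<le> m\<^sup>2 * (\<sigma> / (\<sigma> + m\<^sup>2 / 2))" using main p by (simp add: field_simps)
      also have "\<dots> \<le> c" unfolding c_def by (intro mult_left_mono) auto
      finally show ?thesis .
    qed
    then show ?thesis by (simp add: d_def)
  qed
  have "norm D \<le> sqrt c"
  proof (rule norm_symmetric_le[OF symD])
    show "0 \<le> sqrt c" using c by simp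
    fix x
    show "\<bar>Re (cinner x (blinfun_apply D x))\<bar> \<le> sqrt c * (norm x)\<^sup>2"
    proof (cases "x = 0")
      case False
      define y where "y = (1 / norm x) *\<^sub>R x"
      have "norm y = 1" using False by (simp add: y_def)
      from unit[OF this] have "\<bar>Re (cinner y (blinfun_apply D y))\<bar> \<le> sqrt c" by (simp add: real_le_rsqrt real_le_lsqrt flip: real_sqrt_abs)
      moreover have "Re (cinner y (blinfun_apply D y)) = Re (cinner x (blinfun_apply D x)) / (norm x)\<^sup>2"
        by (simp add: y_def blinfun.scaleR_right cinner_simps power2_eq_square)
      ultimately show ?thesis using False by (simp add: field_simps)
    qed simp
  qed
  then have "m\<^sup>2 \<le> (sqrt c)\<^sup>2" unfolding m_def by (intro power_mono) auto
  then show False using c by simp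
qed

text \<open>For a nonnegative operator the absolute value disappears from trace class and trace
  norm, which leaves sums of its diagonal entries.\<close>

lemma op_abs_nonneg:
  assumes "op_nonneg P"
  shows "op_abs P = P"
  unfolding op_abs_def
proof (rule the_equality)
  have "clinear_op P" using assms by (simp add: op_nonneg_def)
  from adj_eqI[OF this op_nonneg_symmetric[OF assms]] have adj: "adj P = P" by simp
  then show "op_nonneg P \<and> P o\<^sub>L P = adj P o\<^sub>L P" using assms by simp
  show "Q = P" if "op_nonneg Q \<and> Q o\<^sub>L Q = adj P o\<^sub>L P" for Q
    using that positive_sqrt_unique[OF _ assms, of Q] by (simp add: adj)
qed

section \<open>The averaged spectral measure\<close>

text \<open>Completeness of Lebesgue measure. It serves the trace norm, whose value at
  \<open>\<Xi> l\<close> is computed only for almost every l.\<close>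

lemma borel_measurable_lebesgue_AE:
  fixes f g :: "real \<Rightarrow> 'b::topological_space"
  assumes f: "f \<in> borel_measurable lebesgue" and ae: "AE x in lebesgue. f x = g x"
  shows "g \<in> borel_measurable lebesgue"
proof (rule measurableI)
  fix A :: "'b set" assume A: "A \<in> sets borel"
  have ae': "AE x in lborel. f x = g x" using ae by (simp add: AE_completion_iff)
  have 1: "{x \<in> space lebesgue. f x \<noteq> g x \<and> h x \<in> A} \<in> sets lebesgue" for h
  proof -
    have "AE x in lborel. \<not> (f x \<noteq> g x \<and> h x \<in> A)" using ae' by eventually_elim simp
    from sets_completion_AE[OF this] show ?thesis by (simp add: pred_def)
  qed
  have "g -` A \<inter> space lebesgue = (f -` A \<inter> space lebesgue - {x \<in> space lebesgue. f x \<noteq> g x \<and> f x \<in> A})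
    \<union> {x \<in> space lebesgue. f x \<noteq> g x \<and> g x \<in> A}" by auto
  then show "g -` A \<inter> space lebesgue \<in> sets lebesgue"
    using measurable_sets[OF f A] 1[of f] 1[of g] by (simp add: sets.Diff sets.Un)
qed simp

lemma sesquilinear_integral:
  fixes B :: "'s \<Rightarrow> 'a::complex_hilbert \<Rightarrow> 'a \<Rightarrow> complex"
  assumes B: "\<And>s. s \<in> space S \<Longrightarrow> sesquilinear (B s)" and int: "\<And>f g. integrable S (\<lambda>s. B s f g)"
  shows "sesquilinear (\<lambda>f g. \<integral>s. B s f g \<partial>S)"
proof (rule sesquilinearI)
  fix x y z :: 'a and c :: complex
  have "(\<integral>s. B s (x + y) z \<partial>S) = (\<integral>s. B s x z + B s y z \<partial>S)"
    by (intro Bochner_Integration.integral_cong refl) (simp add: sesquilinearD(1)[OF B])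
  then show "(\<integral>s. B s (x + y) z \<partial>S) = (\<integral>s. B s x z \<partial>S) + (\<integral>s. B s y z \<partial>S)" using int by simp
  have "(\<integral>s. B s x (y + z) \<partial>S) = (\<integral>s. B s x y + B s x z \<partial>S)"
    by (intro Bochner_Integration.integral_cong refl) (simp add: sesquilinearD(2)[OF B])
  then show "(\<integral>s. B s x (y + z) \<partial>S) = (\<integral>s. B s x y \<partial>S) + (\<integral>s. B s x z \<partial>S)" using int by simp
  have "(\<integral>s. B s (c *\<^sub>C x) y \<partial>S) = (\<integral>s. cnj c * B s x y \<partial>S)"
    by (intro Bochner_Integration.integral_cong refl) (simp add: sesquilinearD(3)[OF B])
  then show "(\<integral>s. B s (c *\<^sub>C x) y \<partial>S) = cnj c * (\<integral>s. B s x y \<partial>S)" by simp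
  have "(\<integral>s. B s x (c *\<^sub>C y) \<partial>S) = (\<integral>s. c * B s x y \<partial>S)"
    by (intro Bochner_Integration.integral_cong refl) (simp add: sesquilinearD(4)[OF B])
  then show "(\<integral>s. B s x (c *\<^sub>C y) \<partial>S) = c * (\<integral>s. B s x y \<partial>S)" by simp
qed

text \<open>Cauchy-Schwarz bounds the forms uniformly, so convergence on the dense set extends to
  all vectors; the limit form is bounded and thus represented by an operator.\<close>

lemma form_limit_op:
  fixes B :: "nat \<Rightarrow> 'a::complex_hilbert \<Rightarrow> 'a \<Rightarrow> complex"
  assumes B: "\<And>k. sesquilinear (B k)" and pos: "\<And>k x. B k x x \<in> \<real>\<^sub>\<ge>\<^sub>0" and le: "\<And>k x. Re (B k x x) \<le> (norm x)\<^sup>2"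
    and dense: "\<And>x e. e > 0 \<Longrightarrow> \<exists>u\<in>U. norm (x - u) < e"
    and conv: "\<And>u v. u \<in> U \<Longrightarrow> v \<in> U \<Longrightarrow> convergent (\<lambda>k. B k u v)"
  shows "\<exists>T. op_nonneg T \<and> op_nonneg (id_blinfun - T) \<and> (\<forall>x y. (\<lambda>k. B k x y) \<longlonglongrightarrow> cinner x (blinfun_apply T y))"
proof -
  have bd: "cmod (B k x y) \<le> norm x * norm y" for k x y
  proof -
    have nn: "0 \<le> Re (B k x x)" for x using pos[of k x] by (simp add: complex_nonneg_Reals_iff)
    have "(cmod (B k x y))\<^sup>2 \<le> Re (B k x x) * Re (B k y y)" by (rule sesquilinear_Cauchy_Schwarz[OF B pos])
    also have "\<dots> \<le> (norm x)\<^sup>2 * (norm y)\<^sup>2" by (intro mult_mono le nn) auto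
    finally have "(cmod (B k x y))\<^sup>2 \<le> (norm x * norm y)\<^sup>2" by (simp add: power_mult_distrib)
    then show ?thesis by (rule power2_le_imp_le) simp
  qed
  have conv2: "convergent (\<lambda>k. B k x y)" for x y
  proof -
    have "Cauchy (\<lambda>k. B k x y)"
    proof (rule CauchyI)
      fix e :: real assume e: "e > 0"
      define c where "c = norm x + norm y + 1"
      \<comment> \<open>The 1 keeps ||u|| <= ||x|| + 1; the quotient makes the two approximation
        errors, each at most d c, at most e / 2 together.\<close>
      define d where "d = min 1 (e / (4 * c))"
      have c: "c > 0" unfolding c_def by (intro add_nonneg_pos add_nonneg_nonneg) auto
      have d: "d > 0" using e c by (simp add: d_def)
      have dc: "d * (2 * c) \<le> e / 2"
      proof -
        have "d * (2 * c) \<le> (e / (4 * c)) * (2 * c)" using c by (intro mult_right_mono) (auto simp: d_def)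
        then show ?thesis using c by simp
      qed
      obtain u v where u: "u \<in> U" "norm (x - u) < d" and v: "v \<in> U" "norm (y - v) < d"
        using dense[OF d] by blast
      have close: "cmod (B k x y - B k u v) \<le> d * c" for k
      proof -
        have "B k x y - B k u v = B k (x - u) y + B k u (y - v)" by (simp add: sesquilinearD[OF B])
        then have "cmod (B k x y - B k u v) \<le> norm (x - u) * norm y + norm u * norm (y - v)"
          using norm_triangle_ineq[of "B k (x - u) y" "B k u (y - v)"] bd[of k "x - u" y] bd[of k u "y - v"] by simp
        also have "\<dots> \<le> d * norm y + (norm x + 1) * d"
        proof (intro add_mono mult_mono)
          have "norm u \<le> norm x + norm (x - u)" using norm_triangle_ineq4[of x "x - u"] by simp
          then show "norm u \<le> norm x + 1" using u(2) by (simp add: d_def)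
        qed (use u v d in auto)
        also have "\<dots> = d * c" by (simp add: c_def algebra_simps)
        finally show ?thesis .
      qed
      have "Cauchy (\<lambda>k. B k u v)" using conv[OF u(1) v(1)] by (rule convergent_Cauchy)
      from CauchyD[OF this, of "e / 2"] e obtain n where n: "\<And>k l. k \<ge> n \<Longrightarrow> l \<ge> n \<Longrightarrow> cmod (B k u v - B l u v) < e / 2" by auto
      show "\<exists>n. \<forall>k\<ge>n. \<forall>l\<ge>n. norm (B k x y - B l x y) < e"
      proof (intro exI[of _ n] allI impI)
        fix k l assume kl: "k \<ge> n" "l \<ge> n"
        have "B k x y - B l x y = (B k x y - B k u v) - (B l x y - B l u v) + (B k u v - B l u v)" by simp
        then have "cmod (B k x y - B l x y) \<le> cmod (B k x y - B k u v) + cmod (B l x y - B l u v) + cmod (B k u v - B l u v)"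
          by (metis norm_triangle_ineq norm_triangle_ineq4 add_right_mono order_trans)
        then show "norm (B k x y - B l x y) < e"
          using close[of k] close[of l] n[OF kl] dc by linarith
      qed
    qed
    then show ?thesis by (rule Cauchy_convergent)
  qed
  define b where "b = (\<lambda>x y. lim (\<lambda>k. B k x y))"
  have b: "(\<lambda>k. B k x y) \<longlonglongrightarrow> b x y" for x y
    using conv2[of x y] by (simp add: b_def convergent_LIMSEQ_iff)
  have sb: "sesquilinear b"
  proof (rule sesquilinearI)
    fix x y z :: 'a and c :: complex
    show "b (x + y) z = b x z + b y z"
      using LIMSEQ_unique[OF b[of "x + y" z]] tendsto_add[OF b[of x z] b[of y z]] by (simp add: sesquilinearD[OF B])
    show "b x (y + z) = b x y + b x z"
      using LIMSEQ_unique[OF b[of x "y + z"]] tendsto_add[OF b[of x y] b[of x z]] by (simp add: sesquilinearD[OF B])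
    show "b (c *\<^sub>C x) y = cnj c * b x y"
      using LIMSEQ_unique[OF b[of "c *\<^sub>C x" y]] tendsto_mult_left[OF b[of x y], of "cnj c"] by (simp add: sesquilinearD[OF B])
    show "b x (c *\<^sub>C y) = c * b x y"
      using LIMSEQ_unique[OF b[of x "c *\<^sub>C y"]] tendsto_mult_left[OF b[of x y], of c] by (simp add: sesquilinearD[OF B])
  qed
  have "cmod (b x y) \<le> 1 * norm x * norm y" for x y
    using LIMSEQ_le_const2[OF tendsto_norm[OF b[of x y]]] bd by auto
  from sesquilinear_bounded_imp_op[OF sb this] obtain T where T: "clinear_op T" "\<And>x y. cinner x (blinfun_apply T y) = b x y" by auto
  have Im: "Im (b x x) = 0" and Re: "0 \<le> Re (b x x)" "Re (b x x) \<le> (norm x)\<^sup>2" for x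
  proof -
    have p: "Im (B k x x) = 0" "0 \<le> Re (B k x x)" for k using pos[of k x] by (auto simp: complex_nonneg_Reals_iff)
    show "Im (b x x) = 0" using LIMSEQ_unique[OF tendsto_Im[OF b[of x x]]] p by simp
    show "0 \<le> Re (b x x)" "Re (b x x) \<le> (norm x)\<^sup>2"
      using LIMSEQ_le_const[OF tendsto_Re[OF b[of x x]]] LIMSEQ_le_const2[OF tendsto_Re[OF b[of x x]]] p le by auto
  qed
  show ?thesis
  proof (intro exI[of _ T] conjI allI)
    show "op_nonneg T" using T Im Re by (simp add: op_nonneg_def complex_nonneg_Reals_iff)
    show "op_nonneg (id_blinfun - T)"
      using T Im Re by (simp add: op_nonneg_def complex_nonneg_Reals_iff blinfun.diff_left cinner_diff_right cinner_self flip: of_real_power)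
    show "(\<lambda>k. B k x y) \<longlonglongrightarrow> cinner x (blinfun_apply T y)" for x y using b T by simp
  qed
qed

abbreviation unit_lborel :: "real measure" where
  "unit_lborel \<equiv> restrict_space lborel {0..1}"

lemma finite_unit_lborel: "finite_measure unit_lborel"
  by (rule finite_measureI) (simp add: emeasure_restrict_space space_restrict_space)

lemma measure_unit_lborel: "measure unit_lborel {0..1} = 1"
  by (simp add: measure_restrict_space)

text \<open>Connects the restricted measure on which the mixture is built with the gauge integral of
  the logarithm formula and the Lebesgue integral of the final statement.\<close>

lemma integral_unit_lborel:
  fixes h :: "real \<Rightarrow> complex"
  assumes "integrable unit_lborel h"
  shows "integral\<^sup>L unit_lborel h = integral {0..1} h"
    "set_integrable lebesgue {0..1} h" "(LINT s:{0..1}|lebesgue. h s) = integral\<^sup>L unit_lborel h"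
proof -
  have i: "integrable lborel (\<lambda>s. indicator {0..1} s *\<^sub>R h s)"
    using assms by (simp add: integrable_restrict_space)
  have e: "integral\<^sup>L unit_lborel h = (LINT s:{0..1}|lborel. h s)"
    by (simp add: integral_restrict_space set_lebesgue_integral_def)
  show "integral\<^sup>L unit_lborel h = integral {0..1} h"
    unfolding e using i by (intro set_borel_integral_eq_integral(2)) (simp add: set_integrable_def)
  show "set_integrable lebesgue {0..1} h"
    using i unfolding set_integrable_def by (subst integrable_completion) auto
  show "(LINT s:{0..1}|lebesgue. h s) = integral\<^sup>L unit_lborel h"
    unfolding e set_lebesgue_integral_def using i by (intro integral_completion) auto
qed

section \<open>The averaged measures and forms of the perturbed operators\<close>

locale spectral_averaging = perturbation D H K
  for D :: "'h::{complex_hilbert, second_countable_topology} set" and H :: "'h \<Rightarrow> 'h" and K :: "'h \<Rightarrow>\<^sub>L 'h" +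
  fixes E :: "real \<Rightarrow> real set \<Rightarrow> ('h \<Rightarrow>\<^sub>L 'h)"
  assumes sf: "\<And>s. s \<in> {0..1} \<Longrightarrow> spectral_family D (Hs s) (E s)"
begin

lemma pvm: "s \<in> {0..1} \<Longrightarrow> is_pvm (E s)"
  using sf by (simp add: spectral_family_def)

definition N :: "'h \<Rightarrow> real \<Rightarrow> real measure" where
  "N f s = scalar_spectral_measure (E s) (blinfun_apply K f)"

lemma stieltjes_N:
  "s \<in> {0..1} \<Longrightarrow> z \<notin> \<real> \<Longrightarrow> stieltjes (N f s) z = cinner f (blinfun_apply (M s z) f)"
  unfolding N_def cinner_M R_def by (rule cinner_resolvent_eq_stieltjes[OF selfadjoint_Hs sf, symmetric])

lemma measure_N:
  "s \<in> {0..1} \<Longrightarrow> \<Delta> \<in> sets borel \<Longrightarrow> measure (N f s) \<Delta> = (norm (blinfun_apply (E s \<Delta>) (blinfun_apply K f)))\<^sup>2"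
  unfolding N_def by (rule measure_specm[OF pvm])

text \<open>Measurability in s comes from the transforms: for s in the unit interval they are matrix
  elements of M, which are jointly continuous in s and the spectral parameter.\<close>

lemma mixture: "measure_mixture unit_lborel (N f) ((norm (blinfun_apply K f))\<^sup>2)"
proof (intro measure_mixture.intro measure_mixture_axioms.intro finite_unit_lborel)
  have sets: "sets (N f s) = sets borel" if "s \<in> {0..1}" for s
    unfolding N_def by (rule sets_specm[OF pvm[OF that]])
  have fin: "finite_measure (N f s)" if "s \<in> {0..1}" for s
    unfolding N_def by (rule finite_specm[OF pvm[OF that]])
  show "sets (N f s) = sets borel" if "s \<in> space unit_lborel" for s
    using sets that by (simp add: space_restrict_space)
  show "emeasure (N f s) UNIV \<le> ennreal ((norm (blinfun_apply K f))\<^sup>2)" if "s \<in> space unit_lborel" for s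
    using that emeasure_specm[OF pvm, of s UNIV] pvm_UNIV[OF pvm, of s] by (simp add: space_restrict_space N_def)
  fix A :: "real set" assume A: "A \<in> sets borel"
  show "(\<lambda>s. measure (N f s) A) \<in> borel_measurable unit_lborel"
  proof (rule measurable_measure_stieltjes[OF _ _ _ A])
    fix e :: real assume e: "e > 0"
    have c: "continuous_on UNIV (\<lambda>p. M (fst p) (of_real (snd p) + \<i> * of_real e))"
    proof -
      have "continuous_on UNIV (\<lambda>p. (fst p, complex_of_real (snd p) + \<i> * of_real e))"
        by (intro continuous_intros)
      from continuous_on_compose2[OF continuous_on_M this] show ?thesis using e by (simp add: image_subset_iff)
    qed
    have "continuous_on UNIV (\<lambda>p. cinner f (blinfun_apply (M (fst p) (of_real (snd p) + \<i> * of_real e)) f))"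
      by (intro continuous_intros bounded_linear.continuous_on[OF blinfun.bounded_linear_left c])
    then have m: "(\<lambda>p. cinner f (blinfun_apply (M (fst p) (of_real (snd p) + \<i> * of_real e)) f)) \<in> borel_measurable borel"
      by (rule borel_measurable_continuous_onI)
    have "(\<lambda>p. p) \<in> measurable (unit_lborel \<Otimes>\<^sub>M lborel) (borel \<Otimes>\<^sub>M borel)"
    proof (rule measurable_pair)
      have "(\<lambda>x. x) \<in> measurable unit_lborel borel" by (rule measurable_restrict_space1) simp
      from measurable_compose[OF measurable_fst this]
      show "fst \<circ> (\<lambda>p. p) \<in> measurable (unit_lborel \<Otimes>\<^sub>M lborel) borel" by (simp add: comp_def)
      show "snd \<circ> (\<lambda>p. p) \<in> measurable (unit_lborel \<Otimes>\<^sub>M lborel) borel"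
        using measurable_snd[of unit_lborel lborel] by (simp add: comp_def)
    qed
    then have "(\<lambda>p. p) \<in> measurable (unit_lborel \<Otimes>\<^sub>M lborel) (borel :: (real \<times> real) measure)" by (simp only: borel_prod)
    from measurable_compose[OF this m]
    have "(\<lambda>p. cinner f (blinfun_apply (M (fst p) (of_real (snd p) + \<i> * of_real e)) f)) \<in> borel_measurable (unit_lborel \<Otimes>\<^sub>M lborel)" .
    moreover have "(case p of (s, l) \<Rightarrow> stieltjes (N f s) (Complex l e)) = cinner f (blinfun_apply (M (fst p) (of_real (snd p) + \<i> * of_real e)) f)"
      if p: "p \<in> space (unit_lborel \<Otimes>\<^sub>M lborel)" for p
    proof -
      have "fst p \<in> {0..1}" using p by (auto simp: space_pair_measure space_restrict_space)
      moreover have "Complex (snd p) e \<notin> \<real>" using e by (simp add: complex_is_Real_iff)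
      ultimately show ?thesis by (simp add: case_prod_beta stieltjes_N Complex_eq)
    qed
    ultimately show "(\<lambda>(s, l). stieltjes (N f s) (Complex l e)) \<in> borel_measurable (unit_lborel \<Otimes>\<^sub>M lborel)"
      by (subst measurable_cong) auto
  qed (use fin sets in \<open>auto simp: space_restrict_space\<close>)
qed

definition \<mu> :: "'h \<Rightarrow> real measure" where
  "\<mu> f = measure_mixture.mixture unit_lborel (N f)"

lemma sets_\<mu> [simp, measurable_cong]: "sets (\<mu> f) = sets borel"
  unfolding \<mu>_def by (rule measure_mixture.sets_mixture[OF mixture])

lemma finite_\<mu>: "finite_measure (\<mu> f)"
  unfolding \<mu>_def by (rule measure_mixture.finite_mixture[OF mixture])

lemma measure_\<mu>:
  "\<Delta> \<in> sets borel \<Longrightarrow> measure (\<mu> f) \<Delta> = (\<integral>s. measure (N f s) \<Delta> \<partial>unit_lborel)"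
  unfolding \<mu>_def by (rule measure_mixture.measure_mixture_eq(2)[OF mixture])

lemma integrable_measure_N: "\<Delta> \<in> sets borel \<Longrightarrow> integrable unit_lborel (\<lambda>s. measure (N f s) \<Delta>)"
  by (rule measure_mixture.measure_mixture_eq(1)[OF mixture])

lemma measure_\<mu>_UNIV: "measure (\<mu> f) UNIV = (norm (blinfun_apply K f))\<^sup>2"
proof -
  have "measure (N f s) UNIV = (norm (blinfun_apply K f))\<^sup>2" if "s \<in> space unit_lborel" for s
  proof -
    have s: "s \<in> {0..1}" using that by (simp add: space_restrict_space)
    show ?thesis by (simp add: measure_N[OF s] pvm_UNIV[OF pvm[OF s]])
  qed
  then have "(\<integral>s. measure (N f s) UNIV \<partial>unit_lborel) = (\<integral>s. (norm (blinfun_apply K f))\<^sup>2 \<partial>unit_lborel)"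
    by (intro Bochner_Integration.integral_cong refl)
  then show ?thesis by (simp add: measure_\<mu> space_restrict_space measure_unit_lborel)
qed

lemma stieltjes_\<mu>:
  assumes z: "z \<notin> \<real>"
  shows "stieltjes (\<mu> f) z = cinner f (blinfun_apply (op_log (id_blinfun + M 0 z)) f)"
proof -
  have i: "integrable unit_lborel (\<lambda>s. stieltjes (N f s) z)"
    by (rule measure_mixture.stieltjes_mixture(1)[OF mixture z])
  have "stieltjes (\<mu> f) z = (\<integral>s. stieltjes (N f s) z \<partial>unit_lborel)"
    unfolding \<mu>_def by (rule measure_mixture.stieltjes_mixture(2)[OF mixture z])
  also have "\<dots> = integral {0..1} (\<lambda>s. stieltjes (N f s) z)" by (rule integral_unit_lborel(1)[OF i])
  also have "\<dots> = integral {0..1} (\<lambda>s. cinner f (blinfun_apply (M s z) f))"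
    by (intro Henstock_Kurzweil_Integration.integral_cong stieltjes_N z)
  also have "\<dots> = cinner f (blinfun_apply (op_log (id_blinfun + M 0 z)) f)" by (rule cinner_op_log[OF z, symmetric])
  finally show ?thesis .
qed

text \<open>The Lipschitz constant ||f||^2 is the bound pi ||f||^2 divided by the pi of the
  inversion formula; it turns into the upper bound 1 for the spectral shift operator.\<close>

lemma \<mu>_Lipschitz:
  assumes "a \<le> b"
  shows "measure (\<mu> f) {a<..b} \<le> (norm f)\<^sup>2 * (b - a)"
proof (rule measure_Ioc_le[OF finite_\<mu> sets_\<mu> assms])
  fix z assume z: "Im z > 0"
  then have zr: "z \<notin> \<real>" by (simp add: complex_is_Real_iff)
  have c: "continuous_on {0..1} (\<lambda>s. cinner f (blinfun_apply (M s z) f))"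
    by (intro continuous_intros bounded_linear.continuous_on[OF blinfun.bounded_linear_left] continuous_on_M_s zr)
  have "Im (stieltjes (\<mu> f) z) = Im (integral {0..1} (\<lambda>s. cinner f (blinfun_apply (M s z) f)))"
    by (simp add: stieltjes_\<mu>[OF zr] cinner_op_log[OF zr])
  also have "\<dots> = integral {0..1} (\<lambda>s. Im (cinner f (blinfun_apply (M s z) f)))"
    using integral_linear[OF integrable_continuous_real[OF c] bounded_linear_Im] by (simp add: comp_def)
  also have "\<dots> \<le> pi * (norm f)\<^sup>2" by (rule integral_Im_M_le[OF z])
  finally show "Im (stieltjes (\<mu> f) z) \<le> pi * (norm f)\<^sup>2" .
qed

text \<open>The left side of the final identity, with the adjoint of K moved to f.\<close>

definition mform :: "real set \<Rightarrow> 'h \<Rightarrow> 'h \<Rightarrow> complex" where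
  "mform \<Delta> f g = (\<integral>s. cinner (blinfun_apply K f) (blinfun_apply (E s \<Delta>) (blinfun_apply K g)) \<partial>unit_lborel)"

context
  fixes \<Delta> :: "real set"
  assumes \<Delta>: "\<Delta> \<in> sets borel"
begin

lemma sesquilinear_E:
  assumes "s \<in> {0..1}"
  shows "sesquilinear (\<lambda>f g. cinner (blinfun_apply K f) (blinfun_apply (E s \<Delta>) (blinfun_apply K g)))"
  using sesquilinear_cinner_op[OF K clinear_op_intros(5)[OF pvm_clinear[OF pvm[OF assms] \<Delta>] K]] by simp

lemma cinner_E_self:
  "s \<in> {0..1} \<Longrightarrow> cinner (blinfun_apply K f) (blinfun_apply (E s \<Delta>) (blinfun_apply K f)) = complex_of_real (measure (N f s) \<Delta>)"
  by (simp add: pvm_form[OF pvm \<Delta>] measure_N[OF _ \<Delta>])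

text \<open>Measurability in s is known on the diagonal; polarization carries it, together with
  integrability, to arbitrary f and g.\<close>

lemma integrable_mform: "integrable unit_lborel (\<lambda>s. cinner (blinfun_apply K f) (blinfun_apply (E s \<Delta>) (blinfun_apply K g)))"
proof -
  define q where "q = (\<lambda>h s. complex_of_real (measure (N h s) \<Delta>))"
  have q: "integrable unit_lborel (q h)" for h unfolding q_def using integrable_measure_N[OF \<Delta>] by simp
  have "integrable unit_lborel (\<lambda>s. (q (f + g) s - q (f - g) s - \<i> * q (f + \<i> *\<^sub>C g) s + \<i> * q (f - \<i> *\<^sub>C g) s) / 4)"
    by (intro Bochner_Integration.integrable_add Bochner_Integration.integrable_diff integrable_mult_right integrable_divide q)
  moreover have "cinner (blinfun_apply K f) (blinfun_apply (E s \<Delta>) (blinfun_apply K g))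
    = (q (f + g) s - q (f - g) s - \<i> * q (f + \<i> *\<^sub>C g) s + \<i> * q (f - \<i> *\<^sub>C g) s) / 4" if "s \<in> space unit_lborel" for s
    using that sesquilinear_polarization[OF sesquilinear_E, of s f g] by (simp add: space_restrict_space cinner_E_self q_def)
  ultimately show ?thesis by (subst Bochner_Integration.integrable_cong) auto
qed

lemma sesquilinear_mform: "sesquilinear (mform \<Delta>)"
  unfolding mform_def
  by (rule sesquilinear_integral[OF sesquilinear_E integrable_mform]) (simp add: space_restrict_space)

lemma mform_self: "mform \<Delta> f f = complex_of_real (measure (\<mu> f) \<Delta>)"
proof -
  have "mform \<Delta> f f = (\<integral>s. complex_of_real (measure (N f s) \<Delta>) \<partial>unit_lborel)"
    unfolding mform_def by (intro Bochner_Integration.integral_cong refl) (simp add: space_restrict_space cinner_E_self)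
  then show ?thesis by (simp add: measure_\<mu>[OF \<Delta>])
qed

end

text \<open>The type of \<open>op_log\<close> gives real linearity; complex homogeneity is read off
  from the integral formula.\<close>

lemma sesquilinear_op_log:
  assumes z: "z \<notin> \<real>"
  shows "sesquilinear (\<lambda>f g. cinner f (blinfun_apply (op_log (id_blinfun + M 0 z)) g))"
proof (rule sesquilinearI)
  show "cinner x (blinfun_apply (op_log (id_blinfun + M 0 z)) (c *\<^sub>C y)) = c * cinner x (blinfun_apply (op_log (id_blinfun + M 0 z)) y)" for x y c
    by (simp add: cinner_op_log[OF z] clinear_opD[OF clinear_M[OF z]] cinner_scaleC_right)
qed (simp_all add: cinner_simps blinfun.add_right)

section \<open>Existence of the spectral shift operator\<close>

text \<open>The operator at t is the limit of the averaged forms over dyadic cells around t, divided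
  by the cell length.\<close>

theorem spectral_shift_operator_exists:
  assumes \<Phi>: "\<And>z. z \<notin> \<real> \<Longrightarrow> \<Phi> z = id_blinfun + M 0 z"
  shows "\<exists>\<Xi>. is_spectral_shift_operator \<Phi> \<Xi>"
proof -
  obtain U :: "'h set" where U: "countable U" "\<And>V. open V \<Longrightarrow> V \<noteq> {} \<Longrightarrow> \<exists>u\<in>U. u \<in> V"
    using countable_dense_setE by metis
  have dense: "\<exists>u\<in>U. norm (x - u) < e" if "e > 0" for x e
  proof -
    have "ball x e \<noteq> {}" using that by simp
    from U(2)[OF open_ball this] show ?thesis by (simp add: dist_norm)
  qed
  \<comment> \<open>For each pair from U this contains the four vectors of the polarization
    identity, so convergence of the diagonal on W gives convergence of the forms on U.\<close>
  define W where "W = (\<lambda>(u, v, c). u + c *\<^sub>C v) ` (U \<times> U \<times> {1, -1, \<i>, -\<i>})"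
  have W: "countable W" unfolding W_def by (intro countable_image countable_SIGMA U countable_finite) auto
  have "W \<noteq> {}" using dense[of 1 0] by (auto simp: W_def)
  define v where "v = from_nat_into W"
  have vW: "range v = W" unfolding v_def by (rule range_from_nat_into[OF \<open>W \<noteq> {}\<close> W])
  obtain r where r: "strict_mono r" and conv: "AE t in lborel. \<forall>j. convergent (\<lambda>k. slope (\<mu> (v j)) (r k) t)"
    using slopes_converge_AE[of "\<lambda>j. \<mu> (v j)" "\<lambda>j. (norm (v j))\<^sup>2", OF finite_\<mu> sets_\<mu> \<mu>_Lipschitz] by blast
  \<comment> \<open>The Cauchy condition, instead of convergence, makes measurability of this set
    immediate.\<close>
  define good where "good = (\<lambda>t. \<forall>j. Cauchy (\<lambda>k. slope (\<mu> (v j)) (r k) t))"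
  have good_AE: "AE t in lborel. good t"
    using conv unfolding good_def by eventually_elim (simp add: convergent_Cauchy)
  have good_meas: "{t. good t} \<in> sets borel"
  proof -
    have "{t \<in> space borel. Cauchy (\<lambda>k. slope (\<mu> (v j)) (r k) t)} \<in> sets borel" for j
      by (rule sets_Collect_Cauchy) simp
    then have "(\<Inter>j. {t \<in> space borel. Cauchy (\<lambda>k. slope (\<mu> (v j)) (r k) t)}) \<in> sets borel" by (intro sets.countable_INT'') auto
    moreover have "(\<Inter>j. {t \<in> space borel. Cauchy (\<lambda>k. slope (\<mu> (v j)) (r k) t)}) = {t. good t}" by (auto simp: good_def)
    ultimately show ?thesis by (simp only:)
  qed
  define B where "B = (\<lambda>t k f g. complex_of_real (2 ^ r k) * mform (dyadic_interval (r k) (dyadic_index (r k) t)) f g)"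
  have B: "sesquilinear (B t k)" for t k
    unfolding B_def using sesquilinearD[OF sesquilinear_mform[OF dyadic_interval_borel]]
    by (intro sesquilinearI) (auto simp: algebra_simps)
  have B_self: "B t k f f = complex_of_real (slope (\<mu> f) (r k) t)" for t k f
    by (simp add: B_def mform_self slope_def)
  have ex: "\<exists>T. op_nonneg T \<and> op_nonneg (id_blinfun - T) \<and> (\<forall>x y. (\<lambda>k. B t k x y) \<longlonglongrightarrow> cinner x (blinfun_apply T y))" if t: "good t" for t
  proof (rule form_limit_op[OF B _ _ dense])
    show "B t k x x \<in> \<real>\<^sub>\<ge>\<^sub>0" for k x by (simp add: B_self slope_nonneg)
    show "Re (B t k x x) \<le> (norm x)\<^sup>2" for k x
      by (simp add: B_self slope_le[OF finite_\<mu> sets_\<mu> \<mu>_Lipschitz])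
    fix x y assume xy: "x \<in> U" "y \<in> U"
    have c: "convergent (\<lambda>k. B t k (x + c *\<^sub>C y) (x + c *\<^sub>C y))" if "c \<in> {1, -1, \<i>, -\<i>}" for c
    proof -
      have "x + c *\<^sub>C y \<in> W" unfolding W_def using xy that by (intro image_eqI[of _ _ "(x, y, c)"]) auto
      then obtain j where "x + c *\<^sub>C y = v j" using vW by auto
      moreover have "convergent (\<lambda>k. slope (\<mu> (v j)) (r k) t)" using t by (simp add: good_def Cauchy_convergent_iff)
      ultimately show ?thesis unfolding B_self by (auto simp: convergent_def intro: tendsto_of_real)
    qed
    have "(\<lambda>k. B t k x y) = (\<lambda>k. (B t k (x + 1 *\<^sub>C y) (x + 1 *\<^sub>C y) - B t k (x + (-1) *\<^sub>C y) (x + (-1) *\<^sub>C y)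
      - \<i> * B t k (x + \<i> *\<^sub>C y) (x + \<i> *\<^sub>C y) + \<i> * B t k (x + (-\<i>) *\<^sub>C y) (x + (-\<i>) *\<^sub>C y)) * (1 / 4))"
      by (rule ext, subst sesquilinear_polarization[OF B]) (simp add: scaleC_minus_left)
    moreover define L where "L = (\<lambda>c. lim (\<lambda>k. B t k (x + c *\<^sub>C y) (x + c *\<^sub>C y)))"
    have L: "(\<lambda>k. B t k (x + c *\<^sub>C y) (x + c *\<^sub>C y)) \<longlonglongrightarrow> L c" if "c \<in> {1, -1, \<i>, -\<i>}" for c
      using c[OF that] by (simp add: L_def convergent_LIMSEQ_iff)
    have "(\<lambda>k. (B t k (x + 1 *\<^sub>C y) (x + 1 *\<^sub>C y) - B t k (x + (-1) *\<^sub>C y) (x + (-1) *\<^sub>C y)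
      - \<i> * B t k (x + \<i> *\<^sub>C y) (x + \<i> *\<^sub>C y) + \<i> * B t k (x + (-\<i>) *\<^sub>C y) (x + (-\<i>) *\<^sub>C y)) * (1 / 4))
      \<longlonglongrightarrow> (L 1 - L (-1) - \<i> * L \<i> + \<i> * L (-\<i>)) * (1 / 4)"
      by (intro tendsto_add tendsto_diff tendsto_mult tendsto_const L) simp_all
    ultimately show "convergent (\<lambda>k. B t k x y)" by (simp only: convergentI)
  qed
  \<comment> \<open>The value 0 off the good set keeps the diagonal formula valid at every t, from
    which weak measurability follows by polarization.\<close>
  define \<Xi> where "\<Xi> = (\<lambda>t. if good t then SOME T. op_nonneg T \<and> op_nonneg (id_blinfun - T) \<and>
    (\<forall>x y. (\<lambda>k. B t k x y) \<longlonglongrightarrow> cinner x (blinfun_apply T y)) else 0)"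
  have \<Xi>: "op_nonneg (\<Xi> t)" "op_nonneg (id_blinfun - \<Xi> t)" "(\<lambda>k. B t k x y) \<longlonglongrightarrow> cinner x (blinfun_apply (\<Xi> t) y)"
    if "good t" for t x y
    using someI_ex[OF ex[OF that]] that by (auto simp: \<Xi>_def)
  have \<Xi>_sesq: "sesquilinear (\<lambda>f g. cinner f (blinfun_apply (\<Xi> t) g))" for t
    using \<Xi>(1)[of t] by (intro sesquilinear_op) (cases "good t", auto simp: op_nonneg_def \<Xi>_def)
  define \<xi> where "\<xi> = (\<lambda>f t. if good t then lim (\<lambda>k. slope (\<mu> f) (r k) t) else 0)"
  have \<xi>_meas [measurable]: "\<xi> f \<in> borel_measurable borel" for f
    unfolding \<xi>_def using good_meas by (intro measurable_If borel_measurable_lim_metric) auto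
  have lim: "(\<lambda>k. slope (\<mu> f) (r k) t) \<longlonglongrightarrow> \<xi> f t" and diag: "cinner f (blinfun_apply (\<Xi> t) f) = complex_of_real (\<xi> f t)" if t: "good t" for f t
  proof -
    have "(\<lambda>k. slope (\<mu> f) (r k) t) \<longlonglongrightarrow> Re (cinner f (blinfun_apply (\<Xi> t) f))"
      using tendsto_Re[OF \<Xi>(3)[OF t, of f f]] by (simp add: B_self)
    moreover from limI[OF this] have "\<xi> f t = Re (cinner f (blinfun_apply (\<Xi> t) f))" using t by (simp add: \<xi>_def)
    ultimately show "(\<lambda>k. slope (\<mu> f) (r k) t) \<longlonglongrightarrow> \<xi> f t" "cinner f (blinfun_apply (\<Xi> t) f) = complex_of_real (\<xi> f t)"
      using op_nonneg_Re[OF \<Xi>(1)[OF t], of f] by simp_all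
  qed
  have diag': "cinner f (blinfun_apply (\<Xi> t) f) = complex_of_real (\<xi> f t)" for f t
    using diag[of t f] by (cases "good t") (auto simp: \<Xi>_def \<xi>_def)
  have \<xi>_nonneg: "0 \<le> \<xi> f t" for f t
    using diag'[of f t] \<Xi>(1)[of t] op_nonneg_Re_ge[of "\<Xi> t" f] by (cases "good t") (auto simp: \<xi>_def)
  have polar: "cinner f (blinfun_apply (\<Xi> t) g) = (complex_of_real (\<xi> (f + g) t) - complex_of_real (\<xi> (f - g) t)
    - \<i> * complex_of_real (\<xi> (f + \<i> *\<^sub>C g) t) + \<i> * complex_of_real (\<xi> (f - \<i> *\<^sub>C g) t)) / 4" for f g t
    by (subst sesquilinear_polarization[OF \<Xi>_sesq]) (simp only: diag')
  have "weakly_measurable \<Xi>"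
    unfolding weakly_measurable_def polar by (intro allI measurable_completion) measurable
  moreover have "AE l in lebesgue. op_le 0 (\<Xi> l) \<and> op_le (\<Xi> l) id_blinfun"
    unfolding AE_completion_iff using good_AE by eventually_elim (simp add: op_le_def \<Xi>)
  moreover have "has_bochner_integral lebesgue (\<lambda>l. cinner f (blinfun_apply (\<Xi> l) g) * inverse (complex_of_real l - z))
    (cinner f (blinfun_apply (op_log (\<Phi> z)) g))" if z: "z \<notin> \<real>" for z f g
  proof -
    define I where "I = (\<lambda>f. cinner f (blinfun_apply (op_log (\<Phi> z)) f))"
    have d: "has_bochner_integral lborel (\<lambda>l. complex_of_real (\<xi> f l) * inverse (complex_of_real l - z)) (I f)" for f
    proof -
      have dens: "\<mu> f = density lborel (\<lambda>t. ennreal (\<xi> f t))"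
      proof (rule density_slope_limit[OF finite_\<mu> sets_\<mu> \<mu>_Lipschitz r])
        show "AE t in lborel. (\<lambda>k. slope (\<mu> f) (r k) t) \<longlonglongrightarrow> \<xi> f t"
          using good_AE by eventually_elim (rule lim)
      qed simp_all
      have m: "(\<lambda>l. inverse (complex_of_real l - z)) \<in> borel_measurable lborel" by simp
      have "integrable (\<mu> f) (\<lambda>l. inverse (complex_of_real l - z))"
        by (rule integrable_inverse_minus[OF finite_\<mu> sets_\<mu> z])
      then have 1: "integrable lborel (\<lambda>l. \<xi> f l *\<^sub>R inverse (complex_of_real l - z))"
        unfolding dens using \<xi>_nonneg by (subst (asm) integrable_density[OF m]) auto
      have "I f = stieltjes (\<mu> f) z" unfolding I_def \<Phi>[OF z] by (rule stieltjes_\<mu>[OF z, symmetric])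
      also have "\<dots> = (\<integral>l. \<xi> f l *\<^sub>R inverse (complex_of_real l - z) \<partial>lborel)"
        unfolding stieltjes_def dens using \<xi>_nonneg by (subst integral_density[OF m]) auto
      finally show ?thesis using 1 by (simp add: has_bochner_integral_iff scaleR_conv_of_real)
    qed
    have "has_bochner_integral lborel (\<lambda>l. (complex_of_real (\<xi> (f + g) l) * inverse (complex_of_real l - z)
      - complex_of_real (\<xi> (f - g) l) * inverse (complex_of_real l - z)
      - \<i> * (complex_of_real (\<xi> (f + \<i> *\<^sub>C g) l) * inverse (complex_of_real l - z))
      + \<i> * (complex_of_real (\<xi> (f - \<i> *\<^sub>C g) l) * inverse (complex_of_real l - z))) / 4)
      ((I (f + g) - I (f - g) - \<i> * I (f + \<i> *\<^sub>C g) + \<i> * I (f - \<i> *\<^sub>C g)) / 4)"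
      by (intro has_bochner_integral_divide has_bochner_integral_add has_bochner_integral_diff has_bochner_integral_mult_right d)
    moreover have "(I (f + g) - I (f - g) - \<i> * I (f + \<i> *\<^sub>C g) + \<i> * I (f - \<i> *\<^sub>C g)) / 4 = cinner f (blinfun_apply (op_log (\<Phi> z)) g)"
      unfolding I_def \<Phi>[OF z] by (rule sesquilinear_polarization[OF sesquilinear_op_log[OF z], symmetric])
    moreover have "(complex_of_real (\<xi> (f + g) l) * inverse (complex_of_real l - z)
      - complex_of_real (\<xi> (f - g) l) * inverse (complex_of_real l - z)
      - \<i> * (complex_of_real (\<xi> (f + \<i> *\<^sub>C g) l) * inverse (complex_of_real l - z))
      + \<i> * (complex_of_real (\<xi> (f - \<i> *\<^sub>C g) l) * inverse (complex_of_real l - z))) / 4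
      = cinner f (blinfun_apply (\<Xi> l) g) * inverse (complex_of_real l - z)" for l
      unfolding polar by (simp add: left_diff_distrib distrib_right)
    ultimately have 1: "has_bochner_integral lborel (\<lambda>l. cinner f (blinfun_apply (\<Xi> l) g) * inverse (complex_of_real l - z))
      (cinner f (blinfun_apply (op_log (\<Phi> z)) g))" by simp
    have m: "(\<lambda>l. cinner f (blinfun_apply (\<Xi> l) g) * inverse (complex_of_real l - z)) \<in> borel_measurable lborel"
      unfolding polar by measurable
    show ?thesis using 1 m by (simp add: has_bochner_integral_iff integrable_completion integral_completion)
  qed
  ultimately show ?thesis unfolding is_spectral_shift_operator_def by blast
qed

end

section \<open>Properties of every spectral shift operator\<close>

text \<open>Turns unordered sums into integrals over counting measure, so that the sum over a basis
  can be exchanged with the integral over the line.\<close>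

lemma nonneg_summable_on_iff:
  fixes f :: "'b \<Rightarrow> real"
  assumes "\<And>x. 0 \<le> f x"
  shows "f summable_on B \<longleftrightarrow> (\<integral>\<^sup>+x. ennreal (f x) \<partial>count_space B) < \<infinity>"
    and "f summable_on B \<Longrightarrow> infsum f B = enn2real (\<integral>\<^sup>+x. ennreal (f x) \<partial>count_space B)"
proof -
  have "f summable_on B \<longleftrightarrow> (\<lambda>x. norm (f x)) summable_on B" using assms by simp
  also have "\<dots> \<longleftrightarrow> integrable (count_space B) f"
    by (simp only: abs_summable_equivalent abs_summable_on_def)
  finally have 1: "f summable_on B \<longleftrightarrow> integrable (count_space B) f" .
  then show "f summable_on B \<longleftrightarrow> (\<integral>\<^sup>+x. ennreal (f x) \<partial>count_space B) < \<infinity>"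
    using assms by (simp add: integrable_iff_bounded)
  assume s: "f summable_on B"
  then have a: "Infinite_Set_Sum.abs_summable_on f B" using 1 by (simp add: abs_summable_on_def)
  have "infsum f B = infsetsum f B" by (rule infsetsum_infsum[OF a, symmetric])
  also have "ennreal \<dots> = (\<integral>\<^sup>+x. ennreal (f x) \<partial>count_space B)"
    using nn_integral_conv_infsetsum[OF a] assms by simp
  finally have "(\<integral>\<^sup>+x. ennreal (f x) \<partial>count_space B) = ennreal (infsum f B)" by simp
  moreover have "0 \<le> infsum f B" by (rule infsum_nonneg) (rule assms)
  ultimately show "infsum f B = enn2real (\<integral>\<^sup>+x. ennreal (f x) \<partial>count_space B)" by simp
qed

context spectral_averaging
begin

context
  fixes \<Phi> :: "complex \<Rightarrow> ('h \<Rightarrow>\<^sub>L 'h)" and \<Xi> :: "real \<Rightarrow> ('h \<Rightarrow>\<^sub>L 'h)"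
  assumes \<Phi>: "\<And>z. z \<notin> \<real> \<Longrightarrow> \<Phi> z = id_blinfun + M 0 z"
    and \<Xi>: "is_spectral_shift_operator \<Phi> \<Xi>"
begin

text \<open>Truncation at 0 makes this nonnegative everywhere, while the operator is nonnegative
  only almost everywhere.\<close>

definition \<xi> :: "'h \<Rightarrow> real \<Rightarrow> real" where
  "\<xi> f l = max 0 (Re (cinner f (blinfun_apply (\<Xi> l) f)))"

lemma \<Xi>_measurable [measurable]: "(\<lambda>l. cinner f (blinfun_apply (\<Xi> l) g)) \<in> borel_measurable lebesgue"
  using \<Xi> by (simp add: is_spectral_shift_operator_def weakly_measurable_def)

lemma \<xi>_measurable [measurable]: "\<xi> f \<in> borel_measurable lebesgue"
  unfolding \<xi>_def by measurable

lemma \<xi>_nonneg: "0 \<le> \<xi> f l"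
  by (simp add: \<xi>_def)

lemma \<Xi>_nonneg_AE: "AE l in lebesgue. op_nonneg (\<Xi> l)"
  using \<Xi> by (auto simp: is_spectral_shift_operator_def op_le_def elim!: eventually_mono)

lemma \<xi>_eq: "op_nonneg (\<Xi> l) \<Longrightarrow> cinner f (blinfun_apply (\<Xi> l) f) = complex_of_real (\<xi> f l)"
  using op_nonneg_Re[of "\<Xi> l" f] op_nonneg_Re_ge[of "\<Xi> l" f] by (simp add: \<xi>_def max_def)

lemma has_integral_\<xi>_inverse:
  assumes z: "z \<notin> \<real>"
  shows "has_bochner_integral lebesgue (\<lambda>l. complex_of_real (\<xi> f l) * inverse (complex_of_real l - z)) (stieltjes (\<mu> f) z)"
proof -
  have m: "(\<lambda>l. inverse (complex_of_real l - z)) \<in> borel_measurable lebesgue"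
    by (rule measurable_completion) simp
  have "has_bochner_integral lebesgue (\<lambda>l. cinner f (blinfun_apply (\<Xi> l) f) * inverse (complex_of_real l - z)) (stieltjes (\<mu> f) z)"
    using \<Xi> z by (simp add: is_spectral_shift_operator_def stieltjes_\<mu> \<Phi>)
  moreover have "AE l in lebesgue. cinner f (blinfun_apply (\<Xi> l) f) * inverse (complex_of_real l - z)
    = complex_of_real (\<xi> f l) * inverse (complex_of_real l - z)"
    using \<Xi>_nonneg_AE by eventually_elim (simp add: \<xi>_eq)
  ultimately show ?thesis
    by (subst (asm) has_bochner_integral_cong_AE) (use m in \<open>auto intro!: borel_measurable_times\<close>)
qed

text \<open>The definition gives integrability only against (l - z)^{-1}. For z = i e with e
  growing, e times the imaginary part of this kernel tends to 1, while the integrals stay below the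
  mass of \<open>\<mu> f\<close>; Fatou concludes.\<close>

lemma nn_integral_\<xi>_le: "(\<integral>\<^sup>+l. ennreal (\<xi> f l) \<partial>lebesgue) \<le> ennreal (measure (\<mu> f) UNIV)"
proof -
  interpret finite_measure "\<mu> f" by (rule finite_\<mu>)
  define e where "e = (\<lambda>n. real (Suc n))"
  define k where "k = (\<lambda>n l. e n * (\<xi> f l * (e n / ((l - 0)\<^sup>2 + (e n)\<^sup>2))))"
  have e: "e n > 0" for n by (simp add: e_def)
  have k0: "0 \<le> k n l" for n l using e[of n] by (simp add: k_def \<xi>_nonneg)
  have int: "(\<integral>\<^sup>+l. ennreal (k n l) \<partial>lebesgue) \<le> ennreal (measure (\<mu> f) UNIV)" for n
  proof -
    have z: "Complex 0 (e n) \<notin> \<real>" using e[of n] by (simp add: complex_is_Real_iff)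
    have Im: "Im (complex_of_real a * w) = a * Im w" for a w by simp
    from has_bochner_integral_bounded_linear[OF bounded_linear_Im has_integral_\<xi>_inverse[OF z, of f]]
    have "has_bochner_integral lebesgue (\<lambda>l. \<xi> f l * (e n / ((l - 0)\<^sup>2 + (e n)\<^sup>2))) (Im (stieltjes (\<mu> f) (Complex 0 (e n))))"
      unfolding Im Im_inverse_Complex .
    then have k: "has_bochner_integral lebesgue (k n) (e n * Im (stieltjes (\<mu> f) (Complex 0 (e n))))"
      unfolding k_def by (rule has_bochner_integral_mult_right)
    have "Im (stieltjes (\<mu> f) (Complex 0 (e n))) = (\<integral>x. e n / ((x - 0)\<^sup>2 + (e n)\<^sup>2) \<partial>\<mu> f)"
      by (rule Im_stieltjes[OF finite_\<mu> sets_\<mu> e])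
    also have "\<dots> \<le> (\<integral>x. 1 / e n \<partial>\<mu> f)"
    proof (rule integral_mono_AE')
      show "AE x in \<mu> f. e n / ((x - 0)\<^sup>2 + (e n)\<^sup>2) \<le> 1 / e n" by (intro AE_I2 poisson_le[OF finite_\<mu> sets_\<mu>] e)
      show "AE x in \<mu> f. 0 \<le> 1 / e n" using e[of n] by simp
    qed simp
    also have "\<dots> = measure (\<mu> f) UNIV / e n" using sets_eq_imp_space_eq[OF sets_\<mu>[of f]] by simp
    finally have "e n * Im (stieltjes (\<mu> f) (Complex 0 (e n))) \<le> measure (\<mu> f) UNIV" using e[of n] by (simp add: field_simps)
    moreover have "(\<integral>\<^sup>+l. ennreal (k n l) \<partial>lebesgue) = ennreal (e n * Im (stieltjes (\<mu> f) (Complex 0 (e n))))"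
      using k k0 by (subst nn_integral_eq_integral) (auto simp: has_bochner_integral_iff)
    ultimately show ?thesis by (simp add: ennreal_leI)
  qed
  have lim: "(\<lambda>n. k n l) \<longlonglongrightarrow> \<xi> f l" for l
  proof -
    have "k n l = \<xi> f l * (1 / (1 + (l * (1 / e n))\<^sup>2))" for n
    proof -
      have "1 + (l * (1 / e n))\<^sup>2 = (l\<^sup>2 + (e n)\<^sup>2) / (e n)\<^sup>2" using e[of n] by (simp add: field_simps)
      then show ?thesis by (simp add: k_def power2_eq_square mult_ac)
    qed
    moreover have "(\<lambda>n. \<xi> f l * (1 / (1 + (l * (1 / e n))\<^sup>2))) \<longlonglongrightarrow> \<xi> f l * (1 / (1 + (l * 0)\<^sup>2))"
      unfolding e_def by (intro tendsto_intros LIMSEQ_Suc[OF lim_1_over_n]) simp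
    ultimately show ?thesis by simp
  qed
  have m: "k n \<in> borel_measurable lebesgue" for n
  proof -
    have "(\<lambda>l. e n / ((l - 0)\<^sup>2 + (e n)\<^sup>2)) \<in> borel_measurable lebesgue"
      by (rule measurable_completion) simp
    then show ?thesis unfolding k_def by measurable
  qed
  have "(\<integral>\<^sup>+l. ennreal (\<xi> f l) \<partial>lebesgue) = (\<integral>\<^sup>+l. liminf (\<lambda>n. ennreal (k n l)) \<partial>lebesgue)"
    by (intro nn_integral_cong lim_imp_Liminf[symmetric] tendsto_ennrealI lim) simp
  also have "\<dots> \<le> liminf (\<lambda>n. \<integral>\<^sup>+l. ennreal (k n l) \<partial>lebesgue)"
    by (rule nn_integral_liminf) (use m in measurable)
  also have "\<dots> \<le> liminf (\<lambda>n. ennreal (measure (\<mu> f) UNIV))" by (intro Liminf_mono always_eventually allI int)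
  also have "\<dots> = ennreal (measure (\<mu> f) UNIV)" by (simp add: Liminf_const)
  finally show ?thesis .
qed

text \<open>Two finite measures with equal transforms. The image under the identity brings the
  density from the Lebesgue sets down to the Borel sets, where uniqueness is stated.\<close>

lemma \<mu>_eq_distr: "\<mu> f = distr (density lebesgue (\<lambda>l. ennreal (\<xi> f l))) borel (\<lambda>x. x)"
proof (rule stieltjes_unique[OF finite_\<mu> sets_\<mu>])
  have id: "(\<lambda>x. x) \<in> measurable (density lebesgue (\<lambda>l. ennreal (\<xi> f l))) borel"
    by (simp add: measurable_completion)
  show "finite_measure (distr (density lebesgue (\<lambda>l. ennreal (\<xi> f l))) borel (\<lambda>x. x))"
  proof (rule finite_measureI)
    have "emeasure (density lebesgue (\<lambda>l. ennreal (\<xi> f l))) UNIV = (\<integral>\<^sup>+l. ennreal (\<xi> f l) \<partial>lebesgue)"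
      by (subst emeasure_density) auto
    also have "\<dots> < \<infinity>" using nn_integral_\<xi>_le[of f] by (rule le_less_trans) simp
    finally show "emeasure (distr (density lebesgue (\<lambda>l. ennreal (\<xi> f l))) borel (\<lambda>x. x)) (space (distr (density lebesgue (\<lambda>l. ennreal (\<xi> f l))) borel (\<lambda>x. x))) \<noteq> \<infinity>"
      by (subst emeasure_distr[OF id]) auto
  qed
  fix z assume "Im z > 0"
  then have z: "z \<notin> \<real>" by (simp add: complex_is_Real_iff)
  have m: "(\<lambda>l. inverse (complex_of_real l - z)) \<in> borel_measurable lebesgue"
    by (rule measurable_completion) simp
  have "stieltjes (distr (density lebesgue (\<lambda>l. ennreal (\<xi> f l))) borel (\<lambda>x. x)) z
    = (\<integral>l. inverse (complex_of_real l - z) \<partial>density lebesgue (\<lambda>l. ennreal (\<xi> f l)))"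
    unfolding stieltjes_def by (rule integral_distr[OF id]) simp
  also have "\<dots> = (\<integral>l. \<xi> f l *\<^sub>R inverse (complex_of_real l - z) \<partial>lebesgue)"
    using \<xi>_nonneg by (subst integral_density[OF m]) auto
  also have "\<dots> = stieltjes (\<mu> f) z"
    using has_integral_\<xi>_inverse[OF z, of f] by (simp add: has_bochner_integral_iff scaleR_conv_of_real)
  finally show "stieltjes (\<mu> f) z = stieltjes (distr (density lebesgue (\<lambda>l. ennreal (\<xi> f l))) borel (\<lambda>x. x)) z" by simp
qed simp

lemma nn_integral_\<xi>_indicator:
  assumes \<Delta>: "\<Delta> \<in> sets borel"
  shows "(\<integral>\<^sup>+l. ennreal (\<xi> f l) * indicator \<Delta> l \<partial>lebesgue) = ennreal (measure (\<mu> f) \<Delta>)"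
proof -
  have id: "(\<lambda>x. x) \<in> measurable (density lebesgue (\<lambda>l. ennreal (\<xi> f l))) borel"
    by (simp add: measurable_completion)
  have "emeasure (\<mu> f) \<Delta> = emeasure (density lebesgue (\<lambda>l. ennreal (\<xi> f l))) \<Delta>"
    by (subst \<mu>_eq_distr, subst emeasure_distr[OF id \<Delta>]) simp
  also have "\<dots> = (\<integral>\<^sup>+l. ennreal (\<xi> f l) * indicator \<Delta> l \<partial>lebesgue)"
    using \<Delta> by (subst emeasure_density) auto
  finally show ?thesis by (simp add: finite_measure.emeasure_eq_measure[OF finite_\<mu>])
qed

lemma has_integral_\<xi>:
  assumes \<Delta>: "\<Delta> \<in> sets borel"
  shows "has_bochner_integral lebesgue (\<lambda>l. indicator \<Delta> l *\<^sub>R complex_of_real (\<xi> f l)) (complex_of_real (measure (\<mu> f) \<Delta>))"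
proof -
  have i: "indicat_real \<Delta> \<in> borel_measurable lebesgue"
    using borel_measurable_indicator[of \<Delta> borel] \<Delta> by (intro measurable_completion) simp
  have "has_bochner_integral lebesgue (\<lambda>l. \<xi> f l * indicator \<Delta> l) (measure (\<mu> f) \<Delta>)"
  proof (rule has_bochner_integral_nn_integral)
    have "(\<integral>\<^sup>+l. ennreal (\<xi> f l * indicator \<Delta> l) \<partial>lebesgue) = (\<integral>\<^sup>+l. ennreal (\<xi> f l) * indicator \<Delta> l \<partial>lebesgue)"
      by (intro nn_integral_cong) (simp add: indicator_def)
    then show "(\<integral>\<^sup>+l. ennreal (\<xi> f l * indicator \<Delta> l) \<partial>lebesgue) = ennreal (measure (\<mu> f) \<Delta>)"
      by (simp add: nn_integral_\<xi>_indicator[OF \<Delta>])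
  qed (use i \<xi>_nonneg in auto)
  from has_bochner_integral_of_real[OF this] show ?thesis by (simp add: scaleR_conv_of_real mult.commute)
qed

text \<open>On the diagonal this is the identification of \<open>\<mu> f\<close>; polarization is
  applied pointwise at those l where the operator is nonnegative.\<close>

theorem has_integral_spectral_shift_operator:
  assumes \<Delta>: "\<Delta> \<in> sets borel"
  shows "has_bochner_integral lebesgue (\<lambda>l. indicator \<Delta> l *\<^sub>R cinner f (blinfun_apply (\<Xi> l) g)) (mform \<Delta> f g)"
proof -
  define q where "q = (\<lambda>h l. indicator \<Delta> l *\<^sub>R complex_of_real (\<xi> h l))"
  have q: "has_bochner_integral lebesgue (q h) (mform \<Delta> h h)" for h
    unfolding q_def mform_self[OF \<Delta>] by (rule has_integral_\<xi>[OF \<Delta>])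
  have "has_bochner_integral lebesgue (\<lambda>l. (q (f + g) l - q (f - g) l - \<i> * q (f + \<i> *\<^sub>C g) l + \<i> * q (f - \<i> *\<^sub>C g) l) / 4)
    ((mform \<Delta> (f + g) (f + g) - mform \<Delta> (f - g) (f - g) - \<i> * mform \<Delta> (f + \<i> *\<^sub>C g) (f + \<i> *\<^sub>C g)
      + \<i> * mform \<Delta> (f - \<i> *\<^sub>C g) (f - \<i> *\<^sub>C g)) / 4)"
    by (intro has_bochner_integral_divide has_bochner_integral_add has_bochner_integral_diff has_bochner_integral_mult_right q)
  then have p: "has_bochner_integral lebesgue (\<lambda>l. (q (f + g) l - q (f - g) l - \<i> * q (f + \<i> *\<^sub>C g) l + \<i> * q (f - \<i> *\<^sub>C g) l) / 4) (mform \<Delta> f g)"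
    by (simp only: sesquilinear_polarization[OF sesquilinear_mform[OF \<Delta>], of f g])
  have ae: "AE l in lebesgue. (q (f + g) l - q (f - g) l - \<i> * q (f + \<i> *\<^sub>C g) l + \<i> * q (f - \<i> *\<^sub>C g) l) / 4
    = indicator \<Delta> l *\<^sub>R cinner f (blinfun_apply (\<Xi> l) g)"
    using \<Xi>_nonneg_AE
  proof eventually_elim
    case (elim l)
    then have "clinear_op (\<Xi> l)" by (simp add: op_nonneg_def)
    from sesquilinear_polarization[OF sesquilinear_op[OF this], of f g]
    show ?case unfolding q_def \<xi>_eq[OF elim, symmetric] by (simp add: indicator_def)
  qed
  have i: "indicat_real \<Delta> \<in> borel_measurable lebesgue"
    using borel_measurable_indicator[of \<Delta> borel] \<Delta> by (intro measurable_completion) simp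
  have "(\<lambda>l. indicator \<Delta> l *\<^sub>R cinner f (blinfun_apply (\<Xi> l) g)) \<in> borel_measurable lebesgue"
    using i by (intro borel_measurable_scaleR \<Xi>_measurable)
  then show ?thesis
    using p has_bochner_integral_cong_AE[OF borel_measurable_has_bochner_integral[OF p] _ ae] by blast
qed

text \<open>Summing the diagonal over a countable basis and exchanging sum and integral gives the
  sum of ||K e||^2, which is finite.\<close>

theorem trace_norm_integrable:
  assumes hs: "hilbert_schmidt K"
  shows "AE l in lebesgue. trace_class (\<Xi> l)" "integrable lebesgue (\<lambda>l. trace_norm (\<Xi> l))"
proof -
  \<comment> \<open>This must be the very basis chosen inside \<open>trace_norm\<close>, so
    Hilbert-Schmidt summability, given on some basis, has to be moved to it.\<close>
  define B where "B = (SOME B::'h set. is_onb B)"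
  have B: "is_onb B"
    unfolding B_def using hs by (intro someI_ex[of is_onb]) (auto simp: hilbert_schmidt_def)
  have cB: "countable B" by (rule onb_countable[OF B])
  define h where "h = (\<lambda>l. \<integral>\<^sup>+e. ennreal (\<xi> e l) \<partial>count_space B)"
  have "(\<integral>\<^sup>+l. h l \<partial>lebesgue) = (\<integral>\<^sup>+e. (\<integral>\<^sup>+l. ennreal (\<xi> e l) \<partial>lebesgue) \<partial>count_space B)"
    unfolding h_def by (rule nn_integral_count_space_nn_integral[OF cB]) simp
  also have "\<dots> = (\<integral>\<^sup>+e. ennreal ((norm (blinfun_apply K e))\<^sup>2) \<partial>count_space B)"
    using nn_integral_\<xi>_indicator[of UNIV] by (simp add: measure_\<mu>_UNIV)
  also have "\<dots> < \<infinity>"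
    using hilbert_schmidt_onb[OF hs B] by (subst (asm) nonneg_summable_on_iff) auto
  finally have fin: "(\<integral>\<^sup>+l. h l \<partial>lebesgue) < \<infinity>" .
  have hm: "h \<in> borel_measurable lebesgue"
    unfolding h_def
  proof (rule sigma_finite_measure.borel_measurable_nn_integral[OF sigma_finite_measure_count_space_countable[OF cB]])
    have "(\<lambda>(e, l). ennreal (\<xi> e l)) \<in> borel_measurable (count_space B \<Otimes>\<^sub>M lebesgue)"
      by (rule measurable_pair_measure_countable1[OF cB]) simp
    from measurable_pair_swap[OF this]
    show "(\<lambda>(l, e). ennreal (\<xi> e l)) \<in> borel_measurable (lebesgue \<Otimes>\<^sub>M count_space B)" by simp
  qed
  have hfin: "AE l in lebesgue. h l \<noteq> \<infinity>" by (rule nn_integral_PInf_AE[OF hm]) (use fin in simp)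
  have main: "AE l in lebesgue. trace_class (\<Xi> l) \<and> enn2real (h l) = trace_norm (\<Xi> l)"
    using \<Xi>_nonneg_AE hfin
  proof eventually_elim
    case (elim l)
    have eq: "Re (cinner e (blinfun_apply (op_abs (\<Xi> l)) e)) = \<xi> e l" for e
      by (simp add: op_abs_nonneg[OF elim(1)] \<xi>_eq[OF elim(1)])
    have s: "(\<lambda>e. \<xi> e l) summable_on B"
      using elim(2) by (subst nonneg_summable_on_iff(1)) (auto simp: \<xi>_nonneg h_def less_top)
    have "trace_class (\<Xi> l)"
      unfolding trace_class_def eq using elim(1) s B by (auto simp: op_nonneg_def)
    moreover have "trace_norm (\<Xi> l) = enn2real (h l)"
      unfolding trace_norm_def eq B_def[symmetric] h_def by (rule nonneg_summable_on_iff(2)[OF \<xi>_nonneg s])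
    ultimately show ?case by simp
  qed
  then show "AE l in lebesgue. trace_class (\<Xi> l)" by eventually_elim simp
  have ae: "AE l in lebesgue. enn2real (h l) = trace_norm (\<Xi> l)" using main by eventually_elim simp
  have m: "(\<lambda>l. enn2real (h l)) \<in> borel_measurable lebesgue" using hm by measurable
  have "integrable lebesgue (\<lambda>l. enn2real (h l))"
  proof (rule integrableI_nonneg[OF m])
    have "(\<integral>\<^sup>+l. ennreal (enn2real (h l)) \<partial>lebesgue) = (\<integral>\<^sup>+l. h l \<partial>lebesgue)"
    proof (rule nn_integral_cong_AE)
      show "AE l in lebesgue. ennreal (enn2real (h l)) = h l"
        using hfin by eventually_elim (simp add: less_top)
    qed
    then show "(\<integral>\<^sup>+l. ennreal (enn2real (h l)) \<partial>lebesgue) < \<infinity>" using fin by simp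
  qed simp
  then show "integrable lebesgue (\<lambda>l. trace_norm (\<Xi> l))"
    using Bochner_Integration.integrable_cong_AE[OF m borel_measurable_lebesgue_AE[OF m ae] ae] by simp
qed

end

end

theorem theorem4p5:
  fixes D :: "'h::{complex_hilbert, second_countable_topology} set"
    and H\<^sub>0 :: "'h \<Rightarrow> 'h"
    and K :: "'h \<Rightarrow>\<^sub>L 'h"
    and E :: "real \<Rightarrow> real set \<Rightarrow> ('h \<Rightarrow>\<^sub>L 'h)"
    and \<Phi> :: "complex \<Rightarrow> ('h \<Rightarrow>\<^sub>L 'h)"
  assumes H0: "selfadjoint D H\<^sub>0"
    and K: "hilbert_schmidt K"
    and E: "\<And>s. s \<in> {0..1} \<Longrightarrow> spectral_family D (\<lambda>x. H\<^sub>0 x + s *\<^sub>R K (adj K x)) (E s)"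
    and \<Phi>: "\<And>z. z \<notin> \<real> \<Longrightarrow> \<Phi> z = id_blinfun + (adj K o\<^sub>L resolvent D H\<^sub>0 z o\<^sub>L K)"
  shows "(\<exists>\<Xi>. is_spectral_shift_operator \<Phi> \<Xi>) \<and>
    (\<forall>\<Xi>. is_spectral_shift_operator \<Phi> \<Xi> \<longrightarrow>
       (AE l in lebesgue. trace_class (\<Xi> l)) \<and>
       integrable lebesgue (\<lambda>l. trace_norm (\<Xi> l)) \<and>
       (\<forall>f g. \<forall>\<Delta>\<in>sets borel.
          set_integrable lebesgue {0..1} (\<lambda>s. cinner f (adj K (E s \<Delta> (K g)))) \<and>
          set_integrable lebesgue \<Delta> (\<lambda>l. cinner f (\<Xi> l g)) \<and>
          (LINT s:{0..1}|lebesgue. cinner f (adj K (E s \<Delta> (K g))))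
            = (LINT l:\<Delta>|lebesgue. cinner f (\<Xi> l g))))"
proof -
  have cK: "clinear_op K" using K by (simp add: hilbert_schmidt_def)
  interpret perturbation D H\<^sub>0 K by (rule perturbation.intro[OF H0 cK])
  interpret spectral_averaging D H\<^sub>0 K E
    by unfold_locales (use E in \<open>simp add: Hs_def\<close>)
  have "Hs 0 = H\<^sub>0" by (rule ext) (simp add: Hs_def)
  then have \<Phi>': "\<Phi> z = id_blinfun + M 0 z" if "z \<notin> \<real>" for z
    using \<Phi>[OF that] by (simp add: M_def R_def)
  show ?thesis
  proof (intro conjI allI impI ballI)
    show "\<exists>\<Xi>. is_spectral_shift_operator \<Phi> \<Xi>" by (rule spectral_shift_operator_exists[OF \<Phi>'])
    fix \<Xi> assume \<Xi>: "is_spectral_shift_operator \<Phi> \<Xi>"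
    show "AE l in lebesgue. trace_class (\<Xi> l)" "integrable lebesgue (\<lambda>l. trace_norm (\<Xi> l))"
      using trace_norm_integrable[OF \<Phi>' \<Xi> assms(2)] by blast+
    fix f g :: 'h and \<Delta> :: "real set" assume \<Delta>: "\<Delta> \<in> sets borel"
    have adj: "cinner f (adj K (E s \<Delta> (K g))) = cinner (K f) (E s \<Delta> (K g))" for s
      by (rule cinner_adj_right[OF cK])
    note left = integral_unit_lborel(2,3)[OF integrable_mform[OF \<Delta>, of f g]]
    show "set_integrable lebesgue {0..1} (\<lambda>s. cinner f (adj K (E s \<Delta> (K g))))"
      unfolding adj by (rule left(1))
    have right: "has_bochner_integral lebesgue (\<lambda>l. indicator \<Delta> l *\<^sub>R cinner f (\<Xi> l g)) (mform \<Delta> f g)"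
      by (rule has_integral_spectral_shift_operator[OF \<Phi>' \<Xi> \<Delta>])
    then show "set_integrable lebesgue \<Delta> (\<lambda>l. cinner f (\<Xi> l g))"
      by (simp add: set_integrable_def has_bochner_integral_iff)
    show "(LINT s:{0..1}|lebesgue. cinner f (adj K (E s \<Delta> (K g)))) = (LINT l:\<Delta>|lebesgue. cinner f (\<Xi> l g))"
      unfolding adj left(2) using right by (simp add: set_lebesgue_integral_def[of _ \<Delta>] has_bochner_integral_iff mform_def)
  qed
qed

end
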